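(* Every pseudo-umbilical biharmonic submanifold of dimension four in the unit sphere $\mathbb{S}^6$ has constant mean curvature $|\mathbf{H}|$ on each connected component.
   Context: A submanifold $M^m$ of a Riemannian manifold means an $m$-dimensional smooth manifold with an isometric immersion. $B$ is the second fundamental form, $A_\xi$ the Weingarten (shape) operator in the normal direction $\xi$, $\nabla^\perp$ the normal connection, $\mathbf{H}=\frac1m\sum_{i=1}^m B(e_i,e_i)$ the mean curvature vector field for a local orthonormal frame $\{e_i\}$, and $\Delta^\perp=\sum_i\big(\nabla^\perp_{e_i}\nabla^\perp_{e_i}-\nabla^\perp_{\nabla_{e_i}e_i}\big)$ the (non-positive) normal Laplacian. $M$ is pseudo-umbilical if $A_{\mathbf{H}}=|\mathbf{H}|^2\,\mathrm{Id}$ everywhere on $M$ ($\mathbf{H}$ may vanish). A submanifold $M^m$ of a Riemannian manifold of constant sectional curvature $c$ (here $c=1$) is biharmonic if and only if both $$\Delta^\perp\mathbf{H}-\sum_{i=1}^mB(A_{\mathbf{H}}e_i,e_i)+mc\,\mathbf{H}=0,\qquad m\,\nabla|\mathbf{H}|^2+4\sum_{i=1}^mA_{\nabla^\perp_{e_i}\mathbf{H}}e_i=0$$ hold, where $\nabla|\mathbf H|^2$ is the gradient on $M$. *)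

theory Defs
  imports "HOL-Analysis.Analysis"
begin

section \<open>Smooth maps between open subsets of Euclidean spaces\<close>

primrec times_differentiable_on ::
    "nat \<Rightarrow> 'a::euclidean_space set \<Rightarrow> ('a \<Rightarrow> 'b::real_normed_vector) \<Rightarrow> bool" where
  "times_differentiable_on 0 S f \<longleftrightarrow> continuous_on S f"
| "times_differentiable_on (Suc k) S f \<longleftrightarrow>
     (\<forall>x\<in>S. f differentiable (at x)) \<and>
     (\<forall>v. times_differentiable_on k S (\<lambda>x. frechet_derivative f (at x) v))"

text \<open>\<open>C\<^sup>\<infinity>\<close>; only meant for open \<open>S\<close>.\<close>

definition smooth_on :: "'a::euclidean_space set \<Rightarrow> ('a \<Rightarrow> 'b::real_normed_vector) \<Rightarrow> bool" where
  "smooth_on S f \<longleftrightarrow> (\<forall>k. times_differentiable_on k S f)"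

definition orth_proj :: "'a::euclidean_space set \<Rightarrow> 'a \<Rightarrow> 'a" where
  "orth_proj S v = (THE t. t \<in> S \<and> v - t \<in> S\<^sup>\<bottom>)"


section \<open>Smooth manifolds\<close>

text \<open>
  A chart is a pair \<open>(U, \<psi>)\<close> of an open set and a coordinate map; values of \<open>\<psi>\<close> outside \<open>U\<close> are
  irrelevant. The atlas need not be maximal: smoothness with respect to an atlas agrees with
  smoothness with respect to the maximal atlas containing it.
\<close>

locale smooth_manifold =
  fixes M :: "'a topology"
    and charts :: "('a set \<times> ('a \<Rightarrow> real ^ 'm)) set"
  assumes hausdorff: "Hausdorff_space M"
    and second_countable: "second_countable M"
    and charts_cover: "(\<Union>(U, \<psi>)\<in>charts. U) = topspace M"
    and chart_openin: "\<And>U \<psi>. (U, \<psi>) \<in> charts \<Longrightarrow> openin M U"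
    and chart_open_image: "\<And>U \<psi>. (U, \<psi>) \<in> charts \<Longrightarrow> open (\<psi> ` U)"
    and chart_homeomorphic: "\<And>U \<psi>. (U, \<psi>) \<in> charts \<Longrightarrow>
          homeomorphic_map (subtopology M U) (top_of_set (\<psi> ` U)) \<psi>"
    and chart_transition: "\<And>U \<psi> V \<psi>'. (U, \<psi>) \<in> charts \<Longrightarrow> (V, \<psi>') \<in> charts \<Longrightarrow>
          smooth_on (\<psi> ` (U \<inter> V)) (\<psi>' \<circ> inv_into U \<psi>)"
begin

definition smooth_map_on :: "'a set \<Rightarrow> ('a \<Rightarrow> 'b::real_normed_vector) \<Rightarrow> bool" where
  "smooth_map_on W F \<longleftrightarrow>
     (\<forall>(U, \<psi>)\<in>charts. smooth_on (\<psi> ` (U \<inter> W)) (F \<circ> inv_into U \<psi>))"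

definition chart_at :: "'a \<Rightarrow> 'a set \<times> ('a \<Rightarrow> real ^ 'm)" where
  "chart_at p = (SOME c. c \<in> charts \<and> p \<in> fst c)"

text \<open>
  The differential at \<open>p\<close>, on the tangent space of \<open>M\<close> at \<open>p\<close> identified with \<open>real ^ 'm\<close>
  through \<open>chart_at p\<close>.
\<close>

definition differential :: "('a \<Rightarrow> 'b::real_normed_vector) \<Rightarrow> 'a \<Rightarrow> real ^ 'm \<Rightarrow> 'b" where
  "differential F p =
     (case chart_at p of (U, \<psi>) \<Rightarrow> frechet_derivative (F \<circ> inv_into U \<psi>) (at (\<psi> p)))"

end


section \<open>Submanifolds of the unit sphere\<close>

text \<open>
  \<open>M\<close> carries the metric induced by the immersion \<open>\<phi>\<close>, which is the only one making \<open>\<phi>\<close>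
  isometric. Accordingly a tangent vector of \<open>M\<close> at \<open>p\<close> is represented by its image under
  \<open>d\<phi>\<close>, and vector fields along \<open>\<phi>\<close> (tangent or normal to \<open>M\<close>) are functions
  from \<open>M\<close> to the Euclidean space \<open>'n\<close> containing the sphere.
\<close>

locale sphere_submanifold = smooth_manifold M charts
  for M :: "'a topology"
    and charts :: "('a set \<times> ('a \<Rightarrow> real ^ 'm)) set" +
  fixes \<phi> :: "'a \<Rightarrow> 'n::euclidean_space"
  assumes in_sphere: "\<And>p. p \<in> topspace M \<Longrightarrow> \<phi> p \<in> sphere 0 1"
    and immersion_smooth: "smooth_map_on (topspace M) \<phi>"
    and immersion_inj: "\<And>p. p \<in> topspace M \<Longrightarrow> inj (differential \<phi> p)"
begin

definition tangent_space :: "'a \<Rightarrow> 'n set" where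
  "tangent_space p = range (differential \<phi> p)"

text \<open>The orthogonal complement of the tangent space of \<open>M\<close> inside that of the sphere.\<close>

definition normal_space :: "'a \<Rightarrow> 'n set" where
  "normal_space p = {\<xi> \<in> {\<phi> p}\<^sup>\<bottom>. \<xi> \<in> (tangent_space p)\<^sup>\<bottom>}"

definition dir_deriv :: "'n \<Rightarrow> ('a \<Rightarrow> 'b::real_normed_vector) \<Rightarrow> 'a \<Rightarrow> 'b" where
  "dir_deriv v F p = differential F p (inv (differential \<phi> p) v)"

text \<open>
  In the following definitions \<open>v\<close> is a tangent vector at \<open>p\<close>, while \<open>Y\<close>, \<open>\<xi>\<close>, \<open>V\<close> are vector
  fields defined near \<open>p\<close>. The Levi-Civita connection of the sphere (pulled back along \<open>\<phi>\<close>)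
  is the projection of the Euclidean derivative to the tangent space of the sphere. The Gauss
  formula splits it into the Levi-Civita connection of \<open>M\<close> and the second fundamental form \<open>B\<close>
  (which depends on \<open>Y\<close> only through \<open>Y p\<close>), the Weingarten formula into the shape operator
  \<open>A\<close> and the normal connection.
\<close>

definition sphere_conn :: "'n \<Rightarrow> ('a \<Rightarrow> 'n) \<Rightarrow> 'a \<Rightarrow> 'n" where
  "sphere_conn v V p = orth_proj ({\<phi> p}\<^sup>\<bottom>) (dir_deriv v V p)"

definition tangent_conn :: "'n \<Rightarrow> ('a \<Rightarrow> 'n) \<Rightarrow> 'a \<Rightarrow> 'n" where
  "tangent_conn v Y p = orth_proj (tangent_space p) (sphere_conn v Y p)"

definition second_fundamental_form :: "'n \<Rightarrow> ('a \<Rightarrow> 'n) \<Rightarrow> 'a \<Rightarrow> 'n" where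
  "second_fundamental_form v Y p = orth_proj (normal_space p) (sphere_conn v Y p)"

definition shape_operator :: "('a \<Rightarrow> 'n) \<Rightarrow> 'n \<Rightarrow> 'a \<Rightarrow> 'n" where
  "shape_operator \<xi> v p = - orth_proj (tangent_space p) (sphere_conn v \<xi> p)"

definition normal_conn :: "'n \<Rightarrow> ('a \<Rightarrow> 'n) \<Rightarrow> 'a \<Rightarrow> 'n" where
  "normal_conn v \<xi> p = orth_proj (normal_space p) (sphere_conn v \<xi> p)"

definition gradient :: "('a \<Rightarrow> real) \<Rightarrow> 'a \<Rightarrow> 'n" where
  "gradient f p =
     (THE g. g \<in> tangent_space p \<and> (\<forall>v\<in>tangent_space p. g \<bullet> v = dir_deriv v f p))"

definition orthonormal_frame_on :: "'a set \<Rightarrow> ('m \<Rightarrow> 'a \<Rightarrow> 'n) \<Rightarrow> bool" where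
  "orthonormal_frame_on W e \<longleftrightarrow>
     openin M W \<and>
     (\<forall>i. smooth_map_on W (e i)) \<and>
     (\<forall>p\<in>W. \<forall>i. e i p \<in> tangent_space p) \<and>
     (\<forall>p\<in>W. \<forall>i j. e i p \<bullet> e j p = (if i = j then 1 else 0))"

text \<open>The common value given by all local orthonormal frames around \<open>p\<close>.\<close>

definition mean_curvature :: "'a \<Rightarrow> 'n" where
  "mean_curvature p =
     (THE h. \<exists>W e. orthonormal_frame_on W e \<and> p \<in> W \<and>
        h = (1 / real CARD('m)) *\<^sub>R (\<Sum>i\<in>UNIV. second_fundamental_form (e i p) (e i) p))"

definition pseudo_umbilical :: bool where
  "pseudo_umbilical \<longleftrightarrow>
     (\<forall>p\<in>topspace M. \<forall>v\<in>tangent_space p.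
        shape_operator mean_curvature v p = (norm (mean_curvature p))\<^sup>2 *\<^sub>R v)"

text \<open>The normal Laplacian computed in the local orthonormal frame \<open>e\<close>.\<close>

definition normal_laplacian :: "('m \<Rightarrow> 'a \<Rightarrow> 'n) \<Rightarrow> ('a \<Rightarrow> 'n) \<Rightarrow> 'a \<Rightarrow> 'n" where
  "normal_laplacian e \<xi> p =
     (\<Sum>i\<in>UNIV. normal_conn (e i p) (\<lambda>q. normal_conn (e i q) \<xi> q) p
                - normal_conn (tangent_conn (e i p) (e i) p) \<xi> p)"

text \<open>
  The vanishing of the normal and tangential components of the bitension field, for an ambient
  space of constant curvature \<open>1\<close>.
\<close>

definition biharmonic :: bool where
  "biharmonic \<longleftrightarrow>
     (\<forall>W e. orthonormal_frame_on W e \<longrightarrow> (\<forall>p\<in>W.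
        normal_laplacian e mean_curvature p
          - (\<Sum>i\<in>UNIV. second_fundamental_form (shape_operator mean_curvature (e i p) p) (e i) p)
          + real CARD('m) *\<^sub>R mean_curvature p = 0 \<and>
        real CARD('m) *\<^sub>R gradient (\<lambda>q. (norm (mean_curvature q))\<^sup>2) p
          + 4 *\<^sub>R (\<Sum>i\<in>UNIV.
              shape_operator (\<lambda>q. normal_conn (e i q) mean_curvature q) (e i p) p) = 0))"

end

end

theory Submission
  imports Defs "HOL-Computational_Algebra.Polynomial"
begin

text \<open>
  In dimension four the tangential biharmonic equation follows from pseudo-umbilicity, so only the
  normal one carries information. Suppose \<open>h = |H|\<close> had a non-zero differential at some point. Near that
  point the normal bundle has the orthonormal frame \<open>\<eta> = H / h\<close>, \<open>\<zeta>\<close> with connection form \<open>\<omega>\<close>. The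
  Codazzi equation for \<open>\<eta>\<close> forces \<open>\<omega> = w \<theta>\<close> and \<open>dh = \<mu> w \<theta>\<close> for a unit one-form \<open>\<theta>\<close> dual to a unit
  vector field \<open>E\<close>, and the shape operator of \<open>\<zeta>\<close> has eigenvalues \<open>- 3 \<mu>\<close> (on \<open>E\<close>) and \<open>\<mu>\<close> (three times).
  The Codazzi equation for \<open>\<zeta>\<close> and the Gauss equation show that \<open>E\<close> is geodesic with umbilical orthogonal
  leaves of curvature \<open>\<kappa>\<close>. With the normal biharmonic equation, \<open>h\<close>, \<open>\<mu>\<close>, \<open>w\<close>, \<open>\<kappa>\<close> satisfy along \<open>E\<close> a
  polynomial system of four first-order equations together with one polynomial constraint. Differentiating
  the constraint repeatedly and eliminating leaves finitely many values for \<open>\<mu>\<^sup>2 / h\<^sup>2\<close>; this ratio is then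
  constant, which contradicts the system.
\<close>


section \<open>Calculus of smooth maps\<close>

text \<open>Why four: tracing the Codazzi equation of a pseudo-umbilical M^m gives sum_i
  A_{nabla^perp_{e_i} H} e_i = (1 - m/2) grad |H|^2, so the tangential equation reads (4 - m) grad
  |H|^2 = 0 and degenerates exactly for m = 4. No curvature tensor is set up. All fields take values
  in the flat space R^7 and are read in one chart, so the Gauss, Codazzi and Ricci equations are
  components of the symmetry of second derivatives of \<open>\<Phi>\<close>, \<open>\<eta>\<close>,
  \<open>\<zeta>\<close> and \<open>E\<close> in two constant coordinate directions, where no
  bracket terms arise. The obstacle in the elimination is the ambient curvature 1, which enters the
  constraint and the derivative of \<open>\<kappa>\<close> and breaks the scaling. Differentiating
  the constraint and using the constraint again cancels it. The homogeneous relation that is left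
  expresses w^2 / h^2 through the scale-invariant ratios \<open>\<rho>\<close> and
  \<open>\<sigma>\<close>, which therefore obey a closed planar system. Two further differentiations
  give two polynomial relations between \<open>\<rho>\<close> and \<open>\<sigma>\<close>.\<close>

lemma times_differentiable_on_cong:
  assumes "open S" "\<And>x. x \<in> S \<Longrightarrow> f x = g x"
  shows "times_differentiable_on k S f \<longleftrightarrow> times_differentiable_on k S g"
  using assms(2)
proof (induction k arbitrary: f g)
  case 0
  then show ?case by (simp cong: continuous_on_cong)
next
  case (Suc k)
  have d: "(f has_derivative f') (at x) \<longleftrightarrow> (g has_derivative f') (at x)" if "x \<in> S" for x f'
    using has_derivative_transform_within_open[OF _ assms(1) that, of f f' UNIV g]
      has_derivative_transform_within_open[OF _ assms(1) that, of g f' UNIV f] Suc.prems by auto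
  then have "f differentiable (at x) \<longleftrightarrow> g differentiable (at x)" if "x \<in> S" for x
    using that by (simp add: differentiable_def)
  moreover have "times_differentiable_on k S (\<lambda>x. frechet_derivative f (at x) v) \<longleftrightarrow>
      times_differentiable_on k S (\<lambda>x. frechet_derivative g (at x) v)" for v
    by (rule Suc.IH) (simp add: frechet_derivative_def d)
  ultimately show ?case by simp
qed

lemma times_differentiable_on_Suc_imp:
  "times_differentiable_on (Suc k) S f \<Longrightarrow> times_differentiable_on k S f"
proof (induction k arbitrary: f)
  case 0
  then show ?case
    by (auto intro!: continuous_at_imp_continuous_on differentiable_imp_continuous_within)
next
  case (Suc k)
  then show ?case by (metis times_differentiable_on.simps(2))
qed

lemma times_differentiable_on_subset:
  "times_differentiable_on k S f \<Longrightarrow> T \<subseteq> S \<Longrightarrow> times_differentiable_on k T f"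
  by (induction k arbitrary: f) (auto intro: continuous_on_subset)

lemma times_differentiable_on_const: "times_differentiable_on k S (\<lambda>x. c)"
  by (induction k arbitrary: c) auto

lemma frechet_derivative_eq:
  "(f has_derivative f') (at x) \<Longrightarrow> frechet_derivative f (at x) v = f' v"
  by (metis frechet_derivative_at)

lemma times_differentiable_on_bounded_linear:
  assumes "bounded_linear L"
  shows "times_differentiable_on k S f \<Longrightarrow> open S \<Longrightarrow> times_differentiable_on k S (\<lambda>x. L (f x))"
proof (induction k arbitrary: f)
  case 0
  then show ?case using bounded_linear.continuous_on[OF assms] by simp
next
  case (Suc k)
  have d: "((\<lambda>x. L (f x)) has_derivative (\<lambda>v. L (frechet_derivative f (at x) v))) (at x)"
    if "x \<in> S" for x
    using Suc.prems that by (intro bounded_linear.has_derivative[OF assms])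
      (simp add: frechet_derivative_works[symmetric])
  have "times_differentiable_on k S (\<lambda>x. frechet_derivative (\<lambda>x. L (f x)) (at x) v)" for v
  proof -
    have "times_differentiable_on k S (\<lambda>x. L (frechet_derivative f (at x) v))"
      using Suc by auto
    then show ?thesis
      by (subst times_differentiable_on_cong[OF Suc.prems(2)]) (auto simp: frechet_derivative_eq[OF d])
  qed
  then show ?case using d by (auto simp: differentiable_def)
qed

lemma times_differentiable_on_add:
  "\<lbrakk>times_differentiable_on k S f; times_differentiable_on k S g; open S\<rbrakk>
    \<Longrightarrow> times_differentiable_on k S (\<lambda>x. f x + g x)"
proof (induction k arbitrary: f g)
  case 0
  then show ?case by (auto intro!: continuous_intros)
next
  case (Suc k)
  have d: "((\<lambda>x. f x + g x) has_derivative
      (\<lambda>v. frechet_derivative f (at x) v + frechet_derivative g (at x) v)) (at x)"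
    if "x \<in> S" for x
    using Suc.prems that by (intro has_derivative_add)
      (simp_all add: frechet_derivative_works[symmetric])
  have "times_differentiable_on k S (\<lambda>x. frechet_derivative (\<lambda>x. f x + g x) (at x) v)" for v
  proof -
    have "times_differentiable_on k S
        (\<lambda>x. frechet_derivative f (at x) v + frechet_derivative g (at x) v)"
      using Suc by auto
    then show ?thesis
      by (subst times_differentiable_on_cong[OF Suc.prems(3)]) (auto simp: frechet_derivative_eq[OF d])
  qed
  then show ?case using d by (auto simp: differentiable_def)
qed

lemma times_differentiable_on_bounded_bilinear:
  assumes "bounded_bilinear B"
  shows "\<lbrakk>times_differentiable_on k S f; times_differentiable_on k S g; open S\<rbrakk>
    \<Longrightarrow> times_differentiable_on k S (\<lambda>x. B (f x) (g x))"
proof (induction k arbitrary: f g)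
  case 0
  then show ?case by (auto intro!: bounded_bilinear.continuous_on[OF assms])
next
  case (Suc k)
  have d: "((\<lambda>x. B (f x) (g x)) has_derivative
      (\<lambda>v. B (f x) (frechet_derivative g (at x) v) + B (frechet_derivative f (at x) v) (g x))) (at x)"
    if "x \<in> S" for x
    using Suc.prems that by (intro bounded_bilinear.FDERIV[OF assms])
      (simp_all add: frechet_derivative_works[symmetric])
  have "times_differentiable_on k S (\<lambda>x. frechet_derivative (\<lambda>x. B (f x) (g x)) (at x) v)" for v
  proof -
    have "times_differentiable_on k S
        (\<lambda>x. B (f x) (frechet_derivative g (at x) v) + B (frechet_derivative f (at x) v) (g x))"
      by (intro times_differentiable_on_add Suc.IH)
        (use Suc.prems times_differentiable_on_Suc_imp in \<open>auto simp del: times_differentiable_on.simps(1)\<close>)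
    then show ?thesis
      by (subst times_differentiable_on_cong[OF Suc.prems(3)]) (auto simp: frechet_derivative_eq[OF d])
  qed
  then show ?case using d by (auto simp: differentiable_def)
qed

lemma times_differentiable_on_sum:
  assumes "\<And>i. i \<in> I \<Longrightarrow> times_differentiable_on k S (f i)" "open S"
  shows "times_differentiable_on k S (\<lambda>x. \<Sum>i\<in>I. f i x)"
  using assms(1)
  by (induction I rule: infinite_finite_induct)
    (auto intro!: times_differentiable_on_add times_differentiable_on_const assms(2))

text \<open>The chain rule applies the derivative of \<open>f\<close> to a moving vector, while
  \<open>times_differentiable_on\<close> speaks of fixed directions. Expanding that vector in
  \<open>Basis\<close> gives partial derivatives of \<open>f\<close> at \<open>g x\<close> with
  scalar coefficients, and to these the induction hypothesis applies.\<close>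

lemma times_differentiable_on_compose:
  fixes g :: "'a::euclidean_space \<Rightarrow> 'b::euclidean_space"
  assumes "open S" "open T" "g ` S \<subseteq> T"
  shows "\<lbrakk>times_differentiable_on k T f; times_differentiable_on k S g\<rbrakk>
    \<Longrightarrow> times_differentiable_on k S (\<lambda>x. f (g x))"
proof (induction k arbitrary: f)
  case 0
  then show ?case using assms(3) continuous_on_compose2 by auto
next
  case (Suc k)
  have d: "((\<lambda>x. f (g x)) has_derivative
      (\<lambda>v. frechet_derivative f (at (g x)) (frechet_derivative g (at x) v))) (at x)"
    if "x \<in> S" for x
    using Suc.prems that assms(3)
      diff_chain_at[of g "frechet_derivative g (at x)" x f "frechet_derivative f (at (g x))"]
    by (auto simp: o_def frechet_derivative_works[symmetric])
  have e: "frechet_derivative f (at (g x)) (frechet_derivative g (at x) v) =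
      (\<Sum>b\<in>Basis. (frechet_derivative g (at x) v \<bullet> b) *\<^sub>R frechet_derivative f (at (g x)) b)"
    if "x \<in> S" for x v
  proof -
    have "linear (frechet_derivative f (at (g x)))"
      using Suc.prems that assms(3) by (auto intro!: linear_frechet_derivative)
    then show ?thesis
      using linear_sum euclidean_representation[of "frechet_derivative g (at x) v"]
      by (smt (verit, best) linear_cmul sum.cong)
  qed
  have "times_differentiable_on k S (\<lambda>x. frechet_derivative (\<lambda>x. f (g x)) (at x) v)" for v
  proof -
    have "times_differentiable_on k S
        (\<lambda>x. \<Sum>b\<in>Basis. (frechet_derivative g (at x) v \<bullet> b) *\<^sub>R frechet_derivative f (at (g x)) b)"
      by (intro times_differentiable_on_sum
          times_differentiable_on_bounded_bilinear[OF bounded_bilinear_scaleR]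
          times_differentiable_on_bounded_linear[OF bounded_linear_inner_left]
          Suc.IH assms(1) times_differentiable_on_Suc_imp[OF Suc.prems(2)])
        (use Suc.prems in auto)
    then show ?thesis
      by (subst times_differentiable_on_cong[OF assms(1)])
        (auto simp: frechet_derivative_eq[OF d] e)
  qed
  then show ?case using d by (auto simp: differentiable_def)
qed

lemma smooth_on_differentiable: "smooth_on S f \<Longrightarrow> x \<in> S \<Longrightarrow> f differentiable (at x)"
  by (metis smooth_on_def times_differentiable_on.simps(2))

lemma smooth_on_has_derivative:
  "smooth_on S f \<Longrightarrow> x \<in> S \<Longrightarrow> (f has_derivative frechet_derivative f (at x)) (at x)"
  using smooth_on_differentiable frechet_derivative_works by blast

lemma smooth_on_linear: "smooth_on S f \<Longrightarrow> x \<in> S \<Longrightarrow> linear (frechet_derivative f (at x))"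
  by (simp add: linear_frechet_derivative smooth_on_differentiable)

lemma smooth_on_continuous_on: "smooth_on S f \<Longrightarrow> continuous_on S f"
  unfolding smooth_on_def by (metis times_differentiable_on.simps(1))

lemma smooth_on_derivative:
  "smooth_on S f \<Longrightarrow> smooth_on S (\<lambda>x. frechet_derivative f (at x) v)"
  unfolding smooth_on_def by (metis times_differentiable_on.simps(2))

lemma smooth_on_cong:
  "open S \<Longrightarrow> (\<And>x. x \<in> S \<Longrightarrow> f x = g x) \<Longrightarrow> smooth_on S f \<longleftrightarrow> smooth_on S g"
  unfolding smooth_on_def using times_differentiable_on_cong by blast

lemma smooth_on_subset: "smooth_on S f \<Longrightarrow> T \<subseteq> S \<Longrightarrow> smooth_on T f"
  unfolding smooth_on_def using times_differentiable_on_subset by blast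

lemma smooth_on_const: "smooth_on S (\<lambda>x. c)"
  unfolding smooth_on_def using times_differentiable_on_const by blast

lemma smooth_on_bounded_linear:
  "bounded_linear L \<Longrightarrow> smooth_on S f \<Longrightarrow> open S \<Longrightarrow> smooth_on S (\<lambda>x. L (f x))"
  unfolding smooth_on_def using times_differentiable_on_bounded_linear by blast

lemma smooth_on_bounded_bilinear:
  "\<lbrakk>bounded_bilinear B; smooth_on S f; smooth_on S g; open S\<rbrakk> \<Longrightarrow> smooth_on S (\<lambda>x. B (f x) (g x))"
  unfolding smooth_on_def by (blast intro: times_differentiable_on_bounded_bilinear)

lemmas smooth_on_scaleR = smooth_on_bounded_bilinear[OF bounded_bilinear_scaleR]
lemmas smooth_on_mult = smooth_on_bounded_bilinear[OF bounded_bilinear_mult]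
lemmas smooth_on_inner = smooth_on_bounded_bilinear[OF bounded_bilinear_inner]
lemmas smooth_on_minus = smooth_on_bounded_linear[OF bounded_linear_minus[OF bounded_linear_ident]]

lemma smooth_on_add:
  "\<lbrakk>smooth_on S f; smooth_on S g; open S\<rbrakk> \<Longrightarrow> smooth_on S (\<lambda>x. f x + g x)"
  unfolding smooth_on_def using times_differentiable_on_add by blast

lemma smooth_on_diff:
  "\<lbrakk>smooth_on S f; smooth_on S g; open S\<rbrakk> \<Longrightarrow> smooth_on S (\<lambda>x. f x - g x)"
  using smooth_on_add[OF _ smooth_on_minus[of S g], of f] by simp

lemma smooth_on_sum:
  "\<lbrakk>\<And>i. i \<in> I \<Longrightarrow> smooth_on S (f i); open S\<rbrakk> \<Longrightarrow> smooth_on S (\<lambda>x. \<Sum>i\<in>I. f i x)"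
  unfolding smooth_on_def by (auto intro!: times_differentiable_on_sum)

lemma smooth_on_power: "smooth_on S f \<Longrightarrow> open S \<Longrightarrow> smooth_on S (\<lambda>x. (f x :: real) ^ n)"
  by (induction n) (simp_all add: smooth_on_const smooth_on_mult)

lemma smooth_on_compose:
  fixes g :: "'a::euclidean_space \<Rightarrow> 'b::euclidean_space"
  shows "\<lbrakk>smooth_on T f; smooth_on S g; open S; open T; g ` S \<subseteq> T\<rbrakk> \<Longrightarrow> smooth_on S (\<lambda>x. f (g x))"
  unfolding smooth_on_def using times_differentiable_on_compose by blast

text \<open>The derivative is a product of constants and \<open>inverse\<close> itself, so the
  induction closes with the product rule.\<close>

lemma times_differentiable_on_inverse: "times_differentiable_on k (- {0::real}) inverse"
proof (induction k)
  case 0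
  show ?case by (auto intro!: continuous_intros)
next
  case (Suc k)
  have d: "(inverse has_derivative (\<lambda>v. - (inverse x * v * inverse x))) (at x)" if "x \<noteq> 0" for x :: real
    using that by (rule has_derivative_inverse')
  have "times_differentiable_on k (- {0::real}) (\<lambda>x. - (inverse x * v * inverse x))" for v
    by (intro times_differentiable_on_bounded_linear[OF bounded_linear_minus[OF bounded_linear_ident]]
        times_differentiable_on_bounded_bilinear[OF bounded_bilinear_mult] Suc
        times_differentiable_on_const) auto
  then have "times_differentiable_on k (- {0::real}) (\<lambda>x. frechet_derivative inverse (at x) v)" for v
    by (subst times_differentiable_on_cong) (auto simp: frechet_derivative_eq[OF d])
  then show ?case using d by (auto simp: differentiable_def)
qed

lemma smooth_on_inverse:
  assumes "smooth_on S f" "open S" "\<And>x. x \<in> S \<Longrightarrow> f x \<noteq> 0"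
  shows "smooth_on S (\<lambda>x. inverse (f x :: real))"
  by (rule smooth_on_compose[OF _ assms(1,2), of "-{0}"])
    (use assms in \<open>auto simp: smooth_on_def times_differentiable_on_inverse\<close>)

lemma smooth_on_divide:
  assumes "smooth_on S f" "smooth_on S g" "open S" "\<And>x. x \<in> S \<Longrightarrow> g x \<noteq> 0"
  shows "smooth_on S (\<lambda>x. f x / g x :: real)"
  unfolding divide_inverse by (intro smooth_on_mult smooth_on_inverse assms)

text \<open>The derivative is a multiple of the reciprocal of \<open>sqrt\<close> itself, so the
  induction closes by composition with \<open>inverse\<close>.\<close>

lemma times_differentiable_on_sqrt: "times_differentiable_on k {0<..} sqrt"
proof (induction k)
  case 0
  show ?case by (auto intro!: continuous_intros)
next
  case (Suc k)
  have d: "(sqrt has_derivative (\<lambda>v. v * (inverse (sqrt x) * (1/2)))) (at x)" if "x > 0" for x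
    using DERIV_real_sqrt[OF that] by (auto simp: has_field_derivative_def elim!: has_derivative_eq_rhs)
  have "times_differentiable_on k {0<..} (\<lambda>x. v * (inverse (sqrt x) * (1/2)))" for v
    by (intro times_differentiable_on_bounded_bilinear[OF bounded_bilinear_mult] Suc
        times_differentiable_on_compose[OF _ _ _ times_differentiable_on_inverse]
        times_differentiable_on_const) auto
  then have "times_differentiable_on k {0<..} (\<lambda>x. frechet_derivative sqrt (at x) v)" for v
    by (subst times_differentiable_on_cong) (auto simp: frechet_derivative_eq[OF d])
  then show ?case using d by (auto simp: differentiable_def)
qed

lemma smooth_on_sqrt:
  assumes "smooth_on S f" "open S" "\<And>x. x \<in> S \<Longrightarrow> f x > 0"
  shows "smooth_on S (\<lambda>x. sqrt (f x))"
  by (rule smooth_on_compose[OF _ assms(1,2), of "{0<..}"])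
    (use assms in \<open>auto simp: smooth_on_def times_differentiable_on_sqrt\<close>)

lemma linear_eq_sum_Basis:
  assumes "linear f"
  shows "f v = (\<Sum>b\<in>Basis. (v \<bullet> b) *\<^sub>R f b)"
  by (metis (no_types, lifting) assms euclidean_representation linear_cmul linear_sum sum.cong)

lemma smooth_on_directional_derivative:
  assumes "smooth_on S f" "smooth_on S v" "open S"
  shows "smooth_on S (\<lambda>x. frechet_derivative f (at x) (v x))"
proof -
  have "smooth_on S (\<lambda>x. \<Sum>b\<in>Basis. (v x \<bullet> b) *\<^sub>R frechet_derivative f (at x) b)"
    by (intro smooth_on_sum smooth_on_scaleR smooth_on_inner smooth_on_derivative smooth_on_const assms)
  then show ?thesis
    by (subst smooth_on_cong[OF assms(3)])
      (use linear_eq_sum_Basis smooth_on_linear[OF assms(1)] in auto)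
qed

lemma frechet_derivative_cong_open:
  assumes "open S" "x \<in> S" "\<And>y. y \<in> S \<Longrightarrow> f y = g y"
  shows "frechet_derivative f (at x) = frechet_derivative g (at x)"
proof -
  have "(f has_derivative f') (at x) \<longleftrightarrow> (g has_derivative f') (at x)" for f'
    using has_derivative_transform_within_open[OF _ assms(1,2), of f f' UNIV g]
      has_derivative_transform_within_open[OF _ assms(1,2), of g f' UNIV f] assms(3) by auto
  then show ?thesis by (simp add: frechet_derivative_def)
qed

lemma frechet_derivative_bilinear_at:
  assumes "bounded_bilinear B" "f differentiable (at x)" "g differentiable (at x)"
  shows "frechet_derivative (\<lambda>x. B (f x) (g x)) (at x) v =
    B (f x) (frechet_derivative g (at x) v) + B (frechet_derivative f (at x) v) (g x)"
  by (rule frechet_derivative_eq, rule bounded_bilinear.FDERIV[OF assms(1)])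
    (use assms in \<open>auto simp: frechet_derivative_works[symmetric]\<close>)

lemmas frechet_derivative_scaleR_at = frechet_derivative_bilinear_at[OF bounded_bilinear_scaleR]
lemmas frechet_derivative_mult_at = frechet_derivative_bilinear_at[OF bounded_bilinear_mult]
lemmas frechet_derivative_inner_at = frechet_derivative_bilinear_at[OF bounded_bilinear_inner]

lemma frechet_derivative_add_at:
  assumes "f differentiable (at x)" "g differentiable (at x)"
  shows "frechet_derivative (\<lambda>x. f x + g x) (at x) v =
    frechet_derivative f (at x) v + frechet_derivative g (at x) v"
  by (rule frechet_derivative_eq, rule has_derivative_add)
    (use assms in \<open>auto simp: frechet_derivative_works[symmetric]\<close>)

lemma frechet_derivative_diff_at:
  assumes "f differentiable (at x)" "g differentiable (at x)"
  shows "frechet_derivative (\<lambda>x. f x - g x) (at x) v =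
    frechet_derivative f (at x) v - frechet_derivative g (at x) v"
  by (rule frechet_derivative_eq, rule has_derivative_diff)
    (use assms in \<open>auto simp: frechet_derivative_works[symmetric]\<close>)

lemma frechet_derivative_minus_at:
  assumes "f differentiable (at x)"
  shows "frechet_derivative (\<lambda>x. - f x) (at x) v = - frechet_derivative f (at x) v"
  by (rule frechet_derivative_eq, rule has_derivative_minus)
    (use assms in \<open>auto simp: frechet_derivative_works[symmetric]\<close>)


section \<open>Second derivatives and orthonormal frames\<close>

text \<open>The mean value theorem applied twice to the second difference over the parallelogram
  spanned by \<open>s *\<^sub>R v\<close> and \<open>s *\<^sub>R w\<close>: first along
  \<open>v\<close>, then along \<open>w\<close>.\<close>

lemma second_difference:
  fixes f :: "'a::euclidean_space \<Rightarrow> real"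
  assumes f: "smooth_on S f" and S: "cball x (s * (norm v + norm w)) \<subseteq> S" and s: "s > 0"
  obtains y where "y \<in> cball x (s * (norm v + norm w))"
    "f (x + s *\<^sub>R v + s *\<^sub>R w) - f (x + s *\<^sub>R v) - f (x + s *\<^sub>R w) + f x =
      s * s * frechet_derivative (\<lambda>z. frechet_derivative f (at z) v) (at y) w"
proof -
  have inS: "x + p *\<^sub>R v + q *\<^sub>R w \<in> cball x (s * (norm v + norm w))"
    if "0 \<le> p" "p \<le> s" "0 \<le> q" "q \<le> s" for p q
  proof -
    have "norm (p *\<^sub>R v + q *\<^sub>R w) \<le> p * norm v + q * norm w"
      using norm_triangle_ineq[of "p *\<^sub>R v" "q *\<^sub>R w"] that by simp
    also have "\<dots> \<le> s * norm v + s * norm w"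
      using that by (intro add_mono mult_right_mono) auto
    finally show ?thesis
      by (simp add: dist_norm algebra_simps norm_minus_commute)
  qed
  define g where "g p = f (x + p *\<^sub>R v + s *\<^sub>R w) - f (x + p *\<^sub>R v + 0 *\<^sub>R w)" for p
  let ?fv = "\<lambda>z. frechet_derivative f (at z) v"
  have line: "DERIV (\<lambda>p. F (z + p *\<^sub>R u)) p :> frechet_derivative F (at (z + p *\<^sub>R u)) u"
    if "smooth_on S F" "z + p *\<^sub>R u \<in> S" for F :: "'a \<Rightarrow> real" and z u p
  proof -
    have "((\<lambda>p. F (z + p *\<^sub>R u)) has_derivative
        (\<lambda>h. frechet_derivative F (at (z + p *\<^sub>R u)) (h *\<^sub>R u))) (at p)"
      by (rule has_derivative_compose[of "\<lambda>p. z + p *\<^sub>R u" _ p UNIV F, OF _ smooth_on_has_derivative[OF that]])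
        (auto intro!: derivative_eq_intros)
    then show ?thesis
      using linear_cmul[OF smooth_on_linear[OF that]]
      by (auto simp: has_field_derivative_def fun_eq_iff elim!: has_derivative_eq_rhs)
  qed
  have "DERIV g p :> ?fv (x + p *\<^sub>R v + s *\<^sub>R w) - ?fv (x + p *\<^sub>R v + 0 *\<^sub>R w)"
    if "0 \<le> p" "p \<le> s" for p
  proof -
    have "(\<lambda>p. f ((x + q *\<^sub>R w) + p *\<^sub>R v)) = (\<lambda>p. f (x + p *\<^sub>R v + q *\<^sub>R w))" for q
      by (simp add: algebra_simps)
    then have "DERIV (\<lambda>p. f (x + p *\<^sub>R v + q *\<^sub>R w)) p :> ?fv (x + p *\<^sub>R v + q *\<^sub>R w)"
      if "0 \<le> q" "q \<le> s" for q
      using line[OF f, of "x + q *\<^sub>R w" p v] inS[of p q] that \<open>0 \<le> p\<close> \<open>p \<le> s\<close> S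
      by (auto simp: algebra_simps)
    from DERIV_diff[OF this this, of s 0] show ?thesis
      using s unfolding g_def by auto
  qed
  from MVT2[OF s this] obtain p where p: "0 < p" "p < s"
    and gp: "g s - g 0 = s * (?fv (x + p *\<^sub>R v + s *\<^sub>R w) - ?fv (x + p *\<^sub>R v + 0 *\<^sub>R w))" by auto
  have "DERIV (\<lambda>q. ?fv (x + p *\<^sub>R v + q *\<^sub>R w)) q :>
      frechet_derivative ?fv (at (x + p *\<^sub>R v + q *\<^sub>R w)) w"
    if "0 \<le> q" "q \<le> s" for q
    using line[OF smooth_on_derivative[OF f]] inS[of p q] that p S by auto
  from MVT2[OF s this] obtain q where q: "0 < q" "q < s"
    and gq: "?fv (x + p *\<^sub>R v + s *\<^sub>R w) - ?fv (x + p *\<^sub>R v + 0 *\<^sub>R w) =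
      s * frechet_derivative ?fv (at (x + p *\<^sub>R v + q *\<^sub>R w)) w" by auto
  show ?thesis
    by (rule that[OF inS[of p q]]) (use p q gp gq in \<open>auto simp: g_def algebra_simps\<close>)
qed

text \<open>The second difference is symmetric in \<open>v\<close> and \<open>w\<close>, so the two
  mixed derivatives share a value, taken at points \<open>y\<close> and \<open>z\<close> arbitrarily
  close to \<open>x\<close>; continuity carries the equality to \<open>x\<close>.\<close>

lemma symmetric_second_derivative_real:
  fixes f :: "'a::euclidean_space \<Rightarrow> real"
  assumes f: "smooth_on S f" and S: "open S" "x \<in> S"
  shows "frechet_derivative (\<lambda>z. frechet_derivative f (at z) v) (at x) w =
    frechet_derivative (\<lambda>z. frechet_derivative f (at z) w) (at x) v"
proof (rule ccontr)
  let ?A = "\<lambda>v w y. frechet_derivative (\<lambda>z. frechet_derivative f (at z) v) (at y) w"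
  assume ne: "?A v w x \<noteq> ?A w v x"
  \<comment> \<open>Half the gap: no number can lie within less than \<open>e\<close> of both mixed
    derivatives at \<open>x\<close>.\<close>
  define e where "e = \<bar>?A v w x - ?A w v x\<bar> / 2"
  have e: "e > 0" using ne by (simp add: e_def)
  have "\<exists>d>0. \<forall>y\<in>S. dist y x < d \<longrightarrow> dist (?A v w y) (?A v w x) < e" for v w
    using smooth_on_continuous_on[OF smooth_on_derivative[OF smooth_on_derivative[OF f]]] S(2) e
    unfolding continuous_on_iff by blast
  then obtain d1 d2 where d: "d1 > 0" "d2 > 0"
    and d1: "\<And>y. y \<in> S \<Longrightarrow> dist y x < d1 \<Longrightarrow> dist (?A v w y) (?A v w x) < e"
    and d2: "\<And>y. y \<in> S \<Longrightarrow> dist y x < d2 \<Longrightarrow> dist (?A w v y) (?A w v x) < e" by metis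
  obtain r where r: "r > 0" "cball x r \<subseteq> S" using S open_contains_cball by blast
  define m where "m = min r (min d1 d2) / 2"
  define s where "s = m / (norm v + norm w + 1)"
  have m: "m > 0" "m < d1" "m < d2" "m \<le> r" using d r by (auto simp: m_def)
  have s: "s > 0" unfolding s_def using m by (simp add: add_nonneg_pos)
  have sm: "s * (norm v + norm w) \<le> m"
    unfolding s_def using m by (simp add: divide_simps add_nonneg_pos)
  then have sub: "cball x (s * (norm v + norm w)) \<subseteq> S" using r m by auto
  obtain y where y: "y \<in> cball x (s * (norm v + norm w))"
    "f (x + s *\<^sub>R v + s *\<^sub>R w) - f (x + s *\<^sub>R v) - f (x + s *\<^sub>R w) + f x = s * s * ?A v w y"
    using second_difference[OF f sub s] by blast
  obtain z where z: "z \<in> cball x (s * (norm w + norm v))"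
    "f (x + s *\<^sub>R w + s *\<^sub>R v) - f (x + s *\<^sub>R w) - f (x + s *\<^sub>R v) + f x = s * s * ?A w v z"
    using second_difference[OF f _ s, of x w v] sub by (metis add.commute)
  have "x + s *\<^sub>R v + s *\<^sub>R w = x + s *\<^sub>R w + s *\<^sub>R v" by simp
  then have "s * s * ?A v w y = s * s * ?A w v z" using y(2) z(2) by (smt (verit))
  then have eq: "?A v w y = ?A w v z" using s by simp
  have "dist (?A v w y) (?A v w x) < e" "dist (?A w v z) (?A w v x) < e"
    using y(1) z(1) sub sm m by (intro d1 d2; force simp: dist_commute add.commute)+
  moreover have "\<bar>p - q\<bar> < \<bar>q - r\<bar> / 2 \<Longrightarrow> \<bar>p - r\<bar> < \<bar>q - r\<bar> / 2 \<Longrightarrow> False" for p q r :: real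
    by (auto simp: abs_if field_simps split: if_splits)
  ultimately show False using eq unfolding e_def dist_real_def by metis
qed

lemma symmetric_second_derivative:
  fixes f :: "'a::euclidean_space \<Rightarrow> 'b::euclidean_space"
  assumes f: "smooth_on S f" and S: "open S" "x \<in> S"
  shows "frechet_derivative (\<lambda>z. frechet_derivative f (at z) v) (at x) w =
    frechet_derivative (\<lambda>z. frechet_derivative f (at z) w) (at x) v"
proof (rule euclidean_eqI)
  fix b :: 'b
  have in1: "frechet_derivative (\<lambda>z. F z \<bullet> b) (at z) u = frechet_derivative F (at z) u \<bullet> b"
    if "smooth_on S F" "z \<in> S" for F :: "'a \<Rightarrow> 'b" and z u
    by (rule frechet_derivative_eq)
      (rule bounded_linear.has_derivative[OF bounded_linear_inner_left smooth_on_has_derivative[OF that]])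
  have in2: "frechet_derivative (\<lambda>z. frechet_derivative (\<lambda>z. f z \<bullet> b) (at z) v) (at x) w =
      frechet_derivative (\<lambda>z. frechet_derivative f (at z) v) (at x) w \<bullet> b" for v w
    using frechet_derivative_cong_open[OF S, of "\<lambda>z. frechet_derivative (\<lambda>z. f z \<bullet> b) (at z) v"
        "\<lambda>z. frechet_derivative f (at z) v \<bullet> b"]
    by (simp add: in1 f S smooth_on_derivative)
  have "smooth_on S (\<lambda>z. f z \<bullet> b)"
    by (intro smooth_on_inner f smooth_on_const S)
  from symmetric_second_derivative_real[OF this S] show
    "frechet_derivative (\<lambda>z. frechet_derivative f (at z) v) (at x) w \<bullet> b =
     frechet_derivative (\<lambda>z. frechet_derivative f (at z) w) (at x) v \<bullet> b"
    by (simp add: in2)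
qed

lemma orthonormal_expansion:
  fixes B :: "'a::euclidean_space set"
  assumes orth: "\<And>b c. b \<in> B \<Longrightarrow> c \<in> B \<Longrightarrow> b \<bullet> c = (if b = c then 1 else 0)"
    and card: "card B = DIM('a)"
  shows "u = (\<Sum>b\<in>B. (u \<bullet> b) *\<^sub>R b)"
proof -
  have fin: "finite B" using card card.infinite DIM_positive by (metis less_irrefl)
  have "pairwise orthogonal B"
    unfolding pairwise_def orthogonal_def using orth by auto
  moreover have "0 \<notin> B" using orth by fastforce
  ultimately have "independent B" by (rule pairwise_orthogonal_independent)
  then have "UNIV \<subseteq> span B"
    using card card_ge_dim_independent[of B UNIV] by simp
  then have "u \<in> span B" by blast
  then obtain r where "u = (\<Sum>b\<in>B. r b *\<^sub>R b)"
    using span_finite[OF fin] by auto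
  moreover have "(\<Sum>b\<in>B. r b *\<^sub>R b) \<bullet> c = r c" if "c \<in> B" for c
  proof -
    have "(\<Sum>b\<in>B. r b *\<^sub>R b) \<bullet> c = (\<Sum>b\<in>B. if b = c then r b else 0)"
      unfolding inner_sum_left by (rule sum.cong) (use orth that in auto)
    then show ?thesis using that fin by simp
  qed
  ultimately show ?thesis by simp
qed

text \<open>Orthonormal images force the \<open>a i\<close> to be independent, hence a basis by the
  dimension count, and pairing with \<open>L (a j)\<close> reads off the coefficients. Injectivity
  of \<open>L\<close> comes out as a consequence.\<close>

lemma frame_coordinates:
  fixes L :: "'v::euclidean_space \<Rightarrow> 'n::euclidean_space" and a :: "'m::finite \<Rightarrow> 'v"
  assumes L: "linear L" and orth: "\<And>i j. L (a i) \<bullet> L (a j) = (if i = j then 1 else 0)"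
    and card: "CARD('m) = DIM('v)"
  shows "v = (\<Sum>i\<in>UNIV. (L v \<bullet> L (a i)) *\<^sub>R a i)"
proof -
  have comp: "L (\<Sum>i\<in>UNIV. r i *\<^sub>R a i) \<bullet> L (a j) = r j" for r j
    by (simp add: linear_sum[OF L] linear_cmul[OF L] inner_sum_left orth if_distrib cong: if_cong)
  have inj: "inj a"
    using orth by (metis injI zero_neq_one)
  have "independent (range a)"
    unfolding independent_explicit_module
  proof (intro allI impI)
    fix T r v assume T: "finite T" "T \<subseteq> range a" "(\<Sum>v\<in>T. r v *\<^sub>R v) = 0" "v \<in> T"
    define r' where "r' i = (if a i \<in> T then r (a i) else 0)" for i
    have "(\<Sum>v\<in>T. r v *\<^sub>R v) = (\<Sum>v\<in>range a. (if v \<in> T then r v else 0) *\<^sub>R v)"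
      using T by (intro sum.mono_neutral_cong_left) auto
    also have "\<dots> = (\<Sum>i\<in>UNIV. r' i *\<^sub>R a i)"
      by (simp add: sum.reindex[OF inj] r'_def)
    finally have "(\<Sum>i\<in>UNIV. r' i *\<^sub>R a i) = 0" using T by simp
    then have "r' j = 0" for j using comp[of r' j] linear_0[OF L] by simp
    moreover obtain j where "v = a j" using T by blast
    ultimately show "r v = 0" using T unfolding r'_def by (metis (full_types))
  qed
  moreover have "card (range a) = DIM('v)" using inj card by (simp add: card_image)
  ultimately have "UNIV \<subseteq> span (range a)"
    using card_ge_dim_independent[of "range a" UNIV] by simp
  then have "v \<in> span (range a)" by blast
  then obtain r where "v = (\<Sum>b\<in>range a. r b *\<^sub>R b)"
    using span_finite[of "range a"] by auto
  then have "v = (\<Sum>i\<in>UNIV. r (a i) *\<^sub>R a i)" by (simp add: sum.reindex[OF inj])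
  then show ?thesis using comp[of "\<lambda>i. r (a i)"] by simp
qed

lemma inner_const_derivative:
  assumes "smooth_on S f" "smooth_on S g" "open S" "x \<in> S" "\<And>y. y \<in> S \<Longrightarrow> f y \<bullet> g y = c"
  shows "frechet_derivative f (at x) v \<bullet> g x = - (f x \<bullet> frechet_derivative g (at x) v)"
proof -
  have "frechet_derivative (\<lambda>x. f x \<bullet> g x) (at x) v = 0"
    using frechet_derivative_cong_open[OF assms(3,4), of "\<lambda>x. f x \<bullet> g x" "\<lambda>_. c"] assms(5) by simp
  then show ?thesis
    using frechet_derivative_inner_at[of f x g v] assms smooth_on_differentiable by fastforce
qed


section \<open>Immersions into the sphere in coordinates\<close>

text \<open>The \<open>a i\<close> are coordinate vector fields whose images under the differential
  of \<open>\<Phi>\<close> form an orthonormal frame. This encodes the induced metric and makes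
  \<open>\<Phi>\<close> an immersion, see \<open>d\<Phi>_inj\<close>.\<close>

locale immersed_patch =
  fixes S :: "'v::euclidean_space set" and \<Phi> :: "'v \<Rightarrow> 'n::euclidean_space"
    and a :: "'m::finite \<Rightarrow> 'v \<Rightarrow> 'v"
  assumes open_S: "open S"
    and smooth_\<Phi>: "smooth_on S \<Phi>"
    and unit_\<Phi>: "\<And>x. x \<in> S \<Longrightarrow> \<Phi> x \<bullet> \<Phi> x = 1"
    and smooth_a: "\<And>i. smooth_on S (a i)"
    and orthonormal_a: "\<And>x i j. x \<in> S \<Longrightarrow>
      frechet_derivative \<Phi> (at x) (a i x) \<bullet> frechet_derivative \<Phi> (at x) (a j x) =
        (if i = j then 1 else 0)"
    and card_frame: "CARD('m) = DIM('v)"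
begin

abbreviation d\<Phi> :: "'v \<Rightarrow> 'v \<Rightarrow> 'n" where "d\<Phi> x v \<equiv> frechet_derivative \<Phi> (at x) v"

definition frame :: "'m \<Rightarrow> 'v \<Rightarrow> 'n" where "frame i x = d\<Phi> x (a i x)"

text \<open>The orthogonal projection to the normal space inside the sphere, written in the frame so
  that smooth dependence on the point is visible; \<open>tangent_normal_form\<close> identifies it
  with \<open>orth_proj\<close>.\<close>

definition normal_part :: "'v \<Rightarrow> 'n \<Rightarrow> 'n" where
  "normal_part x u = u - (u \<bullet> \<Phi> x) *\<^sub>R \<Phi> x - (\<Sum>i\<in>UNIV. (u \<bullet> frame i x) *\<^sub>R frame i x)"

lemma smooth_frame: "smooth_on S (frame i)"
  unfolding frame_def by (intro smooth_on_directional_derivative smooth_\<Phi> smooth_a open_S)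

lemma frame_orthonormal: "x \<in> S \<Longrightarrow> frame i x \<bullet> frame j x = (if i = j then 1 else 0)"
  unfolding frame_def by (rule orthonormal_a)

lemma linear_d\<Phi>: "x \<in> S \<Longrightarrow> linear (d\<Phi> x)"
  using smooth_\<Phi> by (rule smooth_on_linear)

lemma coordinates: "x \<in> S \<Longrightarrow> v = (\<Sum>i\<in>UNIV. (d\<Phi> x v \<bullet> frame i x) *\<^sub>R a i x)"
  unfolding frame_def by (rule frame_coordinates[OF linear_d\<Phi> orthonormal_a card_frame])

lemma d\<Phi>_expansion: "x \<in> S \<Longrightarrow> d\<Phi> x v = (\<Sum>i\<in>UNIV. (d\<Phi> x v \<bullet> frame i x) *\<^sub>R frame i x)"
  by (subst coordinates[of x v], assumption)
    (simp add: linear_sum[OF linear_d\<Phi>] linear_cmul[OF linear_d\<Phi>] frame_def)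

lemma d\<Phi>_inj: "x \<in> S \<Longrightarrow> d\<Phi> x v = 0 \<Longrightarrow> v = 0"
  using coordinates[of x v] by simp

lemma \<Phi>_d\<Phi>: "x \<in> S \<Longrightarrow> \<Phi> x \<bullet> d\<Phi> x v = 0"
  using inner_const_derivative[OF smooth_\<Phi> smooth_\<Phi> open_S _ unit_\<Phi>, of x v]
  by (simp add: inner_commute)

lemma linear_functional_expansion:
  assumes "x \<in> S" "linear L"
  shows "L v = (\<Sum>i\<in>UNIV. (d\<Phi> x v \<bullet> frame i x) *\<^sub>R L (a i x))"
  by (subst coordinates[OF assms(1), of v]) (simp add: linear_sum[OF assms(2)] linear_cmul[OF assms(2)])

lemma second_derivative_commute:
  "smooth_on S f \<Longrightarrow> x \<in> S \<Longrightarrow>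
    frechet_derivative (\<lambda>y. frechet_derivative f (at y) v) (at x) w =
    frechet_derivative (\<lambda>y. frechet_derivative f (at y) w) (at x) v"
  for f :: "'v \<Rightarrow> 'b::euclidean_space"
  by (rule symmetric_second_derivative[OF _ open_S])

lemma normal_part_normal:
  assumes "x \<in> S"
  shows "normal_part x u \<bullet> d\<Phi> x v = 0" "normal_part x u \<bullet> \<Phi> x = 0"
proof -
  have *: "normal_part x u \<bullet> frame j x = 0" for j
    using \<Phi>_d\<Phi>[OF assms] by (simp add: normal_part_def inner_diff_left inner_sum_left frame_orthonormal[OF assms]
        if_distrib frame_def[symmetric] cong: if_cong) (simp add: frame_def)
  show "normal_part x u \<bullet> d\<Phi> x v = 0"
    by (subst d\<Phi>_expansion[OF assms]) (simp add: inner_sum_right *)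
  have "frame i x \<bullet> \<Phi> x = 0" for i
    using \<Phi>_d\<Phi>[OF assms, of "a i x"] by (simp add: frame_def inner_commute)
  then show "normal_part x u \<bullet> \<Phi> x = 0"
    by (simp add: normal_part_def inner_diff_left inner_sum_left unit_\<Phi>[OF assms])
qed

lemma linear_normal_part: "linear (normal_part x)"
  unfolding normal_part_def
  by (intro linearI) (simp_all add: inner_add_left algebra_simps sum.distrib scaleR_sum_right)

lemma smooth_normal_part: "smooth_on S u \<Longrightarrow> smooth_on S (\<lambda>x. normal_part x (u x))"
  unfolding normal_part_def
  by (intro smooth_on_diff smooth_on_sum smooth_on_scaleR smooth_on_inner smooth_frame smooth_\<Phi> open_S)

end


lemma frechet_derivative_scaleR_add_at:
  assumes "f differentiable (at x)" "p differentiable (at x)" "g differentiable (at x)" "q differentiable (at x)"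
  shows "frechet_derivative (\<lambda>x. f x *\<^sub>R p x + g x *\<^sub>R q x) (at x) v =
    f x *\<^sub>R frechet_derivative p (at x) v + frechet_derivative f (at x) v *\<^sub>R p x +
    (g x *\<^sub>R frechet_derivative q (at x) v + frechet_derivative g (at x) v *\<^sub>R q x)"
  using assms by (subst frechet_derivative_add_at) (simp_all add: frechet_derivative_scaleR_at)

text \<open>Here \<open>h\<close> stands for |H| and \<open>\<eta>\<close> for H / |H|.
  Pseudo-umbilicity becomes A_\<eta> = h Id in \<open>umbilical\<close>; since H has no component
  along \<open>\<zeta>\<close>, the shape operator of \<open>\<zeta>\<close> is trace-free, which is
  \<open>trace_\<zeta>\<close>. As 7 = 1 + 4 + 2, position, frame and the two normals form an
  orthonormal basis of the ambient space.\<close>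

locale umbilical_patch = immersed_patch S \<Phi> a
  for S :: "(real ^ 4) set" and \<Phi> :: "real ^ 4 \<Rightarrow> real ^ 7" and a :: "4 \<Rightarrow> real ^ 4 \<Rightarrow> real ^ 4" +
  fixes h :: "real ^ 4 \<Rightarrow> real" and \<eta> \<zeta> :: "real ^ 4 \<Rightarrow> real ^ 7"
  assumes smooth_h: "smooth_on S h" and smooth_\<eta>: "smooth_on S \<eta>" and smooth_\<zeta>: "smooth_on S \<zeta>"
    and \<Phi>_\<eta>: "\<And>x. x \<in> S \<Longrightarrow> \<Phi> x \<bullet> \<eta> x = 0" and \<Phi>_\<zeta>: "\<And>x. x \<in> S \<Longrightarrow> \<Phi> x \<bullet> \<zeta> x = 0"
    and d\<Phi>_\<eta>: "\<And>x v. x \<in> S \<Longrightarrow> d\<Phi> x v \<bullet> \<eta> x = 0"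
    and d\<Phi>_\<zeta>: "\<And>x v. x \<in> S \<Longrightarrow> d\<Phi> x v \<bullet> \<zeta> x = 0"
    and \<eta>_\<eta>: "\<And>x. x \<in> S \<Longrightarrow> \<eta> x \<bullet> \<eta> x = 1" and \<zeta>_\<zeta>: "\<And>x. x \<in> S \<Longrightarrow> \<zeta> x \<bullet> \<zeta> x = 1"
    and \<eta>_\<zeta>: "\<And>x. x \<in> S \<Longrightarrow> \<eta> x \<bullet> \<zeta> x = 0"
    and h_pos: "\<And>x. x \<in> S \<Longrightarrow> h x > 0"
    and h_noncritical: "\<And>x. x \<in> S \<Longrightarrow> \<exists>v. frechet_derivative h (at x) v \<noteq> 0"
    and umbilical: "\<And>x v u. x \<in> S \<Longrightarrow>
      frechet_derivative \<eta> (at x) v \<bullet> d\<Phi> x u = - h x * (d\<Phi> x v \<bullet> d\<Phi> x u)"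
    and trace_\<zeta>: "\<And>x. x \<in> S \<Longrightarrow>
      (\<Sum>i\<in>UNIV. frechet_derivative \<zeta> (at x) (a i x) \<bullet> frame i x) = 0"
begin

lemma expansion:
  assumes x: "x \<in> S"
  shows "u = (u \<bullet> \<Phi> x) *\<^sub>R \<Phi> x + (\<Sum>i\<in>UNIV. (u \<bullet> frame i x) *\<^sub>R frame i x)
    + (u \<bullet> \<eta> x) *\<^sub>R \<eta> x + (u \<bullet> \<zeta> x) *\<^sub>R \<zeta> x"
proof -
  let ?E = "range (\<lambda>i. frame i x)"
  let ?B = "insert (\<Phi> x) (insert (\<eta> x) (insert (\<zeta> x) ?E))"
  note ip = frame_orthonormal[OF x] unit_\<Phi>[OF x] \<eta>_\<eta>[OF x] \<zeta>_\<zeta>[OF x] \<eta>_\<zeta>[OF x]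
    \<Phi>_\<eta>[OF x] \<Phi>_\<zeta>[OF x] d\<Phi>_\<eta>[OF x, of "a _ x", folded frame_def] d\<Phi>_\<zeta>[OF x, of "a _ x", folded frame_def]
    \<Phi>_d\<Phi>[OF x, of "a _ x", folded frame_def]
  have inj: "inj (\<lambda>i. frame i x)"
    by (rule injI) (metis ip(1) zero_neq_one)
  have ne: "\<Phi> x \<notin> insert (\<eta> x) (insert (\<zeta> x) ?E)" "\<eta> x \<notin> insert (\<zeta> x) ?E" "\<zeta> x \<notin> ?E"
    using ip by (auto, (metis zero_neq_one inner_commute)+)
  have "card ?E = 4" using inj by (simp add: card_image)
  then have card: "card ?B = DIM(real ^ 7)" using ne by simp
  have orth: "b \<bullet> c = (if b = c then 1 else 0)" if "b \<in> ?B" "c \<in> ?B" for b c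
    using that ip inner_commute[of b c] by (auto simp: inner_commute split: if_splits)
  show ?thesis
    using orthonormal_expansion[of ?B u, OF orth card] ne
    by (simp add: sum.reindex[OF inj] algebra_simps)
qed

end


section \<open>Structure equations where the mean curvature is not critical\<close>

text \<open>Two linear conditions leave a non-zero vector in dimension above two. Orthogonality to
  \<open>v\<close> is meant in coordinates, not in the induced metric: its purpose is to keep
  \<open>u\<close> independent of \<open>v\<close>.\<close>

lemma exists_kernel_orthogonal:
  fixes L :: "'a::euclidean_space \<Rightarrow> real"
  assumes L: "linear L" and dim: "DIM('a) > 2"
  obtains u where "u \<noteq> 0" "L u = 0" "u \<bullet> v = 0"
proof -
  define q where "q = (\<Sum>b\<in>Basis. L b *\<^sub>R b)"
  have q: "L u = q \<bullet> u" for u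
    unfolding q_def inner_sum_left linear_eq_sum_Basis[OF L, of u]
    by (simp add: inner_commute mult.commute)
  have "dim {q, v} \<le> 2"
    using dim_le_card'[of "{q, v}"] card_insert_le_m1[of 2 "{v}" q] by simp
  then obtain u where "u \<noteq> 0" "\<And>y. y \<in> span {q, v} \<Longrightarrow> orthogonal u y"
    using orthogonal_to_subspace_exists[of "{q, v}"] dim by auto
  then show ?thesis
    using q by (intro that[of u]) (simp_all add: orthogonal_def span_base inner_commute[of _ u])
qed

context umbilical_patch
begin

definition \<omega> :: "real ^ 4 \<Rightarrow> real ^ 4 \<Rightarrow> real" where
  "\<omega> x v = frechet_derivative \<eta> (at x) v \<bullet> \<zeta> x"

text \<open>The Weingarten formula solved for the shape operator: the normal part of the derivative
  of \<open>\<zeta>\<close> is - \<omega> \<eta>, because \<open>\<eta>\<close> and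
  \<open>\<zeta>\<close> are orthonormal.\<close>

definition shape_\<zeta> :: "real ^ 4 \<Rightarrow> real ^ 4 \<Rightarrow> real ^ 7" where
  "shape_\<zeta> x v = - frechet_derivative \<zeta> (at x) v - \<omega> x v *\<^sub>R \<eta> x"

lemma smooth_\<omega>: "smooth_on S (\<lambda>x. \<omega> x v)"
  unfolding \<omega>_def by (intro smooth_on_inner smooth_on_derivative smooth_\<eta> smooth_\<zeta> open_S)

lemma linear_\<omega>: "x \<in> S \<Longrightarrow> linear (\<omega> x)"
  unfolding \<omega>_def using smooth_on_linear[OF smooth_\<eta>]
  by (intro linearI) (auto simp: linear_add linear_cmul inner_add_left)

lemma linear_dh: "x \<in> S \<Longrightarrow> linear (frechet_derivative h (at x))"
  by (rule smooth_on_linear[OF smooth_h])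

lemma tangential_expansion:
  assumes x: "x \<in> S" and "u \<bullet> \<Phi> x = 0" "u \<bullet> \<eta> x = 0" "u \<bullet> \<zeta> x = 0"
  shows "u = (\<Sum>i\<in>UNIV. (u \<bullet> frame i x) *\<^sub>R frame i x)"
  using expansion[OF x, of u] assms by simp

lemma d\<eta>_\<omega>:
  assumes x: "x \<in> S"
  shows "frechet_derivative \<eta> (at x) v = - h x *\<^sub>R d\<Phi> x v + \<omega> x v *\<^sub>R \<zeta> x"
proof -
  have "frechet_derivative \<eta> (at x) v \<bullet> \<Phi> x = 0"
    using inner_const_derivative[OF smooth_\<Phi> smooth_\<eta> open_S x \<Phi>_\<eta>, of v] d\<Phi>_\<eta>[OF x, of v]
    by (simp add: inner_commute)
  moreover have "frechet_derivative \<eta> (at x) v \<bullet> \<eta> x = 0"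
    using inner_const_derivative[OF smooth_\<eta> smooth_\<eta> open_S x \<eta>_\<eta>, of v] by (simp add: inner_commute)
  moreover have "frechet_derivative \<eta> (at x) v \<bullet> frame i x = - h x * (d\<Phi> x v \<bullet> frame i x)" for i
    using umbilical[OF x] by (simp add: frame_def)
  then have "(\<Sum>i\<in>UNIV. (frechet_derivative \<eta> (at x) v \<bullet> frame i x) *\<^sub>R frame i x) = - h x *\<^sub>R d\<Phi> x v"
    by (subst d\<Phi>_expansion[OF x, of v]) (simp add: scaleR_sum_right sum_negf)
  ultimately show ?thesis
    using expansion[OF x, of "frechet_derivative \<eta> (at x) v"] by (simp add: \<omega>_def)
qed

lemma d\<zeta>_\<zeta>: "x \<in> S \<Longrightarrow> frechet_derivative \<zeta> (at x) v \<bullet> \<zeta> x = 0"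
  using inner_const_derivative[OF smooth_\<zeta> smooth_\<zeta> open_S _ \<zeta>_\<zeta>, of x v] by (simp add: inner_commute)

lemma shape_\<zeta>_tangential:
  assumes x: "x \<in> S"
  shows "shape_\<zeta> x v \<bullet> \<Phi> x = 0" "shape_\<zeta> x v \<bullet> \<eta> x = 0" "shape_\<zeta> x v \<bullet> \<zeta> x = 0"
proof -
  have "frechet_derivative \<zeta> (at x) v \<bullet> \<Phi> x = 0"
    using inner_const_derivative[OF smooth_\<Phi> smooth_\<zeta> open_S x \<Phi>_\<zeta>, of v] d\<Phi>_\<zeta>[OF x, of v]
    by (simp add: inner_commute)
  then show "shape_\<zeta> x v \<bullet> \<Phi> x = 0"
    using \<Phi>_\<eta>[OF x] by (simp add: shape_\<zeta>_def inner_diff_left inner_commute[of "\<eta> x"])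
  have "frechet_derivative \<zeta> (at x) v \<bullet> \<eta> x = - \<omega> x v"
    using inner_const_derivative[OF smooth_\<eta> smooth_\<zeta> open_S x \<eta>_\<zeta>, of v]
    by (simp add: \<omega>_def inner_commute)
  then show "shape_\<zeta> x v \<bullet> \<eta> x = 0"
    using \<eta>_\<eta>[OF x] by (simp add: shape_\<zeta>_def inner_diff_left)
  show "shape_\<zeta> x v \<bullet> \<zeta> x = 0"
    using d\<zeta>_\<zeta>[OF x] \<eta>_\<zeta>[OF x] by (simp add: shape_\<zeta>_def inner_diff_left)
qed

lemma shape_\<zeta>_inner: "x \<in> S \<Longrightarrow> shape_\<zeta> x v \<bullet> d\<Phi> x u = - (frechet_derivative \<zeta> (at x) v \<bullet> d\<Phi> x u)"
  using d\<Phi>_\<eta>[of x u] by (simp add: shape_\<zeta>_def inner_diff_left inner_commute[of "\<eta> x"])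

text \<open>Moving the derivative off \<open>\<zeta>\<close> turns either side into the inner
  product of \<open>\<zeta>\<close> with a second derivative of \<open>\<Phi>\<close>.\<close>

lemma shape_\<zeta>_symmetric:
  assumes x: "x \<in> S"
  shows "shape_\<zeta> x v \<bullet> d\<Phi> x u = shape_\<zeta> x u \<bullet> d\<Phi> x v"
proof -
  have "frechet_derivative \<zeta> (at x) v \<bullet> d\<Phi> x u =
      - (\<zeta> x \<bullet> frechet_derivative (\<lambda>y. d\<Phi> y u) (at x) v)" for u v
    using inner_const_derivative[OF smooth_\<zeta> smooth_on_derivative[OF smooth_\<Phi>] open_S x, of u 0 v] d\<Phi>_\<zeta>
    by (simp add: inner_commute)
  then show ?thesis
    using second_derivative_commute[OF smooth_\<Phi> x, of u v] by (simp add: shape_\<zeta>_inner[OF x])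
qed

text \<open>Both parts come from the symmetric second derivatives of \<open>\<eta>\<close>, whose
  first derivative is - h d\<Phi> + \<omega> \<zeta>. The component along \<open>\<zeta>\<close> is
  the Ricci equation: \<omega> is closed, as A_\<eta> is a multiple of the identity and commutes
  with A_\<zeta>. The rest is the Codazzi equation.\<close>

lemma codazzi_\<eta>:
  assumes x: "x \<in> S"
  shows "frechet_derivative (\<lambda>y. \<omega> y u) (at x) v = frechet_derivative (\<lambda>y. \<omega> y v) (at x) u"
    and "frechet_derivative h (at x) v *\<^sub>R d\<Phi> x u + \<omega> x u *\<^sub>R shape_\<zeta> x v =
      frechet_derivative h (at x) u *\<^sub>R d\<Phi> x v + \<omega> x v *\<^sub>R shape_\<zeta> x u"
proof -
  let ?dh = "frechet_derivative h (at x)" and ?d\<zeta> = "frechet_derivative \<zeta> (at x)"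
  let ?d\<omega> = "\<lambda>u. frechet_derivative (\<lambda>y. \<omega> y u) (at x)"
  note diff = smooth_on_differentiable[OF _ x]
  have *: "frechet_derivative (\<lambda>y. frechet_derivative \<eta> (at y) u) (at x) v =
      - (h x *\<^sub>R frechet_derivative (\<lambda>y. d\<Phi> y u) (at x) v) - ?dh v *\<^sub>R d\<Phi> x u +
      (\<omega> x u *\<^sub>R ?d\<zeta> v + ?d\<omega> u v *\<^sub>R \<zeta> x)" for u v
  proof -
    have "frechet_derivative (\<lambda>y. frechet_derivative \<eta> (at y) u) (at x) v =
        frechet_derivative (\<lambda>y. - h y *\<^sub>R d\<Phi> y u + \<omega> y u *\<^sub>R \<zeta> y) (at x) v"
      by (subst frechet_derivative_cong_open[OF open_S x d\<eta>_\<omega>]) auto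
    also have "\<dots> = - h x *\<^sub>R frechet_derivative (\<lambda>y. d\<Phi> y u) (at x) v +
        frechet_derivative (\<lambda>y. - h y) (at x) v *\<^sub>R d\<Phi> x u +
        (\<omega> x u *\<^sub>R ?d\<zeta> v + ?d\<omega> u v *\<^sub>R \<zeta> x)"
      by (intro frechet_derivative_scaleR_add_at diff smooth_on_minus smooth_h smooth_\<omega> smooth_\<zeta>
          smooth_on_derivative smooth_\<Phi> open_S)
    finally show ?thesis
      by (simp add: frechet_derivative_minus_at[OF diff[OF smooth_h]])
  qed
  have eq: "- (?dh v *\<^sub>R d\<Phi> x u) + (\<omega> x u *\<^sub>R ?d\<zeta> v + ?d\<omega> u v *\<^sub>R \<zeta> x) =
      - (?dh u *\<^sub>R d\<Phi> x v) + (\<omega> x v *\<^sub>R ?d\<zeta> u + ?d\<omega> v u *\<^sub>R \<zeta> x)"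
    using second_derivative_commute[OF smooth_\<eta> x, of u v] second_derivative_commute[OF smooth_\<Phi> x, of u v]
    unfolding * by simp
  from arg_cong[OF eq, of "\<lambda>z. z \<bullet> \<zeta> x"] show sym: "?d\<omega> u v = ?d\<omega> v u"
    using d\<Phi>_\<zeta>[OF x] by (simp add: inner_add_left inner_diff_left d\<zeta>_\<zeta>[OF x] \<zeta>_\<zeta>[OF x])
  have d\<zeta>: "?d\<zeta> v = - shape_\<zeta> x v - \<omega> x v *\<^sub>R \<eta> x" for v by (simp add: shape_\<zeta>_def)
  from eq show "?dh v *\<^sub>R d\<Phi> x u + \<omega> x u *\<^sub>R shape_\<zeta> x v = ?dh u *\<^sub>R d\<Phi> x v + \<omega> x v *\<^sub>R shape_\<zeta> x u"
    unfolding sym d\<zeta> by (simp add: algebra_simps)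
qed

definition w :: "real ^ 4 \<Rightarrow> real" where
  "w x = sqrt (\<Sum>i\<in>UNIV. (\<omega> x (a i x))\<^sup>2)"

definition A :: "real ^ 4 \<Rightarrow> real ^ 4" where
  "A x = (\<Sum>i\<in>UNIV. (\<omega> x (a i x) / w x) *\<^sub>R a i x)"

definition E :: "real ^ 4 \<Rightarrow> real ^ 7" where
  "E x = d\<Phi> x (A x)"

definition \<theta> :: "real ^ 4 \<Rightarrow> real ^ 4 \<Rightarrow> real" where
  "\<theta> x v = E x \<bullet> d\<Phi> x v"

definition \<mu> :: "real ^ 4 \<Rightarrow> real" where
  "\<mu> x = frechet_derivative h (at x) (A x) / w x"

text \<open>If \<omega> vanished at \<open>x\<close>, the Codazzi equation would reduce to dh(v)
  d\<Phi>(u) = dh(u) d\<Phi>(v), and a non-zero \<open>u\<close> in the kernel of dh would force dh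
  = 0.\<close>

lemma w_square_pos:
  assumes x: "x \<in> S"
  shows "(\<Sum>i\<in>UNIV. (\<omega> x (a i x))\<^sup>2) > 0"
proof (rule ccontr)
  assume "\<not> ?thesis"
  then have "(\<Sum>i\<in>UNIV. (\<omega> x (a i x))\<^sup>2) = 0"
    by (metis linorder_not_le order_antisym_conv sum_nonneg zero_le_power2 linorder_le_less_linear)
  then have "\<omega> x (a i x) = 0" for i
    by (simp add: sum_nonneg_eq_0_iff)
  then have \<omega>0: "\<omega> x v = 0" for v
    using linear_functional_expansion[OF x linear_\<omega>[OF x], of v] by simp
  obtain v where v: "frechet_derivative h (at x) v \<noteq> 0" using h_noncritical[OF x] by blast
  obtain u where u: "u \<noteq> 0" "frechet_derivative h (at x) u = 0"
    using exists_kernel_orthogonal[OF linear_dh[OF x], of v] by auto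
  show False
    using codazzi_\<eta>(2)[OF x, of v u] u v d\<Phi>_inj[OF x, of u] by (simp add: \<omega>0)
qed

lemma w_pos: "x \<in> S \<Longrightarrow> w x > 0"
  using w_square_pos by (simp add: w_def)

lemma smooth_w: "smooth_on S w"
  unfolding w_def \<omega>_def
  by (intro smooth_on_sqrt smooth_on_sum smooth_on_power smooth_on_inner smooth_on_directional_derivative
      smooth_\<eta> smooth_a smooth_\<zeta> open_S) (simp add: w_square_pos[unfolded \<omega>_def])

lemma smooth_A: "smooth_on S A"
  unfolding A_def \<omega>_def
  by (intro smooth_on_sum smooth_on_scaleR smooth_on_divide smooth_on_inner smooth_on_directional_derivative
      smooth_\<eta> smooth_a smooth_\<zeta> smooth_w open_S) (use w_pos in force)

lemma smooth_E: "smooth_on S E"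
  unfolding E_def by (intro smooth_on_directional_derivative smooth_\<Phi> smooth_A open_S)

lemma smooth_\<theta>: "smooth_on S (\<lambda>x. \<theta> x v)"
  unfolding \<theta>_def by (intro smooth_on_inner smooth_on_derivative smooth_\<Phi> smooth_E open_S)

lemma smooth_\<mu>: "smooth_on S \<mu>"
  unfolding \<mu>_def
  by (intro smooth_on_divide smooth_on_directional_derivative smooth_h smooth_A smooth_w open_S)
    (use w_pos in force)

lemma E_frame: "x \<in> S \<Longrightarrow> E x = (\<Sum>i\<in>UNIV. (\<omega> x (a i x) / w x) *\<^sub>R frame i x)"
  by (simp add: E_def A_def linear_sum[OF linear_d\<Phi>] linear_cmul[OF linear_d\<Phi>] frame_def)

lemma \<omega>_eq:
  assumes x: "x \<in> S"
  shows "\<omega> x v = w x * \<theta> x v"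
proof -
  have "w x * \<theta> x v = (\<Sum>i\<in>UNIV. (frame i x \<bullet> d\<Phi> x v) * \<omega> x (a i x))"
    unfolding \<theta>_def E_frame[OF x] inner_sum_left sum_distrib_left
    using w_pos[OF x] by (intro sum.cong) auto
  then show ?thesis
    using linear_functional_expansion[OF x linear_\<omega>[OF x], of v] by (simp add: inner_commute)
qed

lemma linear_\<theta>: "x \<in> S \<Longrightarrow> linear (\<theta> x)"
  unfolding \<theta>_def using linear_d\<Phi>
  by (intro linearI) (auto simp: linear_add linear_cmul inner_add_right)

lemma E_E:
  assumes x: "x \<in> S"
  shows "E x \<bullet> E x = 1"
proof -
  have "E x \<bullet> E x = (\<Sum>i\<in>UNIV. (\<omega> x (a i x))\<^sup>2) / (w x)\<^sup>2"
    unfolding E_frame[OF x]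
    by (simp add: inner_sum_left inner_sum_right frame_orthonormal[OF x] if_distrib sum_divide_distrib
        power2_eq_square cong: if_cong)
  then show ?thesis
    using w_square_pos[OF x] unfolding w_def by (simp add: sum_nonneg)
qed

lemma \<theta>_A: "x \<in> S \<Longrightarrow> \<theta> x (A x) = 1"
  using E_E by (simp add: \<theta>_def E_def)

text \<open>On the kernel of \<theta>, which is that of \<omega>, the Codazzi equation reads dh(v) u
  = dh(u) v. This kernel is three-dimensional, so it contains a non-zero \<open>u\<close> orthogonal
  to \<open>v\<close>, and pairing with \<open>u\<close> removes the right-hand side.\<close>

lemma dh_kernel:
  assumes x: "x \<in> S" and "\<theta> x v = 0"
  shows "frechet_derivative h (at x) v = 0"
proof -
  let ?dh = "frechet_derivative h (at x)"
  obtain u where u: "u \<noteq> 0" "\<theta> x u = 0" "u \<bullet> v = 0"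
    using exists_kernel_orthogonal[OF linear_\<theta>[OF x], of v] by auto
  have "?dh v *\<^sub>R d\<Phi> x u = ?dh u *\<^sub>R d\<Phi> x v"
    using codazzi_\<eta>(2)[OF x, of v u] u assms(2) by (simp add: \<omega>_eq[OF x])
  then have "d\<Phi> x (?dh v *\<^sub>R u - ?dh u *\<^sub>R v) = 0"
    by (simp add: linear_diff[OF linear_d\<Phi>[OF x]] linear_cmul[OF linear_d\<Phi>[OF x]])
  then have "?dh v *\<^sub>R u = ?dh u *\<^sub>R v" using d\<Phi>_inj[OF x] by fastforce
  from arg_cong[OF this, of "\<lambda>z. z \<bullet> u"] show ?thesis
    using u by (simp add: inner_commute)
qed

lemma dh_\<theta>:
  assumes x: "x \<in> S"
  shows "frechet_derivative h (at x) v = \<mu> x * w x * \<theta> x v"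
proof -
  have "\<theta> x (v - \<theta> x v *\<^sub>R A x) = 0"
    by (simp add: linear_diff[OF linear_\<theta>[OF x]] linear_cmul[OF linear_\<theta>[OF x]] \<theta>_A[OF x])
  from dh_kernel[OF x this] show ?thesis
    using w_pos[OF x] by (simp add: linear_diff[OF linear_dh[OF x]] linear_cmul[OF linear_dh[OF x]] \<mu>_def)
qed

lemma \<mu>_nonzero: "x \<in> S \<Longrightarrow> \<mu> x \<noteq> 0"
  using h_noncritical[of x] dh_\<theta>[of x] by auto

text \<open>The Codazzi equation with \<open>A x\<close> in one slot determines the operator up to
  its value on \<open>E\<close>. Symmetry makes \<open>E\<close> an eigenvector, with eigenvalue
  \<open>l\<close>, and the vanishing trace 3 \<mu> + l fixes \<open>l\<close>.\<close>

lemma shape_\<zeta>_eq: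
  assumes x: "x \<in> S"
  shows "shape_\<zeta> x v = \<mu> x *\<^sub>R d\<Phi> x v - (4 * \<mu> x * \<theta> x v) *\<^sub>R E x"
proof -
  let ?SA = "shape_\<zeta> x (A x)"
  have 1: "shape_\<zeta> x v = \<mu> x *\<^sub>R d\<Phi> x v - (\<mu> x * \<theta> x v) *\<^sub>R E x + \<theta> x v *\<^sub>R ?SA" for v
  proof -
    have "w x *\<^sub>R shape_\<zeta> x v = w x *\<^sub>R (\<mu> x *\<^sub>R d\<Phi> x v - (\<mu> x * \<theta> x v) *\<^sub>R E x + \<theta> x v *\<^sub>R ?SA)"
      using codazzi_\<eta>(2)[OF x, of v "A x"]
      by (simp add: \<omega>_eq[OF x] dh_\<theta>[OF x] \<theta>_A[OF x] E_def[symmetric] algebra_simps)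
    then show ?thesis using w_pos[OF x] by simp
  qed
  define l where "l = ?SA \<bullet> E x"
  have "?SA \<bullet> d\<Phi> x u = l * \<theta> x u" for u
    using shape_\<zeta>_symmetric[OF x, of "A x" u] 1[of u]
    by (simp add: E_def[symmetric] inner_add_left inner_diff_left E_E[OF x] l_def)
      (simp add: \<theta>_def inner_commute)
  then have "?SA = l *\<^sub>R (\<Sum>i\<in>UNIV. \<theta> x (a i x) *\<^sub>R frame i x)"
    using tangential_expansion[OF x shape_\<zeta>_tangential[OF x], of "A x"]
    by (simp add: frame_def scaleR_sum_right)
  also have "(\<Sum>i\<in>UNIV. \<theta> x (a i x) *\<^sub>R frame i x) = E x"
    using d\<Phi>_expansion[OF x, of "A x"] by (simp add: E_def \<theta>_def frame_def)
  finally have SA: "?SA = l *\<^sub>R E x" .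
  have "(\<Sum>i\<in>UNIV. (\<theta> x (a i x))\<^sup>2) = E x \<bullet> (\<Sum>i\<in>UNIV. \<theta> x (a i x) *\<^sub>R frame i x)"
    by (simp add: inner_sum_right \<theta>_def frame_def power2_eq_square)
  also have "\<dots> = 1" by (simp add: \<open>_ = E x\<close> E_E[OF x])
  finally have tr\<theta>: "(\<Sum>i\<in>UNIV. (\<theta> x (a i x))\<^sup>2) = 1" .
  have "(\<Sum>i\<in>UNIV. shape_\<zeta> x (a i x) \<bullet> frame i x) = 0"
    using trace_\<zeta>[OF x] shape_\<zeta>_inner[OF x] by (simp add: frame_def sum_negf)
  moreover have "shape_\<zeta> x (a i x) \<bullet> frame i x = \<mu> x - \<mu> x * (\<theta> x (a i x))\<^sup>2 + l * (\<theta> x (a i x))\<^sup>2" for i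
    unfolding 1[of "a i x"] SA
    using orthonormal_a[OF x, of i i]
    by (simp add: inner_add_left inner_diff_left frame_def \<theta>_def power2_eq_square)
  ultimately have "4 * \<mu> x - \<mu> x + l = 0"
    by (simp add: sum.distrib sum_subtractf sum_distrib_left[symmetric] tr\<theta>)
  then have "l = - 3 * \<mu> x" by simp
  then show ?thesis unfolding 1[of v] SA
    by (simp add: algebra_simps scaleR_add_left[symmetric])
qed

end

section \<open>The curves along \<open>E\<close> and the leaves orthogonal to it\<close>

context umbilical_patch
begin

lemma d\<zeta>_eq:
  assumes x: "x \<in> S"
  shows "frechet_derivative \<zeta> (at x) v =
    - \<mu> x *\<^sub>R d\<Phi> x v + (4 * (\<mu> x * \<theta> x v)) *\<^sub>R E x + - \<omega> x v *\<^sub>R \<eta> x"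
proof -
  have "frechet_derivative \<zeta> (at x) v = - shape_\<zeta> x v - \<omega> x v *\<^sub>R \<eta> x" by (simp add: shape_\<zeta>_def)
  then show ?thesis unfolding shape_\<zeta>_eq[OF x] by (simp add: algebra_simps)
qed

text \<open>As dh = \<mu> \<omega> with \<omega> closed, symmetry of the second derivatives of
  \<open>h\<close> makes the wedge product of d\<mu> and \<omega> vanish.\<close>

lemma d\<mu>_\<theta>:
  assumes x: "x \<in> S"
  shows "frechet_derivative \<mu> (at x) v = frechet_derivative \<mu> (at x) (A x) * \<theta> x v"
proof -
  note diff = smooth_on_differentiable[OF _ x]
  have *: "frechet_derivative (\<lambda>y. frechet_derivative h (at y) v) (at x) u =
      \<mu> x * frechet_derivative (\<lambda>y. \<omega> y v) (at x) u + frechet_derivative \<mu> (at x) u * \<omega> x v" for u v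
  proof -
    have "frechet_derivative (\<lambda>y. frechet_derivative h (at y) v) (at x) u =
        frechet_derivative (\<lambda>y. \<mu> y * \<omega> y v) (at x) u"
      by (subst frechet_derivative_cong_open[OF open_S x, of _ "\<lambda>y. \<mu> y * \<omega> y v"])
        (simp_all add: dh_\<theta> \<omega>_eq)
    then show ?thesis by (simp add: frechet_derivative_mult_at diff smooth_\<mu> smooth_\<omega>)
  qed
  have "frechet_derivative \<mu> (at x) v * w x = frechet_derivative \<mu> (at x) (A x) * \<theta> x v * w x"
    using second_derivative_commute[OF smooth_h x, of v "A x"] codazzi_\<eta>(1)[OF x, of v "A x"]
    by (auto simp: * \<omega>_eq[OF x] \<theta>_A[OF x] algebra_simps)
  then show ?thesis using w_pos[OF x] by simp
qed

text \<open>Solved from the derivative of \<open>\<mu>\<close> along \<open>E\<close>, see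
  \<open>d\<mu>_A\<close>. The geometric meaning appears in \<open>codazzi_\<zeta>\<close>: on the
  kernel of \<theta> the derivative of \<open>E\<close> is \<kappa> d\<Phi>, so up to sign \<kappa>
  is the principal curvature of the leaves orthogonal to \<open>E\<close>.\<close>

definition \<kappa> :: "real ^ 4 \<Rightarrow> real" where
  "\<kappa> x = - (frechet_derivative \<mu> (at x) (A x) + h x * w x) / (4 * \<mu> x)"

lemma smooth_\<kappa>: "smooth_on S \<kappa>"
  unfolding \<kappa>_def
  by (intro smooth_on_divide smooth_on_minus smooth_on_add smooth_on_mult smooth_on_const
      smooth_on_directional_derivative smooth_h smooth_A smooth_w smooth_\<mu> open_S)
    (use \<mu>_nonzero in force)

lemma d\<mu>_A: "x \<in> S \<Longrightarrow> frechet_derivative \<mu> (at x) (A x) = - 4 * \<mu> x * \<kappa> x - h x * w x"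
  using \<mu>_nonzero[of x] by (simp add: \<kappa>_def)

lemma dh_A: "x \<in> S \<Longrightarrow> frechet_derivative h (at x) (A x) = \<mu> x * w x"
  by (simp add: dh_\<theta> \<theta>_A)

lemma dE_E: "x \<in> S \<Longrightarrow> frechet_derivative E (at x) v \<bullet> E x = 0"
  using inner_const_derivative[OF smooth_E smooth_E open_S _ E_E, of x v] by (simp add: inner_commute)

text \<open>Symmetry of the second derivatives of \<open>\<zeta>\<close> in the directions
  \<open>u\<close> and \<open>A x\<close>; the latter stays frozen at \<open>x\<close> while
  \<open>y\<close> varies, so that both directions are constant. The component along
  \<open>E\<close> gives the first part, and the remainder divided by 4 \<mu> gives the
  second.\<close>

lemma codazzi_\<zeta>:
  assumes x: "x \<in> S"
  shows "frechet_derivative (\<lambda>y. \<theta> y (A x)) (at x) u = frechet_derivative (\<lambda>y. \<theta> y u) (at x) (A x)"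
    and "frechet_derivative E (at x) u =
      \<kappa> x *\<^sub>R (d\<Phi> x u - \<theta> x u *\<^sub>R E x) + \<theta> x u *\<^sub>R frechet_derivative E (at x) (A x)"
proof -
  let ?d\<mu> = "frechet_derivative \<mu> (at x)" and ?dE = "frechet_derivative E (at x)"
  let ?d\<omega> = "\<lambda>u. frechet_derivative (\<lambda>y. \<omega> y u) (at x)"
  let ?d\<theta> = "\<lambda>u. frechet_derivative (\<lambda>y. \<theta> y u) (at x)"
  note diff = smooth_on_differentiable[OF _ x]
  note smooth = smooth_\<mu> smooth_\<theta> smooth_\<omega> smooth_E smooth_on_derivative smooth_\<Phi> smooth_\<eta> open_S
  have *: "frechet_derivative (\<lambda>y. frechet_derivative \<zeta> (at y) v) (at x) u =
      - (\<mu> x *\<^sub>R frechet_derivative (\<lambda>y. d\<Phi> y v) (at x) u) - ?d\<mu> u *\<^sub>R d\<Phi> x v +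
      ((4 * (\<mu> x * \<theta> x v)) *\<^sub>R ?dE u + (4 * (\<mu> x * ?d\<theta> v u + ?d\<mu> u * \<theta> x v)) *\<^sub>R E x) -
      (\<omega> x v *\<^sub>R frechet_derivative \<eta> (at x) u + ?d\<omega> v u *\<^sub>R \<eta> x)" for u v
  proof -
    have "frechet_derivative (\<lambda>y. frechet_derivative \<zeta> (at y) v) (at x) u =
        frechet_derivative (\<lambda>y. - \<mu> y *\<^sub>R d\<Phi> y v + (4 * (\<mu> y * \<theta> y v)) *\<^sub>R E y + - \<omega> y v *\<^sub>R \<eta> y) (at x) u"
      by (subst frechet_derivative_cong_open[OF open_S x d\<zeta>_eq]) auto
    also have "\<dots> = frechet_derivative (\<lambda>y. - \<mu> y *\<^sub>R d\<Phi> y v + (4 * (\<mu> y * \<theta> y v)) *\<^sub>R E y) (at x) u +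
        frechet_derivative (\<lambda>y. - \<omega> y v *\<^sub>R \<eta> y) (at x) u"
      by (intro frechet_derivative_add_at diff smooth_on_add smooth_on_scaleR smooth_on_minus smooth_on_mult
          smooth_on_const smooth)
    also have "frechet_derivative (\<lambda>y. - \<mu> y *\<^sub>R d\<Phi> y v + (4 * (\<mu> y * \<theta> y v)) *\<^sub>R E y) (at x) u =
        - \<mu> x *\<^sub>R frechet_derivative (\<lambda>y. d\<Phi> y v) (at x) u + frechet_derivative (\<lambda>y. - \<mu> y) (at x) u *\<^sub>R d\<Phi> x v +
        ((4 * (\<mu> x * \<theta> x v)) *\<^sub>R ?dE u + frechet_derivative (\<lambda>y. 4 * (\<mu> y * \<theta> y v)) (at x) u *\<^sub>R E x)"
      by (intro frechet_derivative_scaleR_add_at diff smooth_on_minus smooth_on_mult smooth_on_const smooth)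
    also have "frechet_derivative (\<lambda>y. - \<omega> y v *\<^sub>R \<eta> y) (at x) u =
        - \<omega> x v *\<^sub>R frechet_derivative \<eta> (at x) u + frechet_derivative (\<lambda>y. - \<omega> y v) (at x) u *\<^sub>R \<eta> x"
      by (intro frechet_derivative_scaleR_at diff smooth_on_minus smooth)
    also have "frechet_derivative (\<lambda>y. 4 * (\<mu> y * \<theta> y v)) (at x) u = 4 * (\<mu> x * ?d\<theta> v u + ?d\<mu> u * \<theta> x v)"
      by (simp add: frechet_derivative_mult_at diff smooth_on_mult smooth differentiable_mult)
    finally show ?thesis
      by (simp add: frechet_derivative_minus_at diff smooth algebra_simps)
  qed
  \<comment> \<open>The second derivatives of \<open>\<Phi>\<close> and the derivatives of \<omega>
    cancel by symmetry; the terms in \<open>h x * w x\<close> come from the derivative of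
    \<open>\<eta>\<close>.\<close>
  have eq: "?d\<mu> (A x) *\<^sub>R (d\<Phi> x u - \<theta> x u *\<^sub>R E x) + (4 * \<mu> x) *\<^sub>R ?dE u
      + (4 * \<mu> x * ?d\<theta> (A x) u) *\<^sub>R E x + (h x * w x) *\<^sub>R (d\<Phi> x u - \<theta> x u *\<^sub>R E x) =
      (4 * \<mu> x * \<theta> x u) *\<^sub>R ?dE (A x) + (4 * \<mu> x * ?d\<theta> u (A x)) *\<^sub>R E x"
    using second_derivative_commute[OF smooth_\<zeta> x, of u "A x"]
    unfolding * d\<mu>_\<theta>[OF x, of u] second_derivative_commute[OF smooth_\<Phi> x, of u "A x"]
      codazzi_\<eta>(1)[OF x, of u "A x"] d\<eta>_\<omega>[OF x] \<omega>_eq[OF x] \<theta>_A[OF x]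
    by (simp add: E_def[symmetric] algebra_simps)
  have "(d\<Phi> x u - \<theta> x u *\<^sub>R E x) \<bullet> E x = 0"
    by (simp add: inner_diff_left E_E[OF x]) (simp add: \<theta>_def inner_commute)
  then have "4 * \<mu> x * ?d\<theta> (A x) u = 4 * \<mu> x * ?d\<theta> u (A x)"
    using arg_cong[OF eq, of "\<lambda>z. z \<bullet> E x"] by (simp add: inner_add_left dE_E[OF x] E_E[OF x])
  then show sym: "?d\<theta> (A x) u = ?d\<theta> u (A x)" using \<mu>_nonzero[OF x] by simp
  have "(4 * \<mu> x) *\<^sub>R ?dE u = (4 * \<mu> x) *\<^sub>R
      (\<kappa> x *\<^sub>R (d\<Phi> x u - \<theta> x u *\<^sub>R E x) + \<theta> x u *\<^sub>R ?dE (A x))"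
    using eq unfolding sym d\<mu>_A[OF x] by (simp add: algebra_simps)
  then show "?dE u = \<kappa> x *\<^sub>R (d\<Phi> x u - \<theta> x u *\<^sub>R E x) + \<theta> x u *\<^sub>R ?dE (A x)"
    using \<mu>_nonzero[OF x] by simp
qed

lemma d\<theta>_eq:
  assumes x: "x \<in> S"
  shows "frechet_derivative (\<lambda>y. \<theta> y v) (at x) u =
    E x \<bullet> frechet_derivative (\<lambda>y. d\<Phi> y v) (at x) u + frechet_derivative E (at x) u \<bullet> d\<Phi> x v"
  unfolding \<theta>_def
  by (intro frechet_derivative_inner_at smooth_on_differentiable[OF _ x] smooth_E smooth_on_derivative smooth_\<Phi>)

text \<open>The first part of \<open>codazzi_\<zeta>\<close> makes this derivative orthogonal to all
  tangent vectors, so the integral curves of \<open>E\<close> are geodesics of the submanifold. The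
  normal components follow from \<open>E\<close> being orthogonal to \<open>\<Phi>\<close>,
  \<open>\<eta>\<close> and \<open>\<zeta>\<close>.\<close>

lemma dE_A:
  assumes x: "x \<in> S"
  shows "frechet_derivative E (at x) (A x) = - \<Phi> x + h x *\<^sub>R \<eta> x - (3 * \<mu> x) *\<^sub>R \<zeta> x"
proof -
  let ?E' = "frechet_derivative E (at x) (A x)"
  have normal: "?E' \<bullet> d\<Phi> x u = 0" for u
    using codazzi_\<zeta>(1)[OF x, of u] dE_E[OF x, of u] second_derivative_commute[OF smooth_\<Phi> x, of u "A x"]
    by (simp add: d\<theta>_eq[OF x] E_def[symmetric])
  have tangential: "E y \<bullet> \<Phi> y = 0" "E y \<bullet> \<eta> y = 0" "E y \<bullet> \<zeta> y = 0" if "y \<in> S" for y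
    using \<Phi>_d\<Phi>[OF that] d\<Phi>_\<eta>[OF that] d\<Phi>_\<zeta>[OF that] by (simp_all add: E_def inner_commute)
  have "?E' \<bullet> \<Phi> x = - 1"
    using inner_const_derivative[OF smooth_E smooth_\<Phi> open_S x tangential(1), of "A x"] E_E[OF x]
    by (simp add: E_def[symmetric])
  moreover have "?E' \<bullet> \<eta> x = h x"
    using inner_const_derivative[OF smooth_E smooth_\<eta> open_S x tangential(2), of "A x"] E_E[OF x]
    by (simp add: d\<eta>_\<omega>[OF x] E_def[symmetric] inner_add_right inner_diff_right tangential[OF x])
  moreover have "?E' \<bullet> \<zeta> x = - 3 * \<mu> x"
    using inner_const_derivative[OF smooth_E smooth_\<zeta> open_S x tangential(3), of "A x"] E_E[OF x]
    by (simp add: d\<zeta>_eq[OF x] E_def[symmetric] inner_add_right inner_diff_right tangential[OF x] \<theta>_A[OF x])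
  ultimately show ?thesis
    using expansion[OF x, of ?E'] normal by (simp add: frame_def)
qed

text \<open>The coefficient of \<theta> when the derivative of \<open>E\<close> is written as
  \<kappa> d\<Phi> + \<theta> J, see \<open>dE_eq\<close>; that is, the derivative of
  \<open>E\<close> along itself minus \<kappa> E. In this form a further derivative can be
  taken.\<close>

definition J :: "real ^ 4 \<Rightarrow> real ^ 7" where
  "J x = - \<Phi> x + h x *\<^sub>R \<eta> x - (3 * \<mu> x) *\<^sub>R \<zeta> x - \<kappa> x *\<^sub>R E x"

lemma smooth_J: "smooth_on S J"
  unfolding J_def
  by (intro smooth_on_diff smooth_on_add smooth_on_minus smooth_on_scaleR smooth_on_mult smooth_on_const
      smooth_\<Phi> smooth_h smooth_\<eta> smooth_\<mu> smooth_\<zeta> smooth_\<kappa> smooth_E open_S)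

lemma dE_eq: "x \<in> S \<Longrightarrow> frechet_derivative E (at x) u = \<kappa> x *\<^sub>R d\<Phi> x u + \<theta> x u *\<^sub>R J x"
  unfolding codazzi_\<zeta>(2)[of x u] dE_A[of x] J_def by (simp add: algebra_simps)

lemma J_inner:
  assumes x: "x \<in> S"
  shows "J x \<bullet> d\<Phi> x v = - \<kappa> x * \<theta> x v"
  using \<Phi>_d\<Phi>[OF x, of v] d\<Phi>_\<eta>[OF x, of v] d\<Phi>_\<zeta>[OF x, of v]
  by (simp add: J_def inner_diff_left inner_add_left inner_commute[of "\<eta> x"] inner_commute[of "\<zeta> x"] \<theta>_def)

lemma d\<theta>_symmetric:
  assumes x: "x \<in> S"
  shows "frechet_derivative (\<lambda>y. \<theta> y v) (at x) u = frechet_derivative (\<lambda>y. \<theta> y u) (at x) v"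
  using second_derivative_commute[OF smooth_\<Phi> x, of u v]
  by (simp add: d\<theta>_eq[OF x] dE_eq[OF x] inner_add_left J_inner[OF x]
      inner_commute[of "d\<Phi> x u" "d\<Phi> x v"] mult.commute)

lemma dJ_eq:
  assumes x: "x \<in> S"
  shows "frechet_derivative J (at x) u = - d\<Phi> x u
    + (h x *\<^sub>R frechet_derivative \<eta> (at x) u + frechet_derivative h (at x) u *\<^sub>R \<eta> x)
    - 3 *\<^sub>R (\<mu> x *\<^sub>R frechet_derivative \<zeta> (at x) u + frechet_derivative \<mu> (at x) u *\<^sub>R \<zeta> x)
    - (\<kappa> x *\<^sub>R frechet_derivative E (at x) u + frechet_derivative \<kappa> (at x) u *\<^sub>R E x)"
proof -
  note smooth = smooth_\<Phi> smooth_h smooth_\<eta> smooth_\<mu> smooth_\<zeta> smooth_\<kappa> smooth_E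
  show ?thesis
    unfolding J_def
    by (rule frechet_derivative_eq)
      (rule derivative_eq_intros smooth_on_has_derivative[OF _ x] smooth refl | simp add: algebra_simps)+
qed

text \<open>The Riccati equation \<kappa>' + \<kappa>^2 + K = 0 of the leaves. By the Gauss equation
  a plane spanned by \<open>E\<close> and a vector orthogonal to it has curvature K = 1 + h^2 - 3
  \<mu>^2, from the eigenvalues h, h of A_\<eta> and - 3 \<mu>, \<mu> of A_\<zeta>.\<close>

lemma d\<kappa>_A:
  assumes x: "x \<in> S"
  shows "frechet_derivative \<kappa> (at x) (A x) = - 1 - (h x)\<^sup>2 + 3 * (\<mu> x)\<^sup>2 - (\<kappa> x)\<^sup>2"
proof -
  let ?d\<kappa> = "frechet_derivative \<kappa> (at x)" and ?dJ = "frechet_derivative J (at x)"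
  note diff = smooth_on_differentiable[OF _ x]
  have *: "frechet_derivative (\<lambda>y. frechet_derivative E (at y) v) (at x) u =
      \<kappa> x *\<^sub>R frechet_derivative (\<lambda>y. d\<Phi> y v) (at x) u + ?d\<kappa> u *\<^sub>R d\<Phi> x v +
      (\<theta> x v *\<^sub>R ?dJ u + frechet_derivative (\<lambda>y. \<theta> y v) (at x) u *\<^sub>R J x)" for u v
  proof -
    have "frechet_derivative (\<lambda>y. frechet_derivative E (at y) v) (at x) u =
        frechet_derivative (\<lambda>y. \<kappa> y *\<^sub>R d\<Phi> y v + \<theta> y v *\<^sub>R J y) (at x) u"
      by (subst frechet_derivative_cong_open[OF open_S x dE_eq]) auto
    also have "\<dots> = \<kappa> x *\<^sub>R frechet_derivative (\<lambda>y. d\<Phi> y v) (at x) u + ?d\<kappa> u *\<^sub>R d\<Phi> x v +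
      (\<theta> x v *\<^sub>R ?dJ u + frechet_derivative (\<lambda>y. \<theta> y v) (at x) u *\<^sub>R J x)"
      by (intro frechet_derivative_scaleR_add_at diff smooth_\<kappa> smooth_\<theta> smooth_J smooth_on_derivative smooth_\<Phi>)
    finally show ?thesis .
  qed
  obtain u where u: "u \<noteq> 0" "\<theta> x u = 0"
    using exists_kernel_orthogonal[OF linear_\<theta>[OF x], of 0] by auto
  \<comment> \<open>The derivative of \<open>J\<close> along \<open>u\<close> contains the opposite
    of the first term, and \<open>h\<close>, \<open>\<mu>\<close> are stationary along
    \<open>u\<close>; so only multiples of \<open>d\<Phi> x u\<close> survive.\<close>
  have "?d\<kappa> u *\<^sub>R E x + ?dJ u = ?d\<kappa> (A x) *\<^sub>R d\<Phi> x u"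
    using second_derivative_commute[OF smooth_E x, of "A x" u]
      second_derivative_commute[OF smooth_\<Phi> x, of "A x" u] d\<theta>_symmetric[OF x, of u "A x"]
    by (simp add: * u \<theta>_A[OF x] E_def[symmetric])
  then have "(?d\<kappa> (A x) - (- 1 - (h x)\<^sup>2 + 3 * (\<mu> x)\<^sup>2 - (\<kappa> x)\<^sup>2)) *\<^sub>R d\<Phi> x u = 0"
    using d\<mu>_\<theta>[OF x, of u]
    by (simp add: dJ_eq[OF x] d\<eta>_\<omega>[OF x] d\<zeta>_eq[OF x] dE_eq[OF x] dh_\<theta>[OF x] \<omega>_eq[OF x] u
        power2_eq_square algebra_simps)
  then show ?thesis using d\<Phi>_inj[OF x] u(1) by auto
qed

end

text \<open>
  The sum over \<open>j\<close> below is the coordinate vector of the tangential derivative of the frame field \<open>frame i\<close>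
  along itself, as it appears in the normal Laplacian.
\<close>

locale biharmonic_patch = umbilical_patch +
  assumes bitension: "\<And>x. x \<in> S \<Longrightarrow>
    (\<Sum>i\<in>UNIV.
        normal_part x (frechet_derivative (\<lambda>y. normal_part y
          (frechet_derivative (\<lambda>z. h z *\<^sub>R \<eta> z) (at y) (a i y))) (at x) (a i x))
      - normal_part x (frechet_derivative (\<lambda>z. h z *\<^sub>R \<eta> z) (at x)
          (\<Sum>j\<in>UNIV. (frechet_derivative (frame i) (at x) (a i x) \<bullet> frame j x) *\<^sub>R a j x)))
    = (4 * ((h x)\<^sup>2 - 1) * h x) *\<^sub>R \<eta> x"
begin

text \<open>The normal derivative of the mean curvature field h \<eta> along \<open>E\<close>; by
  \<open>normal_derivative_H\<close> the normal derivative vanishes in directions orthogonal to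
  \<open>E\<close>.\<close>

definition N :: "real ^ 4 \<Rightarrow> real ^ 7" where
  "N x = (\<mu> x * w x) *\<^sub>R \<eta> x + (h x * w x) *\<^sub>R \<zeta> x"

lemma smooth_N: "smooth_on S N"
  unfolding N_def by (intro smooth_on_add smooth_on_scaleR smooth_on_mult smooth_\<mu> smooth_w smooth_\<eta> smooth_h smooth_\<zeta> open_S)

lemma normal_part_d\<Phi>: "x \<in> S \<Longrightarrow> normal_part x (d\<Phi> x v) = 0"
  using d\<Phi>_expansion[of x v] \<Phi>_d\<Phi>[of x v] by (simp add: normal_part_def inner_commute[of "d\<Phi> x v" "\<Phi> x"])

lemma normal_part_inner:
  assumes x: "x \<in> S"
  shows "normal_part x u \<bullet> \<eta> x = u \<bullet> \<eta> x" "normal_part x u \<bullet> \<zeta> x = u \<bullet> \<zeta> x"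
  using \<Phi>_\<eta>[OF x] \<Phi>_\<zeta>[OF x] d\<Phi>_\<eta>[OF x] d\<Phi>_\<zeta>[OF x]
  by (simp_all add: normal_part_def inner_diff_left inner_sum_left frame_def)

lemma normal_part_N:
  assumes x: "x \<in> S"
  shows "normal_part x (N x) = N x"
proof -
  have "N x \<bullet> frame i x = 0" for i
    using d\<Phi>_\<eta>[OF x, of "a i x"] d\<Phi>_\<zeta>[OF x, of "a i x"]
    by (simp add: N_def frame_def inner_add_left inner_commute[of "\<eta> x"] inner_commute[of "\<zeta> x"])
  moreover have "N x \<bullet> \<Phi> x = 0"
    using \<Phi>_\<eta>[OF x] \<Phi>_\<zeta>[OF x]
    by (simp add: N_def inner_add_left inner_commute[of "\<eta> x"] inner_commute[of "\<zeta> x"])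
  ultimately show ?thesis by (simp add: normal_part_def)
qed

lemma normal_derivative_H:
  assumes x: "x \<in> S"
  shows "normal_part x (frechet_derivative (\<lambda>z. h z *\<^sub>R \<eta> z) (at x) v) = \<theta> x v *\<^sub>R N x"
proof -
  have "frechet_derivative (\<lambda>z. h z *\<^sub>R \<eta> z) (at x) v = - ((h x)\<^sup>2 *\<^sub>R d\<Phi> x v) + \<theta> x v *\<^sub>R N x"
    using smooth_on_differentiable[OF smooth_h x] smooth_on_differentiable[OF smooth_\<eta> x]
    by (simp add: frechet_derivative_scaleR_at dh_\<theta>[OF x] d\<eta>_\<omega>[OF x] \<omega>_eq[OF x] N_def
        power2_eq_square algebra_simps)
  then show ?thesis
    by (simp add: linear_add[OF linear_normal_part] linear_diff[OF linear_normal_part]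
        linear_neg[OF linear_normal_part] linear_cmul[OF linear_normal_part]
        normal_part_d\<Phi>[OF x] normal_part_N[OF x])
qed

text \<open>The divergence of \<open>E\<close>: \<kappa> for each of the three directions of a leaf,
  zero along the geodesic direction.\<close>

lemma trace_dE:
  assumes x: "x \<in> S"
  shows "(\<Sum>i\<in>UNIV. frechet_derivative E (at x) (a i x) \<bullet> frame i x) = 3 * \<kappa> x"
proof -
  have "frechet_derivative E (at x) (a i x) \<bullet> frame i x = \<kappa> x - \<kappa> x * (\<theta> x (a i x) * \<theta> x (a i x))" for i
    using orthonormal_a[OF x, of i i] J_inner[OF x, of "a i x"]
    by (simp add: dE_eq[OF x] inner_add_left frame_def)
  moreover have "(\<Sum>i\<in>UNIV. \<theta> x (a i x) * \<theta> x (a i x)) = 1"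
  proof -
    have "E x \<bullet> E x = (\<Sum>i\<in>UNIV. (E x \<bullet> frame i x) * (E x \<bullet> frame i x))"
      using arg_cong[OF d\<Phi>_expansion[OF x, of "A x"], of "\<lambda>z. E x \<bullet> z"]
      by (simp add: E_def[symmetric] inner_sum_right)
    then show ?thesis by (simp add: E_E[OF x] \<theta>_def frame_def)
  qed
  ultimately show ?thesis by (simp add: sum_subtractf sum_distrib_left[symmetric])
qed

text \<open>The normal derivative of H is \<theta> times N, so the normal Laplacian is the normal
  derivative of N along \<open>E\<close> plus (div E) N. The frame drops out: differentiating the
  inner product of \<open>E\<close> with a frame field yields a term with the derivative of that
  field, which the correction term of the Laplacian cancels.\<close>

lemma bitension_N:
  assumes x: "x \<in> S"
  shows "normal_part x (frechet_derivative N (at x) (A x)) + (3 * \<kappa> x) *\<^sub>R N x =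
    (4 * ((h x)\<^sup>2 - 1) * h x) *\<^sub>R \<eta> x"
proof -
  let ?n = "normal_part x" and ?dE = "frechet_derivative E (at x)" and ?dN = "frechet_derivative N (at x)"
  let ?H = "\<lambda>z. h z *\<^sub>R \<eta> z" and ?de = "\<lambda>i. frechet_derivative (frame i) (at x) (a i x)"
  note diff = smooth_on_differentiable[OF _ x]
  have "?n (frechet_derivative (\<lambda>y. normal_part y (frechet_derivative ?H (at y) (a i y))) (at x) (a i x))
      - ?n (frechet_derivative ?H (at x) (\<Sum>j\<in>UNIV. (?de i \<bullet> frame j x) *\<^sub>R a j x)) =
      \<theta> x (a i x) *\<^sub>R ?n (?dN (a i x)) + (?dE (a i x) \<bullet> frame i x) *\<^sub>R N x" for i
  proof -
    have "frechet_derivative (\<lambda>y. normal_part y (frechet_derivative ?H (at y) (a i y))) (at x) (a i x) =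
        frechet_derivative (\<lambda>y. (E y \<bullet> frame i y) *\<^sub>R N y) (at x) (a i x)"
      by (subst frechet_derivative_cong_open[OF open_S x, of _ "\<lambda>y. (E y \<bullet> frame i y) *\<^sub>R N y"])
        (simp_all add: normal_derivative_H \<theta>_def frame_def)
    also have "\<dots> = (E x \<bullet> frame i x) *\<^sub>R ?dN (a i x) +
        frechet_derivative (\<lambda>y. E y \<bullet> frame i y) (at x) (a i x) *\<^sub>R N x"
      by (intro frechet_derivative_scaleR_at diff smooth_on_inner smooth_E smooth_frame smooth_N open_S)
    also have "frechet_derivative (\<lambda>y. E y \<bullet> frame i y) (at x) (a i x) =
        E x \<bullet> ?de i + ?dE (a i x) \<bullet> frame i x"
      by (intro frechet_derivative_inner_at diff smooth_E smooth_frame)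
    finally have 1: "?n (frechet_derivative (\<lambda>y. normal_part y (frechet_derivative ?H (at y) (a i y))) (at x) (a i x)) =
        \<theta> x (a i x) *\<^sub>R ?n (?dN (a i x)) + (E x \<bullet> ?de i + ?dE (a i x) \<bullet> frame i x) *\<^sub>R N x"
      by (simp add: linear_add[OF linear_normal_part] linear_cmul[OF linear_normal_part]
          normal_part_N[OF x] \<theta>_def frame_def)
    have "\<theta> x (\<Sum>j\<in>UNIV. (?de i \<bullet> frame j x) *\<^sub>R a j x) = (\<Sum>j\<in>UNIV. (E x \<bullet> frame j x) * (?de i \<bullet> frame j x))"
      unfolding linear_sum[OF linear_\<theta>[OF x]] linear_cmul[OF linear_\<theta>[OF x]]
      by (simp add: \<theta>_def frame_def mult.commute)
    also have "\<dots> = ?de i \<bullet> E x"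
      using arg_cong[OF d\<Phi>_expansion[OF x, of "A x"], of "\<lambda>z. ?de i \<bullet> z"]
      by (simp add: E_def[symmetric] inner_sum_right)
    finally show ?thesis
      unfolding 1 normal_derivative_H[OF x] by (simp add: inner_commute[of "?de i"] algebra_simps)
  qed
  then have "(\<Sum>i\<in>UNIV. \<theta> x (a i x) *\<^sub>R ?n (?dN (a i x))) + (3 * \<kappa> x) *\<^sub>R N x =
      (4 * ((h x)\<^sup>2 - 1) * h x) *\<^sub>R \<eta> x"
    using bitension[OF x] by (simp add: sum.distrib scaleR_sum_left[symmetric] trace_dE[OF x])
  moreover have "(\<Sum>i\<in>UNIV. \<theta> x (a i x) *\<^sub>R ?n (?dN (a i x))) = ?n (?dN (A x))"
  proof -
    have "linear (\<lambda>v. ?n (?dN v))"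
      using linear_compose[OF smooth_on_linear[OF smooth_N x] linear_normal_part] by (simp add: o_def)
    from linear_functional_expansion[OF x this, of "A x"] show ?thesis
      by (simp add: \<theta>_def E_def frame_def)
  qed
  ultimately show ?thesis by simp
qed

lemma dN_eq:
  assumes x: "x \<in> S"
  shows "frechet_derivative N (at x) v = (\<mu> x * w x) *\<^sub>R frechet_derivative \<eta> (at x) v
      + (\<mu> x * frechet_derivative w (at x) v + frechet_derivative \<mu> (at x) v * w x) *\<^sub>R \<eta> x
    + ((h x * w x) *\<^sub>R frechet_derivative \<zeta> (at x) v
      + (h x * frechet_derivative w (at x) v + frechet_derivative h (at x) v * w x) *\<^sub>R \<zeta> x)"
proof -
  note diff = smooth_on_differentiable[OF _ x]
  note smooth = smooth_\<mu> smooth_w smooth_h smooth_\<eta> smooth_\<zeta> open_S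
  have "frechet_derivative N (at x) v = (\<mu> x * w x) *\<^sub>R frechet_derivative \<eta> (at x) v
      + frechet_derivative (\<lambda>x. \<mu> x * w x) (at x) v *\<^sub>R \<eta> x
    + ((h x * w x) *\<^sub>R frechet_derivative \<zeta> (at x) v
      + frechet_derivative (\<lambda>x. h x * w x) (at x) v *\<^sub>R \<zeta> x)"
    unfolding N_def by (intro frechet_derivative_scaleR_add_at diff smooth_on_mult smooth)
  then show ?thesis by (simp add: frechet_derivative_mult_at diff smooth)
qed

lemma d\<eta>_d\<zeta>_A:
  assumes x: "x \<in> S"
  shows "frechet_derivative \<eta> (at x) (A x) \<bullet> \<eta> x = 0" "frechet_derivative \<eta> (at x) (A x) \<bullet> \<zeta> x = w x"
    "frechet_derivative \<zeta> (at x) (A x) \<bullet> \<eta> x = - w x"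
proof -
  show "frechet_derivative \<eta> (at x) (A x) \<bullet> \<eta> x = 0"
    using inner_const_derivative[OF smooth_\<eta> smooth_\<eta> open_S x \<eta>_\<eta>, of "A x"] by (simp add: inner_commute)
  show 1: "frechet_derivative \<eta> (at x) (A x) \<bullet> \<zeta> x = w x"
    using \<omega>_eq[OF x, of "A x"] by (simp add: \<omega>_def \<theta>_A[OF x])
  show "frechet_derivative \<zeta> (at x) (A x) \<bullet> \<eta> x = - w x"
    using inner_const_derivative[OF smooth_\<eta> smooth_\<zeta> open_S x \<eta>_\<zeta>, of "A x"] 1
    by (simp add: inner_commute)
qed

lemma bitension_components:
  assumes x: "x \<in> S"
  defines "w' \<equiv> frechet_derivative w (at x) (A x)"
  shows "\<mu> x * w' + (- 4 * \<mu> x * \<kappa> x - h x * w x) * w x - h x * w x * w x + 3 * \<kappa> x * (\<mu> x * w x) =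
      4 * ((h x)\<^sup>2 - 1) * h x"
    and "\<mu> x * w x * w x + (h x * w' + \<mu> x * w x * w x) + 3 * \<kappa> x * (h x * w x) = 0"
proof -
  have \<zeta>_\<eta>: "\<zeta> x \<bullet> \<eta> x = 0" using \<eta>_\<zeta>[OF x] by (simp add: inner_commute)
  note simps = inner_add_left normal_part_inner[OF x] dN_eq[OF x] d\<eta>_d\<zeta>_A[OF x] d\<zeta>_\<zeta>[OF x] N_def
    \<eta>_\<eta>[OF x] \<zeta>_\<zeta>[OF x] \<eta>_\<zeta>[OF x] \<zeta>_\<eta> d\<mu>_A[OF x] dh_A[OF x] w'_def
  show "\<mu> x * w' + (- 4 * \<mu> x * \<kappa> x - h x * w x) * w x - h x * w x * w x + 3 * \<kappa> x * (\<mu> x * w x) =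
      4 * ((h x)\<^sup>2 - 1) * h x"
    using arg_cong[OF bitension_N[OF x], of "\<lambda>z. z \<bullet> \<eta> x"] by (simp add: simps)
  show "\<mu> x * w x * w x + (h x * w' + \<mu> x * w x * w x) + 3 * \<kappa> x * (h x * w x) = 0"
    using arg_cong[OF bitension_N[OF x], of "\<lambda>z. z \<bullet> \<zeta> x"] by (simp add: simps)
qed

lemma dw_A:
  "x \<in> S \<Longrightarrow> h x * frechet_derivative w (at x) (A x) = - 2 * (w x)\<^sup>2 * \<mu> x - 3 * \<kappa> x * h x * w x"
  using bitension_components(2)[of x] by (simp add: power2_eq_square algebra_simps)

text \<open>Both components of the normal equation contain the derivative of \<open>w\<close>.
  Eliminating it by \<open>dw_A\<close> leaves a relation free of derivatives, to accompany the four
  equations \<open>dh_A\<close>, \<open>d\<mu>_A\<close>, \<open>d\<kappa>_A\<close> and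
  \<open>dw_A\<close>.\<close>

lemma tension_constraint:
  assumes x: "x \<in> S"
  shows "w x * (2 * \<kappa> x * \<mu> x * h x + (\<mu> x)\<^sup>2 * w x + (h x)\<^sup>2 * w x) = 2 * (h x)\<^sup>2 * (1 - (h x)\<^sup>2)"
  using arg_cong[OF bitension_components(1)[OF x], of "\<lambda>z. h x * z"] dw_A[OF x]
  by algebra

end


section \<open>Elimination\<close>

text \<open>The two polynomials are those of \<open>first_relation\<close> and
  \<open>second_relation\<close>, with \<open>x\<close> for \<open>\<rho>\<close> and
  \<open>s\<close> for \<open>\<sigma>\<close>. Eliminating \<open>s\<close> leaves one non-zero
  polynomial in \<open>x\<close>.\<close>

lemma finite_common_zeros:
  "finite {x :: real. \<exists>s.
     9 * x ^ 3 - 5 * x\<^sup>2 - 7 * x + s * (60 * x\<^sup>2 - 29 * x - 8) + s\<^sup>2 * (66 * x - 32) = 0 \<and>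
     (60 * x\<^sup>2 - 29 * x - 8 + 2 * s * (66 * x - 32)) *
       (- 12 * s\<^sup>2 * x - 6 * s * x - 3 * x ^ 3 - 3 * x\<^sup>2 + (3 * x - 2) * ((2 * s + x + 1) * (8 * s + 7 * x))) +
     6 * x\<^sup>2 * (27 * x\<^sup>2 - 10 * x - 7 + s * (120 * x - 29) + 66 * s\<^sup>2) * (- 2 - 2 * x - 8 * s) = 0}"
  (is "finite {x. \<exists>s. ?p x s = 0 \<and> ?q x s = 0}")
proof -
  \<comment> \<open>pseudo-division in \<open>s\<close> of the second polynomial by the first leaves the remainder \<open>\<beta> s + \<alpha>\<close>,
    and \<open>r\<close> is the first polynomial, with denominators cleared, at \<open>s = - \<alpha> / \<beta>\<close>\<close>
  define \<alpha> :: "real poly" where "\<alpha> = [:0, -7168, 58944, -184872, 268488, -232407, -137808, 197802:]"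
  define \<beta> :: "real poly" where "\<beta> = [:-8192, 72192, -245760, 374904, -197136, -454707, 416988:]"
  define r where "r = [:-32, 66:] * \<alpha>\<^sup>2 - [:-8, -29, 60:] * \<alpha> * \<beta> + [:0, -7, -5, 9:] * \<beta>\<^sup>2"
  have "poly r x = 0" if p: "?p x s = 0" and q: "?q x s = 0" for x s
  proof -
    have "(33 * x - 16)\<^sup>2 * ?q x s = 2 * ((- 3072 + 10688 * x + 4224 * x\<^sup>2 - 45243 * x ^ 3 + 23760 * x ^ 4
        + s * (- 8192 + 43008 * x - 60192 * x\<^sup>2 + 13068 * x ^ 3)) * ?p x s + poly \<beta> x * s + poly \<alpha> x)"
      unfolding \<alpha>_def \<beta>_def by (simp add: algebra_simps power2_eq_square power3_eq_cube power4_eq_xxxx)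
    then have lin: "poly \<beta> x * s + poly \<alpha> x = 0" using p q by simp
    have "poly r x = (66 * x - 32) * (poly \<alpha> x)\<^sup>2 - (60 * x\<^sup>2 - 29 * x - 8) * poly \<alpha> x * poly \<beta> x
        + (9 * x ^ 3 - 5 * x\<^sup>2 - 7 * x) * (poly \<beta> x)\<^sup>2"
      unfolding r_def by (simp add: algebra_simps power2_eq_square power3_eq_cube)
    \<comment> \<open>Substituting for \<alpha> instead of dividing by \<beta> covers the points
      where \<beta> vanishes.\<close>
    also have "poly \<alpha> x = - (poly \<beta> x * s)" using lin by simp
    also have "(66 * x - 32) * (- (poly \<beta> x * s))\<^sup>2 - (60 * x\<^sup>2 - 29 * x - 8) * (- (poly \<beta> x * s)) * poly \<beta> x
        + (9 * x ^ 3 - 5 * x\<^sup>2 - 7 * x) * (poly \<beta> x)\<^sup>2 = (poly \<beta> x)\<^sup>2 * ?p x s"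
      by (simp add: algebra_simps power2_eq_square)
    finally show ?thesis using p by simp
  qed
  then have "{x. \<exists>s. ?p x s = 0 \<and> ?q x s = 0} \<subseteq> {x. poly r x = 0}" by blast
  moreover have "poly r 1 \<noteq> 0" by (simp add: r_def \<alpha>_def \<beta>_def)
  then have "r \<noteq> 0" by auto
  ultimately show ?thesis using poly_roots_finite finite_subset by blast
qed

context biharmonic_patch
begin

text \<open>
  The system is invariant under scaling up to the curvature of the ambient space, and \<open>\<rho>\<close>, \<open>\<sigma>\<close> are scale
  invariant; derivatives along \<open>E\<close> are measured in units of \<open>q\<close>.
\<close>

definition \<rho> :: "real ^ 4 \<Rightarrow> real" where "\<rho> x = (\<mu> x)\<^sup>2 / (h x)\<^sup>2"
definition \<sigma> :: "real ^ 4 \<Rightarrow> real" where "\<sigma> x = \<kappa> x * \<mu> x / (h x * w x)"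
definition R :: "real ^ 4 \<Rightarrow> real" where "R x = (2 * \<sigma> x + \<rho> x + 1) * (8 * \<sigma> x + 7 * \<rho> x)"
definition q :: "real ^ 4 \<Rightarrow> real" where "q x = \<mu> x * w x / h x"

abbreviation ddA :: "(real ^ 4 \<Rightarrow> real) \<Rightarrow> real ^ 4 \<Rightarrow> real" where
  "ddA f x \<equiv> frechet_derivative f (at x) (A x)"

lemma smooth_\<rho>: "smooth_on S \<rho>"
  unfolding \<rho>_def by (intro smooth_on_divide smooth_on_power smooth_\<mu> smooth_h open_S) (use h_pos in force)

lemma smooth_\<sigma>: "smooth_on S \<sigma>"
  unfolding \<sigma>_def by (intro smooth_on_divide smooth_on_mult smooth_\<kappa> smooth_\<mu> smooth_h smooth_w open_S)
    (use h_pos w_pos in force)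

lemma \<rho>_pos: "x \<in> S \<Longrightarrow> \<rho> x > 0"
  using h_pos[of x] \<mu>_nonzero[of x] by (simp add: \<rho>_def)

lemma q_nonzero: "x \<in> S \<Longrightarrow> q x \<noteq> 0"
  using h_pos[of x] w_pos[of x] \<mu>_nonzero[of x] by (simp add: q_def)

lemma quotients:
  assumes "x \<in> S"
  shows "\<rho> x * (h x)\<^sup>2 = (\<mu> x)\<^sup>2" "\<sigma> x * (h x * w x) = \<kappa> x * \<mu> x" "q x * h x = \<mu> x * w x"
  using h_pos[OF assms] w_pos[OF assms] by (simp_all add: \<rho>_def \<sigma>_def q_def)

lemma ddA_zero:
  assumes f: "smooth_on S f" and x: "x \<in> S" and zero: "\<And>y. y \<in> S \<Longrightarrow> f y = c"
  shows "ddA f x = 0"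
  using frechet_derivative_cong_open[OF open_S x, of f "\<lambda>_. c"] zero by simp

lemma ddA_mult: "\<lbrakk>smooth_on S f; smooth_on S g; x \<in> S\<rbrakk> \<Longrightarrow> ddA (\<lambda>y. f y * g y) x = f x * ddA g x + ddA f x * g x"
  by (simp add: frechet_derivative_mult_at smooth_on_differentiable)

lemma ddA_power2: "\<lbrakk>smooth_on S f; x \<in> S\<rbrakk> \<Longrightarrow> ddA (\<lambda>y. (f y)\<^sup>2) x = 2 * f x * ddA f x"
  by (simp add: power2_eq_square ddA_mult)

lemma ddA_power4: "\<lbrakk>smooth_on S f; x \<in> S\<rbrakk> \<Longrightarrow> ddA (\<lambda>y. f y ^ 4) x = 4 * f x ^ 3 * ddA f x"
  by (simp add: power4_eq_xxxx power3_eq_cube ddA_mult smooth_on_mult open_S)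

lemma ddA_add: "\<lbrakk>smooth_on S f; smooth_on S g; x \<in> S\<rbrakk> \<Longrightarrow> ddA (\<lambda>y. f y + g y) x = ddA f x + ddA g x"
  by (simp add: frechet_derivative_add_at smooth_on_differentiable)

lemma ddA_diff: "\<lbrakk>smooth_on S f; smooth_on S g; x \<in> S\<rbrakk> \<Longrightarrow> ddA (\<lambda>y. f y - g y) x = ddA f x - ddA g x"
  by (simp add: frechet_derivative_diff_at smooth_on_differentiable)

lemmas ddA_simps = ddA_mult ddA_power2 ddA_power4 ddA_add ddA_diff

lemmas smooth_intros = smooth_on_mult smooth_on_power smooth_on_add smooth_on_diff smooth_on_const
  smooth_h smooth_\<mu> smooth_w smooth_\<kappa> smooth_\<rho> smooth_\<sigma> open_S

section \<open>The planar system for \<open>\<rho>\<close> and \<open>\<sigma>\<close>\<close>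

lemma ddA_\<rho>:
  assumes x: "x \<in> S"
  shows "ddA \<rho> x = q x * (- 2 - 2 * \<rho> x - 8 * \<sigma> x)"
proof -
  have "ddA (\<lambda>y. \<rho> y * (h y)\<^sup>2) x = ddA (\<lambda>y. (\<mu> y)\<^sup>2) x"
    by (subst frechet_derivative_cong_open[OF open_S x, of _ "\<lambda>y. (\<mu> y)\<^sup>2"]) (use h_pos in \<open>force simp: \<rho>_def\<close>)+
  then have "ddA \<rho> x * (h x)\<^sup>2 = 2 * \<mu> x * (- 4 * \<mu> x * \<kappa> x - h x * w x) - \<rho> x * (2 * h x * (\<mu> x * w x))"
    by (simp add: ddA_simps smooth_intros x dh_A d\<mu>_A)
  then have "(h x)\<^sup>2 * ddA \<rho> x = (h x)\<^sup>2 * (q x * (- 2 - 2 * \<rho> x - 8 * \<sigma> x))"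
    using quotients[OF x] by algebra
  then show ?thesis using h_pos[OF x] by simp
qed

lemma ddA_\<sigma>:
  assumes x: "x \<in> S"
  shows "ddA \<sigma> x * (h x)\<^sup>2 * w x = h x * \<mu> x * (- 1 - (h x)\<^sup>2 + 3 * (\<mu> x)\<^sup>2 - (\<kappa> x)\<^sup>2)
    + h x * \<kappa> x * (- 4 * \<mu> x * \<kappa> x - h x * w x) + \<kappa> x * \<mu> x * (\<mu> x * w x + 3 * \<kappa> x * h x)"
proof -
  have "ddA (\<lambda>y. \<sigma> y * (h y * w y)) x = ddA (\<lambda>y. \<kappa> y * \<mu> y) x"
    by (subst frechet_derivative_cong_open[OF open_S x, of _ "\<lambda>y. \<kappa> y * \<mu> y"])
      (use h_pos w_pos in \<open>force simp: \<sigma>_def\<close>)+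
  then have "\<sigma> x * (h x * ddA w x + \<mu> x * w x * w x) + ddA \<sigma> x * (h x * w x) =
      \<kappa> x * (- 4 * \<mu> x * \<kappa> x - h x * w x) + (- 1 - (h x)\<^sup>2 + 3 * (\<mu> x)\<^sup>2 - (\<kappa> x)\<^sup>2) * \<mu> x"
    by (simp add: ddA_simps smooth_intros x dh_A d\<mu>_A d\<kappa>_A)
  then show ?thesis using dw_A[OF x] quotients(2)[OF x] by algebra
qed

text \<open>The derivative of \<open>tension_constraint\<close> along \<open>E\<close>, with the
  constraint used once more for its inhomogeneous part. The ambient curvature has dropped out: every
  term has degree five in h, \<mu>, w, \<kappa>.\<close>

lemma tension_derivative:
  assumes x: "x \<in> S"
  shows "(2 * \<kappa> x * \<mu> x * h x + (\<mu> x)\<^sup>2 * w x + (h x)\<^sup>2 * w x) * (8 * \<kappa> x * h x + 7 * \<mu> x * w x) =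
    6 * (\<mu> x) ^ 3 * (h x)\<^sup>2"
proof -
  let ?G = "\<lambda>y. w y * (2 * (\<kappa> y * \<mu> y * h y) + (\<mu> y)\<^sup>2 * w y + (h y)\<^sup>2 * w y) - 2 * ((h y)\<^sup>2 * (1 - (h y)\<^sup>2))"
  have "ddA ?G x = 0"
    by (rule ddA_zero[OF _ x, of _ 0]) (auto intro!: smooth_intros dest!: tension_constraint simp: mult.assoc)
  moreover have "ddA ?G x = w x * (2 * (\<kappa> x * \<mu> x * (\<mu> x * w x) + (\<kappa> x * (- 4 * \<mu> x * \<kappa> x - h x * w x)
        + (- 1 - (h x)\<^sup>2 + 3 * (\<mu> x)\<^sup>2 - (\<kappa> x)\<^sup>2) * \<mu> x) * h x)
      + ((\<mu> x)\<^sup>2 * ddA w x + 2 * \<mu> x * (- 4 * \<mu> x * \<kappa> x - h x * w x) * w x)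
      + ((h x)\<^sup>2 * ddA w x + 2 * h x * (\<mu> x * w x) * w x))
      + ddA w x * (2 * (\<kappa> x * \<mu> x * h x) + (\<mu> x)\<^sup>2 * w x + (h x)\<^sup>2 * w x)
      - 2 * (2 * h x * (\<mu> x * w x) * (1 - (h x)\<^sup>2) - (h x)\<^sup>2 * (2 * h x * (\<mu> x * w x)))"
    by (simp add: ddA_simps smooth_intros x dh_A d\<mu>_A d\<kappa>_A)
  ultimately have "w x * ((2 * \<kappa> x * \<mu> x * h x + (\<mu> x)\<^sup>2 * w x + (h x)\<^sup>2 * w x) * (8 * \<kappa> x * h x + 7 * \<mu> x * w x)) =
      w x * (6 * (\<mu> x) ^ 3 * (h x)\<^sup>2)"
    using tension_constraint[OF x] dw_A[OF x] by algebra
  then show ?thesis using w_pos[OF x] by simp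
qed

text \<open>The scale-invariant form of \<open>tension_derivative\<close>. It determines the third
  ratio, w^2 / h^2 = 6 \<rho>^2 / R, and so closes the system in \<rho> and \<sigma>; it also gives
  the sign of \<open>R\<close>.\<close>

lemma R_eq:
  assumes x: "x \<in> S"
  shows "R x * ((h x)\<^sup>2 * (w x)\<^sup>2) = 6 * \<mu> x ^ 4"
proof -
  have "R x * ((h x)\<^sup>2 * (w x)\<^sup>2) * (h x)\<^sup>2 = \<mu> x * ((2 * \<kappa> x * \<mu> x * h x + (\<mu> x)\<^sup>2 * w x + (h x)\<^sup>2 * w x) *
      (8 * \<kappa> x * h x + 7 * \<mu> x * w x))"
    using h_pos[OF x] w_pos[OF x] by (simp add: R_def \<rho>_def \<sigma>_def field_simps power2_eq_square)
  also have "\<dots> = 6 * \<mu> x ^ 4 * (h x)\<^sup>2"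
    unfolding tension_derivative[OF x] by (simp add: power2_eq_square power3_eq_cube power4_eq_xxxx)
  finally show ?thesis using h_pos[OF x] by simp
qed

lemma R_pos:
  assumes x: "x \<in> S"
  shows "R x > 0"
proof -
  have "R x * ((h x)\<^sup>2 * (w x)\<^sup>2) > 0" using R_eq[OF x] \<mu>_nonzero[OF x] by simp
  then show ?thesis by (metis mult_nonneg_nonneg zero_le_power2 zero_less_mult_pos2 less_eq_real_def mult_zero_right)
qed

text \<open>Two substitutions in \<open>ddA_\<sigma>\<close>: \<open>tension_constraint\<close>
  removes the ambient curvature, then \<open>R_eq\<close> removes h^2 / w^2 = R / (6 \<rho>^2),
  whence the factor on the left.\<close>

lemma ddA_\<sigma>_normalised:
  assumes x: "x \<in> S"
  shows "6 * (\<rho> x)\<^sup>2 * ddA \<sigma> x = q x * (- 12 * (\<sigma> x)\<^sup>2 * \<rho> x - 6 * \<sigma> x * \<rho> x - 3 * (\<rho> x) ^ 3 - 3 * (\<rho> x)\<^sup>2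
    + (3 * \<rho> x - 2) * R x)"
proof -
  have 1: "6 * (h x) ^ 3 * w x * ddA \<sigma> x = - 12 * (\<kappa> x)\<^sup>2 * \<mu> x * (h x)\<^sup>2 - 6 * \<kappa> x * w x * (h x) ^ 3
      - 3 * (w x)\<^sup>2 * \<mu> x * ((\<mu> x)\<^sup>2 + (h x)\<^sup>2) + 6 * (3 * (\<mu> x)\<^sup>2 - 2 * (h x)\<^sup>2) * \<mu> x * (h x)\<^sup>2"
    using ddA_\<sigma>[OF x] tension_constraint[OF x] by algebra
  have "(h x ^ 7 * w x) * (6 * (\<rho> x)\<^sup>2 * ddA \<sigma> x) =
      (\<rho> x * (h x)\<^sup>2)\<^sup>2 * (6 * (h x) ^ 3 * w x * ddA \<sigma> x)"
    by (simp add: algebra_simps eval_nat_numeral)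
  also have "\<dots> = \<mu> x * (- 12 * (\<kappa> x * \<mu> x)\<^sup>2 * (\<mu> x)\<^sup>2 * (h x)\<^sup>2
      - 6 * (\<kappa> x * \<mu> x) * (\<mu> x)\<^sup>2 * (h x) ^ 3 * w x - 3 * ((\<mu> x)\<^sup>2) ^ 3 * (w x)\<^sup>2
      - 3 * ((\<mu> x)\<^sup>2)\<^sup>2 * (h x)\<^sup>2 * (w x)\<^sup>2 + (3 * (\<mu> x)\<^sup>2 - 2 * (h x)\<^sup>2) * (6 * \<mu> x ^ 4) * (h x)\<^sup>2)"
    unfolding quotients(1)[OF x] 1 by (simp add: algebra_simps eval_nat_numeral)
  also have "\<dots> = \<mu> x * w x * (h x ^ 6 * w x * (- 12 * (\<sigma> x)\<^sup>2 * \<rho> x - 6 * \<sigma> x * \<rho> x - 3 * (\<rho> x) ^ 3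
      - 3 * (\<rho> x)\<^sup>2 + (3 * \<rho> x - 2) * R x))"
    unfolding R_eq[OF x, symmetric] quotients(1,2)[OF x, symmetric]
    by (simp add: algebra_simps eval_nat_numeral)
  also have "\<dots> = (h x ^ 7 * w x) * (q x * (- 12 * (\<sigma> x)\<^sup>2 * \<rho> x - 6 * \<sigma> x * \<rho> x - 3 * (\<rho> x) ^ 3
      - 3 * (\<rho> x)\<^sup>2 + (3 * \<rho> x - 2) * R x))"
    unfolding quotients(3)[OF x, symmetric] by (simp add: eval_nat_numeral)
  finally show ?thesis using h_pos[OF x] w_pos[OF x] by simp
qed

lemma ddA_R:
  assumes x: "x \<in> S"
  shows "ddA R x = (8 + 22 * \<rho> x + 32 * \<sigma> x) * ddA \<sigma> x + (7 + 14 * \<rho> x + 22 * \<sigma> x) * ddA \<rho> x"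
  unfolding R_def by (simp add: ddA_simps smooth_intros x algebra_simps)

text \<open>The logarithmic derivative of R = 6 \<mu>^4 / (h^2 w^2), as opposed to
  \<open>ddA_R\<close>, which differentiates \<open>R\<close> as a polynomial in \<rho> and
  \<sigma>.\<close>

lemma ddA_R_normalised:
  assumes x: "x \<in> S"
  shows "\<rho> x * ddA R x = q x * R x * (2 * \<rho> x - 10 * \<sigma> x - 4)"
proof -
  note pos = h_pos[OF x] w_pos[OF x] \<mu>_nonzero[OF x]
  have smooth_R: "smooth_on S R" unfolding R_def by (intro smooth_intros)
  have "ddA (\<lambda>y. R y * ((h y)\<^sup>2 * (w y)\<^sup>2)) x = ddA (\<lambda>y. 6 * \<mu> y ^ 4) x"
    by (subst frechet_derivative_cong_open[OF open_S x, of _ "\<lambda>y. 6 * \<mu> y ^ 4"]) (auto simp: R_eq)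
  then have "R x * ((h x)\<^sup>2 * (2 * w x * ddA w x) + 2 * h x * (\<mu> x * w x) * (w x)\<^sup>2) + ddA R x * ((h x)\<^sup>2 * (w x)\<^sup>2) =
      6 * (4 * \<mu> x ^ 3 * (- 4 * \<mu> x * \<kappa> x - h x * w x))"
    by (simp add: ddA_simps smooth_intros smooth_R x dh_A d\<mu>_A)
  then have "(h x)\<^sup>2 * (w x)\<^sup>2 * \<mu> x * (ddA R x * \<mu> x * h x) =
      (h x)\<^sup>2 * (w x)\<^sup>2 * \<mu> x * (R x * (2 * (\<mu> x)\<^sup>2 * w x - 10 * \<kappa> x * \<mu> x * h x - 4 * (h x)\<^sup>2 * w x))"
    using dw_A[OF x] R_eq[OF x] by algebra
  then have "ddA R x * \<mu> x * h x = R x * (2 * (\<mu> x)\<^sup>2 * w x - 10 * \<kappa> x * \<mu> x * h x - 4 * (h x)\<^sup>2 * w x)"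
    using pos by simp
  then have "ddA R x = R x * (2 * (\<mu> x)\<^sup>2 * w x - 10 * \<kappa> x * \<mu> x * h x - 4 * (h x)\<^sup>2 * w x) / (\<mu> x * h x)"
    using pos by (simp add: field_simps)
  then show ?thesis
    using pos by (simp add: \<rho>_def \<sigma>_def q_def) (simp add: field_simps power2_eq_square)
qed

text \<open>The two expressions for the derivative of \<open>R\<close>, in \<open>ddA_R\<close> and
  \<open>ddA_R_normalised\<close>, must agree. Their difference contains the factor 2 \<sigma> +
  \<rho> + 1, which divides \<open>R\<close> and is therefore non-zero; the cofactor is this
  relation.\<close>

lemma first_relation:
  assumes x: "x \<in> S"
  shows "9 * (\<rho> x) ^ 3 - 5 * (\<rho> x)\<^sup>2 - 7 * \<rho> x + \<sigma> x * (60 * (\<rho> x)\<^sup>2 - 29 * \<rho> x - 8) + (\<sigma> x)\<^sup>2 * (66 * \<rho> x - 32) = 0"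
    (is "?p = 0")
proof -
  let ?L = "2 * \<sigma> x + \<rho> x + 1"
  have "6 * \<rho> x * (q x * R x * (2 * \<rho> x - 10 * \<sigma> x - 4)) =
      (8 + 22 * \<rho> x + 32 * \<sigma> x) * (6 * (\<rho> x)\<^sup>2 * ddA \<sigma> x) + 6 * (\<rho> x)\<^sup>2 * (7 + 14 * \<rho> x + 22 * \<sigma> x) * ddA \<rho> x"
    using ddA_R_normalised[OF x] ddA_R[OF x] by algebra
  then have "q x * (16 * ?L * ?p) = 0"
    unfolding ddA_\<sigma>_normalised[OF x] ddA_\<rho>[OF x] R_def
    by algebra
  moreover have "?L \<noteq> 0" using R_pos[OF x] by (auto simp: R_def)
  ultimately show ?thesis using q_nonzero[OF x] by simp
qed

text \<open>The chain rule for \<open>first_relation\<close>: \<open>?a\<close> is its partial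
  derivative in \<sigma>, \<open>?c\<close> is 6 \<rho>^2 times the one in \<rho>, and
  \<open>?b\<close>, \<open>?d\<close> are the right-hand sides of
  \<open>ddA_\<sigma>_normalised\<close> and \<open>ddA_\<rho>\<close> in units of
  \<open>q\<close>.\<close>

lemma second_relation:
  assumes x: "x \<in> S"
  shows "(60 * (\<rho> x)\<^sup>2 - 29 * \<rho> x - 8 + 2 * \<sigma> x * (66 * \<rho> x - 32)) *
       (- 12 * (\<sigma> x)\<^sup>2 * \<rho> x - 6 * \<sigma> x * \<rho> x - 3 * (\<rho> x) ^ 3 - 3 * (\<rho> x)\<^sup>2
        + (3 * \<rho> x - 2) * ((2 * \<sigma> x + \<rho> x + 1) * (8 * \<sigma> x + 7 * \<rho> x))) +
     6 * (\<rho> x)\<^sup>2 * (27 * (\<rho> x)\<^sup>2 - 10 * \<rho> x - 7 + \<sigma> x * (120 * \<rho> x - 29) + 66 * (\<sigma> x)\<^sup>2)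
       * (- 2 - 2 * \<rho> x - 8 * \<sigma> x) = 0" (is "?a * ?b + ?c * ?d = 0")
proof -
  let ?p = "\<lambda>y. 9 * (\<rho> y * (\<rho> y)\<^sup>2) - 5 * (\<rho> y)\<^sup>2 - 7 * \<rho> y + \<sigma> y * (60 * (\<rho> y)\<^sup>2 - 29 * \<rho> y - 8)
    + (\<sigma> y)\<^sup>2 * (66 * \<rho> y - 32)"
  have "ddA ?p x = 0"
    by (rule ddA_zero[OF _ x, of _ 0])
      (auto intro!: smooth_intros dest!: first_relation simp: power2_eq_square power3_eq_cube)
  moreover have "6 * (\<rho> x)\<^sup>2 * ddA ?p x = ?a * (6 * (\<rho> x)\<^sup>2 * ddA \<sigma> x) + ?c * ddA \<rho> x"
    by (simp add: ddA_simps smooth_intros x) (simp add: algebra_simps power2_eq_square)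
  ultimately have "q x * (?a * ?b + ?c * ?d) = 0"
    unfolding ddA_\<sigma>_normalised[OF x] ddA_\<rho>[OF x] R_def by algebra
  then show ?thesis using q_nonzero[OF x] by simp
qed

lemma connected_imp_empty:
  assumes "connected S"
  shows "S = {}"
proof (rule ccontr)
  assume "S \<noteq> {}"
  have "\<rho> ` S \<subseteq> {x. \<exists>s.
     9 * x ^ 3 - 5 * x\<^sup>2 - 7 * x + s * (60 * x\<^sup>2 - 29 * x - 8) + s\<^sup>2 * (66 * x - 32) = 0 \<and>
     (60 * x\<^sup>2 - 29 * x - 8 + 2 * s * (66 * x - 32)) *
       (- 12 * s\<^sup>2 * x - 6 * s * x - 3 * x ^ 3 - 3 * x\<^sup>2 + (3 * x - 2) * ((2 * s + x + 1) * (8 * s + 7 * x))) +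
     6 * x\<^sup>2 * (27 * x\<^sup>2 - 10 * x - 7 + s * (120 * x - 29) + 66 * s\<^sup>2) * (- 2 - 2 * x - 8 * s) = 0}"
    using first_relation second_relation by blast
  then have "finite (\<rho> ` S)" using finite_common_zeros finite_subset by blast
  then have "\<rho> constant_on S"
    by (intro continuous_finite_range_constant assms smooth_on_continuous_on smooth_\<rho>)
  then obtain c where c: "\<And>y. y \<in> S \<Longrightarrow> \<rho> y = c" unfolding constant_on_def by blast
  \<comment> \<open>A constant \<rho> makes the right-hand side of \<open>ddA_\<rho>\<close> vanish.
    Hence \<sigma> is constant as well, and its own equation becomes a polynomial condition on
    \<open>c\<close>.\<close>
  have \<sigma>: "\<sigma> y = - (1 + c) / 4" if y: "y \<in> S" for y
    using ddA_\<rho>[OF y] ddA_zero[OF smooth_\<rho> y c] q_nonzero[OF y] c[OF y] by simp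
  obtain x where x: "x \<in> S" using \<open>S \<noteq> {}\<close> by blast
  have pos: "c > 0" using \<rho>_pos[OF x] c[OF x] by simp
  have R: "R x = (1 + c) / 2 * (5 * c - 2)"
    unfolding R_def c[OF x] \<sigma>[OF x] by (simp add: field_simps)
  have "- 12 * (\<sigma> x)\<^sup>2 * c - 6 * \<sigma> x * c - 3 * c ^ 3 - 3 * c\<^sup>2 + (3 * c - 2) * R x = 0"
    using ddA_\<sigma>_normalised[OF x] ddA_zero[OF smooth_\<sigma> x \<sigma>] q_nonzero[OF x] c[OF x] by simp
  then have "(1 + c) * ((3 * c - 1) * (5 * c - 8)) = 0"
    unfolding R \<sigma>[OF x] by (simp add: field_simps power2_eq_square power3_eq_cube)
  \<comment> \<open>The two equilibria of the planar system fail for different reasons: c = 1/3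
    would make \<open>R\<close> negative, and c = 8/5 violates
    \<open>first_relation\<close>.\<close>
  then have "3 * c - 1 = 0 \<or> 5 * c - 8 = 0" using pos by auto
  then show False
  proof
    assume "3 * c - 1 = 0"
    then have c: "c = 1 / 3" by simp
    show False using R_pos[OF x] unfolding R c by simp
  next
    assume "5 * c - 8 = 0"
    then have c': "c = 8 / 5" by simp
    show False using first_relation[OF x] unfolding c[OF x] \<sigma>[OF x] c' by (simp add: power2_eq_square power3_eq_cube)
  qed
qed

end


section \<open>The norm of the mean curvature field is locally constant\<close>

text \<open>Gram-Schmidt for the coordinate fields in the induced metric. The invariant that
  \<open>a i\<close> has no components outside the indices treated so far gives the next field
  \<open>u\<close> the k-th component 1; hence it is non-zero, and injectivity of the differential
  makes its length positive.\<close>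

lemma gram_schmidt_fields:
  fixes \<Phi> :: "real ^ 'm \<Rightarrow> 'n::euclidean_space"
  assumes S: "open S" and \<Phi>: "smooth_on S \<Phi>"
    and inj: "\<And>x. x \<in> S \<Longrightarrow> inj (frechet_derivative \<Phi> (at x))"
  obtains a :: "'m \<Rightarrow> real ^ 'm \<Rightarrow> real ^ 'm" where "\<And>i. smooth_on S (a i)"
    "\<And>x i j. x \<in> S \<Longrightarrow> frechet_derivative \<Phi> (at x) (a i x) \<bullet> frechet_derivative \<Phi> (at x) (a j x) =
      (if i = j then 1 else 0)"
proof -
  let ?d = "\<lambda>x. frechet_derivative \<Phi> (at x)"
  have "\<exists>a :: 'm \<Rightarrow> real ^ 'm \<Rightarrow> real ^ 'm. (\<forall>i\<in>I. smooth_on S (a i) \<and> (\<forall>x\<in>S. \<forall>j. j \<notin> I \<longrightarrow> a i x $ j = 0)) \<and>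
      (\<forall>x\<in>S. \<forall>i\<in>I. \<forall>j\<in>I. ?d x (a i x) \<bullet> ?d x (a j x) = (if i = j then 1 else 0))" for I :: "'m set"
  proof (induction I rule: finite_induct[OF finite])
    case 1
    show ?case by simp
  next
    case (2 k I)
    then obtain a :: "'m \<Rightarrow> real ^ 'm \<Rightarrow> real ^ 'm" where smooth_a: "\<And>i. i \<in> I \<Longrightarrow> smooth_on S (a i)"
      and comp_a: "\<And>i x j. i \<in> I \<Longrightarrow> x \<in> S \<Longrightarrow> j \<notin> I \<Longrightarrow> a i x $ j = 0"
      and orth_a: "\<And>i j x. x \<in> S \<Longrightarrow> i \<in> I \<Longrightarrow> j \<in> I \<Longrightarrow>
        ?d x (a i x) \<bullet> ?d x (a j x) = (if i = j then 1 else 0)" by blast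
    define u where "u x = axis k 1 - (\<Sum>i\<in>I. (?d x (axis k 1) \<bullet> ?d x (a i x)) *\<^sub>R a i x)" for x
    define b where "b = a(k := (\<lambda>x. inverse (sqrt (?d x (u x) \<bullet> ?d x (u x))) *\<^sub>R u x))"
    have lin: "linear (?d x)" if "x \<in> S" for x using \<Phi> that by (rule smooth_on_linear)
    have smooth_u: "smooth_on S u" unfolding u_def
      by (intro smooth_on_diff smooth_on_sum smooth_on_scaleR smooth_on_inner smooth_on_directional_derivative
          smooth_on_derivative \<Phi> smooth_a smooth_on_const S)
    have "u x $ k = 1" if "x \<in> S" for x
      using comp_a[OF _ that \<open>k \<notin> I\<close>] by (simp add: u_def)
    then have "u x \<noteq> 0" if "x \<in> S" for x using that by force
    then have "?d x (u x) \<noteq> 0" if "x \<in> S" for x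
      using inj[OF that] linear_0[OF lin[OF that]] that by (metis injD)
    then have pos: "?d x (u x) \<bullet> ?d x (u x) > 0" if "x \<in> S" for x using that by simp
    have smooth_b: "smooth_on S (b i)" if "i \<in> insert k I" for i
    proof (cases "i = k")
      case True
      have "smooth_on S (\<lambda>x. inverse (sqrt (?d x (u x) \<bullet> ?d x (u x))) *\<^sub>R u x)"
        by (intro smooth_on_scaleR smooth_on_inverse smooth_on_sqrt smooth_on_inner
            smooth_on_directional_derivative \<Phi> smooth_u S) (use pos in force)+
      then show ?thesis using True by (simp add: b_def)
    qed (use that smooth_a in \<open>auto simp: b_def\<close>)
    have "b i x $ j = 0" if "i \<in> insert k I" "x \<in> S" "j \<notin> insert k I" for i x j
      using that comp_a by (auto simp: b_def u_def axis_def)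
    moreover have uorth: "?d x (u x) \<bullet> ?d x (a j x) = 0" if "x \<in> S" "j \<in> I" for x j
    proof -
      have "(\<Sum>i\<in>I. (?d x (axis k 1) \<bullet> ?d x (a i x)) * (?d x (a i x) \<bullet> ?d x (a j x))) =
          (\<Sum>i\<in>I. if i = j then ?d x (axis k 1) \<bullet> ?d x (a i x) else 0)"
        using orth_a[OF that(1) _ that(2)] by (intro sum.cong) auto
      then show ?thesis
        using that \<open>finite I\<close>
        by (simp add: u_def linear_diff[OF lin] linear_sum[OF lin] linear_cmul[OF lin] inner_diff_left
            inner_sum_left)
    qed
    have "?d x (b i x) \<bullet> ?d x (b j x) = (if i = j then 1 else 0)"
      if "x \<in> S" "i \<in> insert k I" "j \<in> insert k I" for x i j
    proof -
      define c where "c = inverse (sqrt (?d x (u x) \<bullet> ?d x (u x)))"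
      have c: "c * (c * (?d x (u x) \<bullet> ?d x (u x))) = 1"
        using pos[OF that(1)] by (simp add: c_def divide_simps)
      have d: "?d x (b l x) = (if l = k then c *\<^sub>R ?d x (u x) else ?d x (a l x))" for l
        by (simp add: b_def c_def linear_cmul[OF lin[OF that(1)]])
      have "?d x (a l x) \<bullet> ?d x (u x) = 0" if "l \<in> I" for l
        using uorth[OF \<open>x \<in> S\<close> that] by (simp add: inner_commute)
      then show ?thesis
        using that c orth_a[OF that(1), of i j] uorth[OF that(1)] \<open>k \<notin> I\<close> by (auto simp: d)
    qed
    ultimately show ?case using smooth_b by blast
  qed
  from this[of UNIV] obtain a :: "'m \<Rightarrow> real ^ 'm \<Rightarrow> real ^ 'm" where "\<forall>i. smooth_on S (a i)"
    "\<forall>x\<in>S. \<forall>i j. ?d x (a i x) \<bullet> ?d x (a j x) = (if i = j then 1 else 0)" by auto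
  then show ?thesis using that[of a] by simp
qed

lemma (in immersed_patch) subpatch:
  assumes "open B" "B \<subseteq> S"
  shows "immersed_patch B \<Phi> a"
  using assms smooth_\<Phi> smooth_a unit_\<Phi> orthonormal_a card_frame
  by unfold_locales (auto intro: smooth_on_subset)

lemma smooth_on_positive_neighbourhood:
  assumes "smooth_on S f" "open S" "x \<in> S" "f x > (0::real)"
  obtains r where "r > 0" "ball x r \<subseteq> S" "\<And>y. y \<in> ball x r \<Longrightarrow> f y > 0"
proof -
  have "open {y \<in> S. f y > 0}"
    using continuous_open_preimage[OF smooth_on_continuous_on[OF assms(1)] assms(2), of "{0<..}"]
    by (simp add: vimage_def Int_def)
  then obtain r where "r > 0" "ball x r \<subseteq> {y \<in> S. f y > 0}"
    using assms open_contains_ball by (metis (mono_tags, lifting) mem_Collect_eq)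
  then show ?thesis using that by blast
qed

lemma (in immersed_patch) normal_part_self_adjoint: "normal_part x u \<bullet> v = u \<bullet> normal_part x v"
  by (simp add: normal_part_def inner_diff_left inner_diff_right inner_sum_left inner_sum_right
      inner_commute[of v] mult.commute)

lemma (in immersed_patch) smooth_normal_trace:
  "smooth_on S (\<lambda>x. \<Sum>i\<in>UNIV. normal_part x (frechet_derivative (frame i) (at x) (a i x)))"
  by (intro smooth_on_sum smooth_normal_part smooth_on_directional_derivative smooth_frame smooth_a open_S)

text \<open>The problem in one chart, where \<open>H\<close> may still have zeros. In
  \<open>H_bitension\<close> pseudo-umbilicity has turned the sum of B(A_H e_i, e_i) into 4 |H|^2 H,
  and the curvature term 4 H stands on the right.\<close>

locale biharmonic_field = immersed_patch S \<Phi> a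
  for S :: "(real ^ 4) set" and \<Phi> :: "real ^ 4 \<Rightarrow> real ^ 7" and a :: "4 \<Rightarrow> real ^ 4 \<Rightarrow> real ^ 4" +
  fixes H :: "real ^ 4 \<Rightarrow> real ^ 7"
  assumes H_trace: "\<And>x. x \<in> S \<Longrightarrow>
      4 *\<^sub>R H x = (\<Sum>i\<in>UNIV. normal_part x (frechet_derivative (frame i) (at x) (a i x)))"
    and H_umbilical: "\<And>x v u. x \<in> S \<Longrightarrow>
      frechet_derivative H (at x) v \<bullet> d\<Phi> x u = - (H x \<bullet> H x) * (d\<Phi> x v \<bullet> d\<Phi> x u)"
    and H_bitension: "\<And>x. x \<in> S \<Longrightarrow>
    (\<Sum>i\<in>UNIV.
        normal_part x (frechet_derivative (\<lambda>y. normal_part y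
          (frechet_derivative H (at y) (a i y))) (at x) (a i x))
      - normal_part x (frechet_derivative H (at x)
          (\<Sum>j\<in>UNIV. (frechet_derivative (frame i) (at x) (a i x) \<bullet> frame j x) *\<^sub>R a j x)))
    = (4 * (H x \<bullet> H x - 1)) *\<^sub>R H x"
begin

lemma smooth_H: "smooth_on S H"
proof -
  have "smooth_on S (\<lambda>x. (1 / 4) *\<^sub>R (\<Sum>i\<in>UNIV. normal_part x (frechet_derivative (frame i) (at x) (a i x))))"
    by (intro smooth_on_scaleR smooth_on_const smooth_normal_trace open_S)
  then show ?thesis
    by (subst smooth_on_cong[OF open_S]) (auto simp: H_trace[symmetric])
qed

lemma H_normal:
  assumes "x \<in> S"
  shows "H x \<bullet> \<Phi> x = 0" "H x \<bullet> d\<Phi> x v = 0"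
proof -
  have "(4 *\<^sub>R H x) \<bullet> \<Phi> x = 0" "(4 *\<^sub>R H x) \<bullet> d\<Phi> x v = 0"
    unfolding H_trace[OF assms] by (simp_all add: inner_sum_left normal_part_normal[OF assms])
  then show "H x \<bullet> \<Phi> x = 0" "H x \<bullet> d\<Phi> x v = 0" by simp_all
qed

text \<open>At \<open>x0\<close> the position, H and the frame span at most six of seven dimensions,
  which leaves a vector \<open>\<xi>0\<close>. Projecting this fixed vector at each point to the
  normal space and off H gives a field that equals \<open>\<xi>0\<close> at
  \<open>x0\<close>.\<close>

lemma exists_normal_field:
  assumes x: "x0 \<in> S" and pos: "H x0 \<bullet> H x0 > 0"
  obtains \<xi> where "smooth_on {x \<in> S. H x \<bullet> H x > 0} \<xi>" "\<xi> x0 \<bullet> \<xi> x0 > 0"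
    "\<And>x. x \<in> S \<Longrightarrow> \<xi> x \<bullet> \<Phi> x = 0" "\<And>x v. x \<in> S \<Longrightarrow> \<xi> x \<bullet> d\<Phi> x v = 0"
    "\<And>x. x \<in> S \<Longrightarrow> H x \<bullet> H x > 0 \<Longrightarrow> \<xi> x \<bullet> H x = 0"
proof -
  let ?B = "insert (\<Phi> x0) (insert (H x0) (range (\<lambda>i. frame i x0)))"
  have "card ?B \<le> 6"
  proof -
    have "card (range (\<lambda>i. frame i x0)) \<le> 4" using card_image_le[of "UNIV :: 4 set" "\<lambda>i. frame i x0"] by simp
    then show ?thesis by (intro card_insert_le_m1) simp_all
  qed
  then have "dim ?B < DIM(real ^ 7)"
    using dim_le_card'[of ?B] by simp
  then obtain \<xi>0 where \<xi>0: "\<xi>0 \<noteq> 0" "\<And>y. y \<in> span ?B \<Longrightarrow> orthogonal \<xi>0 y"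
    using orthogonal_to_subspace_exists[of ?B] by auto
  have orth: "\<xi>0 \<bullet> \<Phi> x0 = 0" "\<xi>0 \<bullet> H x0 = 0" "\<xi>0 \<bullet> frame i x0 = 0" for i
    using \<xi>0(2) by (auto simp: orthogonal_def span_base)
  define \<xi> where "\<xi> x = normal_part x \<xi>0 - ((\<xi>0 \<bullet> H x) / (H x \<bullet> H x)) *\<^sub>R H x" for x
  have op: "open {x \<in> S. H x \<bullet> H x > 0}"
    using continuous_open_preimage[OF smooth_on_continuous_on[OF smooth_on_inner[OF smooth_H smooth_H open_S]] open_S, of "{0<..}"]
    by (simp add: vimage_def Int_def)
  show ?thesis
  proof
    have sH: "smooth_on {x \<in> S. H x \<bullet> H x > 0} H" by (rule smooth_on_subset[OF smooth_H]) auto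
    have "smooth_on {x \<in> S. H x \<bullet> H x > 0} (\<lambda>x. normal_part x \<xi>0)"
      by (rule smooth_on_subset[OF smooth_normal_part[OF smooth_on_const]]) auto
    then show "smooth_on {x \<in> S. H x \<bullet> H x > 0} \<xi>"
      unfolding \<xi>_def
      by (intro smooth_on_diff smooth_on_scaleR smooth_on_divide smooth_on_inner smooth_on_const sH op) auto
    have "\<xi> x0 = \<xi>0" by (simp add: \<xi>_def normal_part_def orth)
    then show "\<xi> x0 \<bullet> \<xi> x0 > 0" using \<xi>0(1) by simp
    fix x assume x: "x \<in> S"
    show "\<xi> x \<bullet> \<Phi> x = 0" "\<xi> x \<bullet> d\<Phi> x v = 0" for v
      by (simp_all add: \<xi>_def inner_diff_left normal_part_normal[OF x] H_normal[OF x])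
    have "normal_part x (H x) = H x"
      by (simp add: normal_part_def H_normal[OF x] frame_def)
    then show "\<xi> x \<bullet> H x = 0" if "H x \<bullet> H x > 0"
      using that by (simp add: \<xi>_def inner_diff_left normal_part_self_adjoint)
  qed
qed

text \<open>The square of the norm is used because it is smooth at zeros of H as well. Where its
  derivative is non-zero, H is non-zero too, so a neighbourhood carries the data of
  \<open>biharmonic_patch\<close>.\<close>

lemma derivative_norm_H_eq_0:
  assumes x: "x0 \<in> S"
  shows "frechet_derivative (\<lambda>x. H x \<bullet> H x) (at x0) v0 = 0"
proof (rule ccontr)
  let ?f = "\<lambda>x. H x \<bullet> H x"
  assume nc: "frechet_derivative ?f (at x0) v0 \<noteq> 0"
  have df: "frechet_derivative ?f (at x) v = 2 * (H x \<bullet> frechet_derivative H (at x) v)" if "x \<in> S" for x v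
    using frechet_derivative_inner_at[of H x H v] smooth_on_differentiable[OF smooth_H that]
    by (simp add: inner_commute)
  have smooth_f: "smooth_on S ?f" by (intro smooth_on_inner smooth_H open_S)
  have pos: "?f x0 > 0"
    using nc df[OF x] by (metis inner_gt_zero_iff inner_zero_left mult_zero_right)
  let ?P = "{x \<in> S. ?f x > 0}"
  obtain \<xi> where \<xi>: "smooth_on ?P \<xi>" "\<xi> x0 \<bullet> \<xi> x0 > 0"
    and \<xi>_\<Phi>: "\<And>x. x \<in> S \<Longrightarrow> \<xi> x \<bullet> \<Phi> x = 0" and \<xi>_d\<Phi>: "\<And>x v. x \<in> S \<Longrightarrow> \<xi> x \<bullet> d\<Phi> x v = 0"
    and \<xi>_H: "\<And>x. x \<in> S \<Longrightarrow> ?f x > 0 \<Longrightarrow> \<xi> x \<bullet> H x = 0"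
    using exists_normal_field[OF x pos] by blast
  obtain r1 where r1: "r1 > 0" "ball x0 r1 \<subseteq> S" "\<And>y. y \<in> ball x0 r1 \<Longrightarrow> ?f y > 0"
    using smooth_on_positive_neighbourhood[OF smooth_f open_S x pos] by blast
  have smooth_\<xi>: "smooth_on (ball x0 r1) \<xi>" using r1 by (intro smooth_on_subset[OF \<xi>(1)]) auto
  obtain r2 where r2: "r2 > 0" "ball x0 r2 \<subseteq> ball x0 r1" "\<And>y. y \<in> ball x0 r2 \<Longrightarrow> \<xi> y \<bullet> \<xi> y > 0"
    by (rule smooth_on_positive_neighbourhood[OF smooth_on_inner[OF smooth_\<xi> smooth_\<xi> open_ball] open_ball _ \<xi>(2)])
      (use r1 in auto)
  have smooth_df: "smooth_on S (\<lambda>y. (frechet_derivative ?f (at y) v0)\<^sup>2)"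
    by (intro smooth_on_power smooth_on_derivative smooth_f open_S)
  have "(frechet_derivative ?f (at x0) v0)\<^sup>2 > 0" using nc by simp
  from smooth_on_positive_neighbourhood[OF smooth_df open_S x this]
  obtain r3 where r3: "r3 > 0" "ball x0 r3 \<subseteq> S"
      "\<And>y. y \<in> ball x0 r3 \<Longrightarrow> (frechet_derivative ?f (at y) v0)\<^sup>2 > 0"
    by metis
  \<comment> \<open>A ball, hence connected as \<open>connected_imp_empty\<close> requires, on which
    H, \<xi> and the derivative of |H|^2 in direction \<open>v0\<close> have no zeros.\<close>
  define B where "B = ball x0 (min r2 r3)"
  have B: "open B" "connected B" "B \<noteq> {}" "B \<subseteq> S" using r1 r2 r3 by (auto simp: B_def)
  have fB: "?f y > 0" and \<xi>B: "\<xi> y \<bullet> \<xi> y > 0" and dfB: "frechet_derivative ?f (at y) v0 \<noteq> 0"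
    if "y \<in> B" for y
    using that r1 r2 r3 by (auto simp: B_def)
  have smooth_HB: "smooth_on B H" and smooth_\<xi>B: "smooth_on B \<xi>"
    using smooth_on_subset[OF smooth_H B(4)] smooth_on_subset[OF smooth_\<xi>, of B] r2(2)
    by (auto simp: B_def ball_subset_ball_iff subset_iff)
  define h where "h x = sqrt (?f x)" for x
  define \<eta> where "\<eta> x = inverse (h x) *\<^sub>R H x" for x
  define \<zeta> where "\<zeta> x = inverse (sqrt (\<xi> x \<bullet> \<xi> x)) *\<^sub>R \<xi> x" for x
  have h: "h y > 0" "h y * h y = ?f y" if "y \<in> B" for y using fB[OF that] by (auto simp: h_def)
  have h\<eta>: "h y *\<^sub>R \<eta> y = H y" if "y \<in> B" for y using h[OF that] by (simp add: \<eta>_def)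
  have smooth_h: "smooth_on B h"
    unfolding h_def by (intro smooth_on_sqrt smooth_on_inner smooth_HB B fB)
  have smooth_ih: "smooth_on B (\<lambda>x. inverse (h x))"
    by (intro smooth_on_inverse smooth_h B) (use h in force)
  have smooth_\<eta>: "smooth_on B \<eta>"
    unfolding \<eta>_def by (intro smooth_on_scaleR smooth_ih smooth_HB B)
  have smooth_\<zeta>: "smooth_on B \<zeta>"
    unfolding \<zeta>_def
    by (intro smooth_on_scaleR smooth_on_inverse smooth_on_sqrt smooth_on_inner smooth_\<xi>B B)
      (use \<xi>B in force)+
  interpret patch: immersed_patch B \<Phi> a by (rule subpatch[OF B(1,4)])
  have \<zeta>_\<Phi>: "\<zeta> y \<bullet> \<Phi> y = 0" and \<zeta>_d\<Phi>: "\<zeta> y \<bullet> d\<Phi> y v = 0" and \<zeta>_H: "\<zeta> y \<bullet> H y = 0" if "y \<in> B" for y v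
    using \<xi>_\<Phi> \<xi>_d\<Phi> \<xi>_H fB[OF that] that B(4) by (auto simp: \<zeta>_def)
  have "biharmonic_patch B \<Phi> a h \<eta> \<zeta>"
  proof (unfold_locales)
    fix x v u assume xB: "x \<in> B"
    then have xS: "x \<in> S" using B by auto
    show "\<Phi> x \<bullet> \<eta> x = 0" "d\<Phi> x v \<bullet> \<eta> x = 0"
      using H_normal[OF xS] by (simp_all add: \<eta>_def inner_commute[of _ "H x"])
    show "\<Phi> x \<bullet> \<zeta> x = 0" "d\<Phi> x v \<bullet> \<zeta> x = 0"
      using \<zeta>_\<Phi>[OF xB] \<zeta>_d\<Phi>[OF xB] by (simp_all add: inner_commute[of _ "\<zeta> x"])
    show "\<eta> x \<bullet> \<eta> x = 1" using h[OF xB] fB[OF xB] by (auto simp: \<eta>_def divide_simps)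
    show "\<zeta> x \<bullet> \<zeta> x = 1" using \<xi>B[OF xB] by (simp add: \<zeta>_def divide_simps)
    show "\<eta> x \<bullet> \<zeta> x = 0" using \<zeta>_H[OF xB] by (simp add: \<eta>_def inner_commute)
    show "h x > 0" using h[OF xB] by simp
    have "frechet_derivative ?f (at x) v0 = frechet_derivative (\<lambda>y. h y * h y) (at x) v0"
      using frechet_derivative_cong_open[OF B(1) xB, of "\<lambda>y. h y * h y" ?f] h(2) by simp
    also have "\<dots> = 2 * h x * frechet_derivative h (at x) v0"
      using smooth_on_differentiable[OF smooth_h xB] by (simp add: frechet_derivative_mult_at)
    finally show "\<exists>v. frechet_derivative h (at x) v \<noteq> 0" using dfB[OF xB] by auto
    have "frechet_derivative \<eta> (at x) v = inverse (h x) *\<^sub>R frechet_derivative H (at x) v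
        + frechet_derivative (\<lambda>y. inverse (h y)) (at x) v *\<^sub>R H x"
      unfolding \<eta>_def
      by (intro frechet_derivative_scaleR_at smooth_on_differentiable[OF smooth_ih xB]
          smooth_on_differentiable[OF smooth_HB xB])
    then show "frechet_derivative \<eta> (at x) v \<bullet> d\<Phi> x u = - h x * (d\<Phi> x v \<bullet> d\<Phi> x u)"
      using h[OF xB] by (simp add: inner_add_left H_umbilical[OF xS] H_normal[OF xS] h(2)[OF xB, symmetric] field_simps)
    have smooth_frameB: "smooth_on B (frame i)" for i using smooth_frame B(4) by (rule smooth_on_subset)
    \<comment> \<open>Orthogonality of \<zeta> to the frame moves the derivative to the frame field.
      Summed over \<open>i\<close> this gives - 4 times the inner product of \<zeta> and H, which is
      zero.\<close>
    have "frechet_derivative \<zeta> (at x) (a i x) \<bullet> frame i x =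
        - (\<zeta> x \<bullet> normal_part x (frechet_derivative (frame i) (at x) (a i x)))" for i
    proof -
      have "normal_part x (\<zeta> x) = \<zeta> x"
        using \<zeta>_\<Phi>[OF xB] \<zeta>_d\<Phi>[OF xB] by (simp add: normal_part_def frame_def)
      then have "\<zeta> x \<bullet> normal_part x (frechet_derivative (frame i) (at x) (a i x)) =
          \<zeta> x \<bullet> frechet_derivative (frame i) (at x) (a i x)"
        by (metis normal_part_self_adjoint)
      then show ?thesis
        using inner_const_derivative[OF smooth_\<zeta> smooth_frameB B(1) xB, of i 0 "a i x"] \<zeta>_d\<Phi>
        by (simp add: frame_def)
    qed
    then have "(\<Sum>i\<in>UNIV. frechet_derivative \<zeta> (at x) (a i x) \<bullet> frame i x) = - (\<zeta> x \<bullet> (4 *\<^sub>R H x))"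
      by (simp only: sum_negf H_trace[OF xS] inner_sum_right)
    then show "(\<Sum>i\<in>UNIV. frechet_derivative \<zeta> (at x) (a i x) \<bullet> patch.frame i x) = 0"
      using \<zeta>_H[OF xB] by simp
    have Hder: "frechet_derivative (\<lambda>z. h z *\<^sub>R \<eta> z) (at y) = frechet_derivative H (at y)" if "y \<in> B" for y
      by (rule frechet_derivative_cong_open[OF B(1) that h\<eta>])
    then have "frechet_derivative (\<lambda>y. normal_part y (frechet_derivative (\<lambda>z. h z *\<^sub>R \<eta> z) (at y) (a i y))) (at x) =
        frechet_derivative (\<lambda>y. normal_part y (frechet_derivative H (at y) (a i y))) (at x)" for i
      by (intro frechet_derivative_cong_open[OF B(1) xB]) simp
    then show "(\<Sum>i\<in>UNIV.
          patch.normal_part x (frechet_derivative (\<lambda>y. patch.normal_part y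
            (frechet_derivative (\<lambda>z. h z *\<^sub>R \<eta> z) (at y) (a i y))) (at x) (a i x))
        - patch.normal_part x (frechet_derivative (\<lambda>z. h z *\<^sub>R \<eta> z) (at x)
            (\<Sum>j\<in>UNIV. (frechet_derivative (patch.frame i) (at x) (a i x) \<bullet> patch.frame j x) *\<^sub>R a j x)))
      = (4 * ((h x)\<^sup>2 - 1) * h x) *\<^sub>R \<eta> x"
      using H_bitension[OF xS] h[OF xB]
      by (simp add: Hder[OF xB] power2_eq_square scaleR_scaleR[symmetric] h\<eta>[OF xB] del: scaleR_scaleR)
  qed (use smooth_h smooth_\<eta> smooth_\<zeta> in auto)
  from biharmonic_patch.connected_imp_empty[OF this B(2)] B(3) show False by blast
qed

end


section \<open>Charts\<close>

lemma orth_proj_eqI: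
  assumes "subspace S" "t \<in> S" "\<And>y. y \<in> S \<Longrightarrow> (v - t) \<bullet> y = 0"
  shows "orth_proj S v = t"
  unfolding orth_proj_def
proof (rule the_equality)
  show "t \<in> S \<and> v - t \<in> S\<^sup>\<bottom>"
    using assms by (simp add: orthogonal_comp_def orthogonal_def inner_commute)
  fix t' assume t': "t' \<in> S \<and> v - t' \<in> S\<^sup>\<bottom>"
  have "t - t' \<in> S" using assms t' by (simp add: subspace_diff)
  then have "(v - t) \<bullet> (t - t') = 0" "(v - t') \<bullet> (t - t') = 0"
    using t' assms(3) by (auto simp: orthogonal_comp_def orthogonal_def inner_commute)
  moreover have "(t - t') \<bullet> (t - t') = (v - t') \<bullet> (t - t') - (v - t) \<bullet> (t - t')"
    by (simp add: inner_diff_left[symmetric])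
  ultimately have "(t - t') \<bullet> (t - t') = 0" by simp
  then show "t' = t" by simp
qed

context smooth_manifold
begin

context
  fixes U \<psi> assumes chart: "(U, \<psi>) \<in> charts"
begin

lemma chart_subset: "U \<subseteq> topspace M"
  using chart_openin[OF chart] by (rule openin_subset)

lemma chart_inj: "inj_on \<psi> U"
  using homeomorphic_imp_injective_map[OF chart_homeomorphic[OF chart]]
  by (simp add: Int_absorb1[OF chart_subset])

lemma chart_inv: "q \<in> U \<Longrightarrow> inv_into U \<psi> (\<psi> q) = q"
  by (rule inv_into_f_f[OF chart_inj])

lemma open_chart_image:
  assumes "openin M W"
  shows "open (\<psi> ` (U \<inter> W))"
proof -
  have "openin (subtopology M U) (U \<inter> W)"
    using assms by (auto simp: openin_subtopology)
  then have "openin (top_of_set (\<psi> ` U)) (\<psi> ` (U \<inter> W))"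
    using homeomorphic_imp_open_map[OF chart_homeomorphic[OF chart]] unfolding open_map_def by blast
  then show ?thesis using chart_open_image[OF chart] by (simp add: openin_open_eq)
qed

lemma openin_chart_preimage:
  assumes "open T"
  shows "openin M {q \<in> U. \<psi> q \<in> T}"
proof -
  have "openin (subtopology M U) {q \<in> topspace (subtopology M U). \<psi> q \<in> \<psi> ` U \<inter> T}"
    by (rule openin_continuous_map_preimage[OF homeomorphic_imp_continuous_map[OF chart_homeomorphic[OF chart]]])
      (use assms in \<open>auto simp: openin_open\<close>)
  moreover have "{q \<in> topspace (subtopology M U). \<psi> q \<in> \<psi> ` U \<inter> T} = {q \<in> U. \<psi> q \<in> T}"
    using chart_subset by (auto simp: topspace_subtopology)
  ultimately show ?thesis using openin_trans_full[OF _ chart_openin[OF chart]] by metis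
qed

end

text \<open>Tangent vectors at \<open>q\<close> are coordinatised by the arbitrary choice
  \<open>chart_at q\<close>; this is the linear passage from those coordinates to the ones of
  \<psi>.\<close>

definition chart_change :: "('a \<Rightarrow> real ^ 'm) \<Rightarrow> 'a \<Rightarrow> real ^ 'm \<Rightarrow> real ^ 'm" where
  "chart_change \<psi> q = (case chart_at q of (V, \<psi>') \<Rightarrow> frechet_derivative (\<psi> \<circ> inv_into V \<psi>') (at (\<psi>' q)))"

lemma chart_at:
  assumes "q \<in> topspace M"
  obtains V \<psi>' where "chart_at q = (V, \<psi>')" "(V, \<psi>') \<in> charts" "q \<in> V"
proof -
  have "\<exists>c. c \<in> charts \<and> q \<in> fst c" using assms charts_cover by fastforce
  then have "chart_at q \<in> charts \<and> q \<in> fst (chart_at q)" unfolding chart_at_def by (rule someI_ex)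
  then show ?thesis using that by (metis prod.collapse)
qed

lemma transition_derivative:
  assumes c: "(U, \<psi>) \<in> charts" "(V, \<psi>') \<in> charts" and q: "q \<in> U" "q \<in> V"
    and F: "(F \<circ> inv_into U \<psi>) differentiable (at (\<psi> q))"
  shows "frechet_derivative (F \<circ> inv_into V \<psi>') (at (\<psi>' q)) =
    frechet_derivative (F \<circ> inv_into U \<psi>) (at (\<psi> q)) \<circ> frechet_derivative (\<psi> \<circ> inv_into V \<psi>') (at (\<psi>' q))"
proof -
  let ?D = "\<psi>' ` (V \<inter> U)"
  have op: "open ?D" by (rule open_chart_image[OF c(2) chart_openin[OF c(1)]])
  have mem: "\<psi>' q \<in> ?D" using q by auto
  have "(\<psi> \<circ> inv_into V \<psi>') differentiable (at (\<psi>' q))"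
    using chart_transition[OF c(2,1)] mem by (rule smooth_on_differentiable)
  moreover have "(F \<circ> inv_into U \<psi>) differentiable (at ((\<psi> \<circ> inv_into V \<psi>') (\<psi>' q)))"
    using F by (simp add: chart_inv[OF c(2) q(2)])
  ultimately have "frechet_derivative ((F \<circ> inv_into U \<psi>) \<circ> (\<psi> \<circ> inv_into V \<psi>')) (at (\<psi>' q)) =
      frechet_derivative (F \<circ> inv_into U \<psi>) (at (\<psi> q)) \<circ> frechet_derivative (\<psi> \<circ> inv_into V \<psi>') (at (\<psi>' q))"
    using frechet_derivative_compose[of "\<psi> \<circ> inv_into V \<psi>'" "\<psi>' q" "F \<circ> inv_into U \<psi>"]
    by (simp add: chart_inv[OF c(2) q(2)])
  moreover have "frechet_derivative ((F \<circ> inv_into U \<psi>) \<circ> (\<psi> \<circ> inv_into V \<psi>')) (at (\<psi>' q)) =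
      frechet_derivative (F \<circ> inv_into V \<psi>') (at (\<psi>' q))"
    by (rule frechet_derivative_cong_open[OF op mem]) (auto simp: chart_inv[OF c(1)] chart_inv[OF c(2)])
  ultimately show ?thesis by simp
qed

lemma differential_eq:
  assumes c: "(U, \<psi>) \<in> charts" and q: "q \<in> U"
    and F: "(F \<circ> inv_into U \<psi>) differentiable (at (\<psi> q))"
  shows "differential F q = frechet_derivative (F \<circ> inv_into U \<psi>) (at (\<psi> q)) \<circ> chart_change \<psi> q"
proof -
  have "q \<in> topspace M" using q chart_subset[OF c] by auto
  then obtain V \<psi>' where V: "chart_at q = (V, \<psi>')" "(V, \<psi>') \<in> charts" "q \<in> V" by (rule chart_at)
  show ?thesis
    using transition_derivative[OF c V(2) q V(3) F] by (simp add: differential_def chart_change_def V(1))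
qed

text \<open>The derivative of the opposite transition map is a right inverse.\<close>

lemma surj_chart_change:
  assumes c: "(U, \<psi>) \<in> charts" and q: "q \<in> U"
  shows "surj (chart_change \<psi> q)"
proof -
  have "q \<in> topspace M" using q chart_subset[OF c] by auto
  then obtain V \<psi>' where V: "chart_at q = (V, \<psi>')" "(V, \<psi>') \<in> charts" "q \<in> V" by (rule chart_at)
  let ?D = "\<psi> ` (U \<inter> V)"
  have op: "open ?D" by (rule open_chart_image[OF c chart_openin[OF V(2)]])
  have mem: "\<psi> q \<in> ?D" using q V by auto
  have opV: "open (\<psi>' ` (V \<inter> U))" by (rule open_chart_image[OF V(2) chart_openin[OF c]])
  have "(\<psi> \<circ> inv_into V \<psi>') differentiable (at (\<psi>' q))"
    by (rule smooth_on_differentiable[OF chart_transition[OF V(2) c]]) (use q V in auto)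
  from transition_derivative[OF V(2) c V(3) q this]
  have "frechet_derivative (\<psi> \<circ> inv_into V \<psi>') (at (\<psi>' q)) \<circ> frechet_derivative (\<psi>' \<circ> inv_into U \<psi>) (at (\<psi> q)) =
      frechet_derivative (\<psi> \<circ> inv_into U \<psi>) (at (\<psi> q))" by simp
  also have "\<dots> = frechet_derivative (\<lambda>x. x) (at (\<psi> q))"
    by (rule frechet_derivative_cong_open[OF op mem]) (auto simp: chart_inv[OF c])
  finally have "frechet_derivative (\<psi> \<circ> inv_into V \<psi>') (at (\<psi>' q)) (frechet_derivative (\<psi>' \<circ> inv_into U \<psi>) (at (\<psi> q)) v) = v" for v
    by (metis comp_apply frechet_derivative_ident)
  then show ?thesis unfolding chart_change_def V(1) prod.case by (rule surjI)
qed

lemma smooth_map_on_chart: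
  assumes c: "(U, \<psi>) \<in> charts" and F: "smooth_on (\<psi> ` U) F"
  shows "smooth_map_on U (\<lambda>q. F (\<psi> q))"
  unfolding smooth_map_on_def
proof (clarify)
  fix V \<psi>' assume V: "(V, \<psi>') \<in> charts"
  have "smooth_on (\<psi>' ` (V \<inter> U)) (\<lambda>y. F ((\<psi> \<circ> inv_into V \<psi>') y))"
    by (rule smooth_on_compose[OF F chart_transition[OF V c] open_chart_image[OF V chart_openin[OF c]]
          chart_open_image[OF c]]) (auto simp: chart_inv[OF V])
  then show "smooth_on (\<psi>' ` (V \<inter> U)) ((\<lambda>q. F (\<psi> q)) \<circ> inv_into V \<psi>')" by (simp add: o_def)
qed

end

context sphere_submanifold
begin

context
  fixes U \<psi> assumes chart: "(U, \<psi>) \<in> charts"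
begin

lemma smooth_parametrisation: "smooth_on (\<psi> ` U) (\<phi> \<circ> inv_into U \<psi>)"
  using immersion_smooth chart chart_subset[OF chart]
  by (auto simp: smooth_map_on_def Int_absorb2)

lemma differentiable_parametrisation:
  "q \<in> U \<Longrightarrow> (\<phi> \<circ> inv_into U \<psi>) differentiable (at (\<psi> q))"
  by (rule smooth_on_differentiable[OF smooth_parametrisation]) auto

lemma inj_parametrisation:
  assumes "q \<in> U"
  shows "inj (frechet_derivative (\<phi> \<circ> inv_into U \<psi>) (at (\<psi> q)))"
proof (rule injI)
  let ?d = "frechet_derivative (\<phi> \<circ> inv_into U \<psi>) (at (\<psi> q))"
  note eq = differential_eq[OF chart assms differentiable_parametrisation[OF assms]]
  fix v v' assume "?d v = ?d v'"
  moreover obtain u u' where "v = chart_change \<psi> q u" "v' = chart_change \<psi> q u'"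
    using surj_chart_change[OF chart assms] by (metis surjD)
  ultimately show "v = v'"
    using injD[OF immersion_inj[of q], of u u'] assms chart_subset[OF chart] by (auto simp: eq)
qed

lemma tangent_space_eq:
  assumes "q \<in> U"
  shows "tangent_space q = range (frechet_derivative (\<phi> \<circ> inv_into U \<psi>) (at (\<psi> q)))"
  unfolding tangent_space_def differential_eq[OF chart assms differentiable_parametrisation[OF assms]]
  using surj_chart_change[OF chart assms] by (metis fun.set_map image_comp)

text \<open>The coordinate change enters both the differential of \<phi>, which is inverted, and
  that of \<open>F\<close>; so it cancels.\<close>

lemma dir_deriv_eq:
  assumes q: "q \<in> U" and F: "(F \<circ> inv_into U \<psi>) differentiable (at (\<psi> q))"
  shows "dir_deriv (frechet_derivative (\<phi> \<circ> inv_into U \<psi>) (at (\<psi> q)) v) F q =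
    frechet_derivative (F \<circ> inv_into U \<psi>) (at (\<psi> q)) v"
proof -
  obtain u where u: "v = chart_change \<psi> q u"
    using surj_chart_change[OF chart q] by (metis surjD)
  have "differential \<phi> q u = frechet_derivative (\<phi> \<circ> inv_into U \<psi>) (at (\<psi> q)) v"
    by (simp add: differential_eq[OF chart q differentiable_parametrisation[OF q]] u)
  then have "inv (differential \<phi> q) (frechet_derivative (\<phi> \<circ> inv_into U \<psi>) (at (\<psi> q)) v) = u"
    using immersion_inj[of q] q chart_subset[OF chart] inv_f_f by (metis subsetD)
  then show ?thesis
    by (simp add: dir_deriv_def differential_eq[OF chart q F] u)
qed

end

end

section \<open>The operators of submanifold geometry in a chart\<close>

locale sphere_chart = sphere_submanifold M charts \<phi> + immersed_patch "\<psi> ` U" "\<phi> \<circ> inv_into U \<psi>" a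
  for M :: "'a topology" and charts :: "('a set \<times> ('a \<Rightarrow> real ^ 'm)) set"
    and \<phi> :: "'a \<Rightarrow> 'n::euclidean_space" and U \<psi> and a :: "'m \<Rightarrow> real ^ 'm \<Rightarrow> real ^ 'm" +
  assumes chart: "(U, \<psi>) \<in> charts"
begin

abbreviation local_rep :: "('a \<Rightarrow> 'b) \<Rightarrow> real ^ 'm \<Rightarrow> 'b" where "local_rep F \<equiv> F \<circ> inv_into U \<psi>"

lemma \<Phi>_chart: "q \<in> U \<Longrightarrow> (\<phi> \<circ> inv_into U \<psi>) (\<psi> q) = \<phi> q"
  by (simp add: chart_inv[OF chart])

lemma tangent_normal_form:
  assumes q: "q \<in> U"
  shows "orth_proj ({\<phi> q}\<^sup>\<bottom>) u = u - (u \<bullet> \<phi> q) *\<^sub>R \<phi> q"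
    and "orth_proj (tangent_space q) (orth_proj ({\<phi> q}\<^sup>\<bottom>) u) =
      (\<Sum>i\<in>UNIV. (u \<bullet> frame i (\<psi> q)) *\<^sub>R frame i (\<psi> q))"
    and "orth_proj (normal_space q) (orth_proj ({\<phi> q}\<^sup>\<bottom>) u) = normal_part (\<psi> q) u"
proof -
  let ?s = "orth_proj ({\<phi> q}\<^sup>\<bottom>) u" and ?sph = "u - (u \<bullet> \<phi> q) *\<^sub>R \<phi> q"
  let ?tan = "\<Sum>i\<in>UNIV. (u \<bullet> frame i (\<psi> q)) *\<^sub>R frame i (\<psi> q)"
  let ?x = "\<psi> q"
  have x: "?x \<in> \<psi> ` U" using q by simp
  have \<phi>: "\<phi> q \<bullet> \<phi> q = 1" using unit_\<Phi>[OF x] \<Phi>_chart[OF q] by simp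
  have T: "tangent_space q = range (d\<Phi> ?x)" by (rule tangent_space_eq[OF chart q])
  have np: "normal_part ?x u = ?sph - ?tan" by (simp only: normal_part_def \<Phi>_chart[OF q])
  show sph: "?s = ?sph"
    by (rule orth_proj_eqI[OF subspace_orthogonal_comp])
      (auto simp: orthogonal_comp_def orthogonal_def inner_diff_right \<phi> inner_commute)
  have subT: "subspace (tangent_space q)"
    unfolding T by (rule linear_subspace_image[OF linear_d\<Phi>[OF x] subspace_UNIV])
  have "?tan \<in> tangent_space q"
    by (intro subspace_sum subspace_scale subT) (auto simp: T frame_def)
  moreover have "(?s - ?tan) \<bullet> y = 0" if "y \<in> tangent_space q" for y
    using that normal_part_normal(1)[OF x, of u] unfolding sph np[symmetric] T by auto
  ultimately show "orth_proj (tangent_space q) ?s = ?tan"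
    by (rule orth_proj_eqI[OF subT])
  have N: "normal_space q = {\<phi> q}\<^sup>\<bottom> \<inter> (tangent_space q)\<^sup>\<bottom>" by (auto simp: normal_space_def)
  have subN: "subspace (normal_space q)"
    unfolding N by (intro subspace_inter subspace_orthogonal_comp)
  have "normal_part ?x u \<in> normal_space q"
    unfolding N T using normal_part_normal[OF x, of u] \<Phi>_chart[OF q]
    by (auto simp: orthogonal_comp_def orthogonal_def inner_commute)
  moreover have "(?s - normal_part ?x u) \<bullet> y = 0" if "y \<in> normal_space q" for y
  proof -
    have "frame i ?x \<bullet> y = 0" for i
      using that by (auto simp: N T orthogonal_comp_def orthogonal_def frame_def)
    then show ?thesis unfolding sph np by (simp add: inner_sum_left)
  qed
  ultimately show "orth_proj (normal_space q) ?s = normal_part ?x u"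
    by (rule orth_proj_eqI[OF subN])
qed

context
  fixes F :: "'a \<Rightarrow> 'n" and q
  assumes q: "q \<in> U" and F: "local_rep F differentiable (at (\<psi> q))"
begin

lemma normal_conn_eq:
  "normal_conn (d\<Phi> (\<psi> q) v) F q = normal_part (\<psi> q) (frechet_derivative (local_rep F) (at (\<psi> q)) v)"
  unfolding normal_conn_def sphere_conn_def dir_deriv_eq[OF chart q F] by (rule tangent_normal_form(3)[OF q])

lemma second_fundamental_form_eq:
  "second_fundamental_form (d\<Phi> (\<psi> q) v) F q =
    normal_part (\<psi> q) (frechet_derivative (local_rep F) (at (\<psi> q)) v)"
  unfolding second_fundamental_form_def sphere_conn_def dir_deriv_eq[OF chart q F]
  by (rule tangent_normal_form(3)[OF q])

lemma tangent_conn_eq: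
  "tangent_conn (d\<Phi> (\<psi> q) v) F q =
    (\<Sum>i\<in>UNIV. (frechet_derivative (local_rep F) (at (\<psi> q)) v \<bullet> frame i (\<psi> q)) *\<^sub>R frame i (\<psi> q))"
  unfolding tangent_conn_def sphere_conn_def dir_deriv_eq[OF chart q F]
  by (rule tangent_normal_form(2)[OF q])

lemma shape_operator_eq:
  "shape_operator F (d\<Phi> (\<psi> q) v) q =
    - (\<Sum>i\<in>UNIV. (frechet_derivative (local_rep F) (at (\<psi> q)) v \<bullet> frame i (\<psi> q)) *\<^sub>R frame i (\<psi> q))"
  unfolding shape_operator_def sphere_conn_def dir_deriv_eq[OF chart q F]
  by (subst tangent_normal_form(2)[OF q]) (rule refl)

end

definition frame_field :: "'m \<Rightarrow> 'a \<Rightarrow> 'n" where "frame_field i q = frame i (\<psi> q)"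

lemma local_rep_frame_field: "y \<in> \<psi> ` U \<Longrightarrow> local_rep (frame_field i) y = frame i y"
  by (auto simp: frame_field_def chart_inv[OF chart])

lemma local_rep_cong:
  assumes "\<And>y. y \<in> \<psi> ` U \<Longrightarrow> local_rep F y = G y" "smooth_on (\<psi> ` U) G" "q \<in> U"
  shows "local_rep F differentiable (at (\<psi> q))"
    "frechet_derivative (local_rep F) (at (\<psi> q)) = frechet_derivative G (at (\<psi> q))"
proof -
  have "smooth_on (\<psi> ` U) (local_rep F)"
    using smooth_on_cong[OF open_S, of "local_rep F" G] assms by auto
  then show "local_rep F differentiable (at (\<psi> q))"
    using assms(3) by (intro smooth_on_differentiable) auto
  show "frechet_derivative (local_rep F) (at (\<psi> q)) = frechet_derivative G (at (\<psi> q))"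
    by (rule frechet_derivative_cong_open[OF open_S _ assms(1)]) (use assms(3) in auto)
qed

lemmas frame_field_derivative = local_rep_cong[OF local_rep_frame_field smooth_frame]

lemma orthonormal_frame_field: "orthonormal_frame_on U frame_field"
  unfolding orthonormal_frame_on_def
proof (intro conjI allI ballI)
  show "openin M U" by (rule chart_openin[OF chart])
  show "smooth_map_on U (frame_field i)" for i
    unfolding frame_field_def by (rule smooth_map_on_chart[OF chart smooth_frame])
  show "frame_field i p \<in> tangent_space p" if "p \<in> U" for p i
    using that by (simp add: frame_field_def frame_def tangent_space_eq[OF chart])
  show "frame_field i p \<bullet> frame_field j p = (if i = j then 1 else 0)" if "p \<in> U" for p i j
    using that by (simp add: frame_field_def frame_orthonormal)
qed

text \<open>Invariance of the trace of the bilinear form that pairs \<open>d\<Phi> x u\<close> with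
  \<open>L v\<close>: the matrix \<open>?c\<close> between the two orthonormal bases is orthogonal,
  which is \<open>cc\<close>.\<close>

lemma trace_orthonormal_invariant:
  fixes b :: "'m \<Rightarrow> real ^ 'm"
  assumes x: "x \<in> \<psi> ` U" and b: "\<And>i j. d\<Phi> x (b i) \<bullet> d\<Phi> x (b j) = (if i = j then 1 else 0)"
    and L: "linear L"
  shows "(\<Sum>i\<in>UNIV. d\<Phi> x (b i) \<bullet> L (b i)) = (\<Sum>i\<in>UNIV. d\<Phi> x (a i x) \<bullet> L (a i x))"
proof -
  let ?c = "\<lambda>i j. d\<Phi> x (a j x) \<bullet> d\<Phi> x (b i)"
  have a: "a j x = (\<Sum>i\<in>UNIV. ?c i j *\<^sub>R b i)" for j
    by (rule frame_coordinates[where L = "d\<Phi> x" and a = b, OF linear_d\<Phi>[OF x] b card_frame])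
  have cc: "(\<Sum>j\<in>UNIV. ?c i j * ?c k j) = (if i = k then 1 else 0)" for i k
  proof -
    have "?c i j = d\<Phi> x (b i) \<bullet> frame j x" for i j by (simp add: frame_def inner_commute)
    then have "(\<Sum>j\<in>UNIV. ?c i j * ?c k j) = d\<Phi> x (b k) \<bullet> (\<Sum>j\<in>UNIV. (d\<Phi> x (b i) \<bullet> frame j x) *\<^sub>R frame j x)"
      by (simp add: inner_sum_right)
    also have "\<dots> = (if i = k then 1 else 0)"
      unfolding d\<Phi>_expansion[OF x, symmetric] using b[of k i] by auto
    finally show ?thesis .
  qed
  have "(\<Sum>j\<in>UNIV. d\<Phi> x (a j x) \<bullet> L (a j x)) =
      (\<Sum>j\<in>UNIV. \<Sum>i\<in>UNIV. \<Sum>k\<in>UNIV. (?c i j * ?c k j) * (d\<Phi> x (b i) \<bullet> L (b k)))"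
  proof (rule sum.cong)
    fix j
    have "d\<Phi> x (a j x) = (\<Sum>i\<in>UNIV. ?c i j *\<^sub>R d\<Phi> x (b i))"
      using arg_cong[OF a[of j], of "d\<Phi> x"] by (simp only: linear_sum[OF linear_d\<Phi>[OF x]] linear_cmul[OF linear_d\<Phi>[OF x]])
    moreover have "L (a j x) = (\<Sum>i\<in>UNIV. ?c i j *\<^sub>R L (b i))"
      using arg_cong[OF a[of j], of L] by (simp only: linear_sum[OF L] linear_cmul[OF L])
    ultimately have "d\<Phi> x (a j x) \<bullet> L (a j x) =
        (\<Sum>i\<in>UNIV. ?c i j *\<^sub>R d\<Phi> x (b i)) \<bullet> (\<Sum>i\<in>UNIV. ?c i j *\<^sub>R L (b i))" by (rule arg_cong2)
    also have "\<dots> = (\<Sum>i\<in>UNIV. \<Sum>k\<in>UNIV. (?c i j * ?c k j) * (d\<Phi> x (b i) \<bullet> L (b k)))"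
      unfolding inner_sum_left inner_sum_right by (subst sum.swap) (simp add: ac_simps)
    finally show "d\<Phi> x (a j x) \<bullet> L (a j x) = (\<Sum>i\<in>UNIV. \<Sum>k\<in>UNIV. (?c i j * ?c k j) * (d\<Phi> x (b i) \<bullet> L (b k)))" .
  qed simp
  also have "\<dots> = (\<Sum>i\<in>UNIV. \<Sum>k\<in>UNIV. \<Sum>j\<in>UNIV. (?c i j * ?c k j) * (d\<Phi> x (b i) \<bullet> L (b k)))"
    by (subst sum.swap) (rule sum.cong[OF refl], rule sum.swap)
  also have "\<dots> = (\<Sum>i\<in>UNIV. \<Sum>k\<in>UNIV. if i = k then d\<Phi> x (b i) \<bullet> L (b k) else 0)"
    unfolding sum_distrib_right[symmetric] cc by (intro sum.cong) auto
  finally show ?thesis by simp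
qed

text \<open>Frame independence of the trace of B. A constant vector \<open>\<xi>0\<close> extends to
  the normal field \<open>\<xi>\<close>, and orthogonality of \<open>e i\<close> to
  \<open>\<xi>\<close> moves the derivative from the frame to \<open>\<xi>\<close>. What remains
  depends on the frame only through its values at \<open>q\<close>, and is a trace as in
  \<open>trace_orthonormal_invariant\<close>.\<close>

lemma normal_trace_frame:
  assumes e: "orthonormal_frame_on W e" "q \<in> W" and q: "q \<in> U"
  shows "(\<Sum>i\<in>UNIV. second_fundamental_form (e i q) (e i) q) =
    (\<Sum>i\<in>UNIV. normal_part (\<psi> q) (frechet_derivative (frame i) (at (\<psi> q)) (a i (\<psi> q))))"
proof -
  let ?x = "\<psi> q" and ?W = "\<psi> ` (U \<inter> W)"
  have W: "open ?W" "?x \<in> ?W" "?W \<subseteq> \<psi> ` U"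
    using e q open_chart_image[OF chart, of W] by (auto simp: orthonormal_frame_on_def)
  then have x: "?x \<in> \<psi> ` U" by auto
  have smooth_e: "smooth_on ?W (local_rep (e i))" for i
    using e(1) chart by (auto simp: orthonormal_frame_on_def smooth_map_on_def)
  have e_tangent: "e i p \<in> tangent_space p" if "p \<in> W" for i p
    using e(1) that by (simp add: orthonormal_frame_on_def)
  have "\<exists>v. e i q = d\<Phi> ?x v" for i
    using e_tangent[OF e(2), of i] unfolding tangent_space_eq[OF chart q] by auto
  then obtain b where b: "\<And>i. e i q = d\<Phi> ?x (b i)" by metis
  have b_orth: "d\<Phi> ?x (b i) \<bullet> d\<Phi> ?x (b j) = (if i = j then 1 else 0)" for i j
    using e by (simp add: orthonormal_frame_on_def b[symmetric])
  have 1: "second_fundamental_form (e i q) (e i) q = normal_part ?x (frechet_derivative (local_rep (e i)) (at ?x) (b i))" for i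
    unfolding b[of i] by (rule second_fundamental_form_eq[OF q smooth_on_differentiable[OF smooth_e W(2)]])
  have "\<forall>\<xi>0. (\<Sum>i\<in>UNIV. second_fundamental_form (e i q) (e i) q) \<bullet> \<xi>0 =
    (\<Sum>i\<in>UNIV. normal_part ?x (frechet_derivative (frame i) (at ?x) (a i ?x))) \<bullet> \<xi>0"
  proof
    fix \<xi>0
    define \<xi> where "\<xi> y = normal_part y \<xi>0" for y
    have smooth_\<xi>: "smooth_on (\<psi> ` U) \<xi>" unfolding \<xi>_def by (intro smooth_normal_part smooth_on_const)
    have \<xi>_normal: "d\<Phi> y v \<bullet> \<xi> y = 0" if "y \<in> \<psi> ` U" for y v
      using normal_part_normal(1)[OF that] by (simp add: \<xi>_def inner_commute)
    let ?L = "frechet_derivative \<xi> (at ?x)"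
    have "local_rep (e i) y \<bullet> \<xi> y = 0" if y: "y \<in> ?W" for i y
    proof -
      obtain p where p: "p \<in> U" "p \<in> W" "y = \<psi> p" using y by blast
      then show ?thesis
        using e_tangent[of p i] \<xi>_normal[of y] by (auto simp: tangent_space_eq[OF chart] chart_inv[OF chart])
    qed
    note orth = inner_const_derivative[OF smooth_e smooth_on_subset[OF smooth_\<xi> W(3)] W(1,2) this]
    have 2: "frechet_derivative (local_rep (e i)) (at ?x) (b i) \<bullet> \<xi> ?x = - (d\<Phi> ?x (b i) \<bullet> ?L (b i))" for i
    proof -
      have "local_rep (e i) ?x = d\<Phi> ?x (b i)" by (simp add: chart_inv[OF chart q] b)
      then show ?thesis by (simp only: orth)
    qed
    have "(\<Sum>i\<in>UNIV. second_fundamental_form (e i q) (e i) q) \<bullet> \<xi>0 = - (\<Sum>i\<in>UNIV. d\<Phi> ?x (b i) \<bullet> ?L (b i))"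
      unfolding 1 inner_sum_left normal_part_self_adjoint \<xi>_def[symmetric] 2 by (simp add: sum_negf)
    also have "\<dots> = - (\<Sum>i\<in>UNIV. d\<Phi> ?x (a i ?x) \<bullet> ?L (a i ?x))"
      using trace_orthonormal_invariant[OF x b_orth smooth_on_linear[OF smooth_\<xi> x]] by simp
    also have "\<dots> = (\<Sum>i\<in>UNIV. normal_part ?x (frechet_derivative (frame i) (at ?x) (a i ?x))) \<bullet> \<xi>0"
    proof -
      have "frame i y \<bullet> \<xi> y = 0" if "y \<in> \<psi> ` U" for i y using \<xi>_normal[OF that] by (simp add: frame_def)
      note orth = inner_const_derivative[OF smooth_frame smooth_\<xi> open_S x this]
      have "frame i ?x = d\<Phi> ?x (a i ?x)" for i by (rule frame_def)
      then have "frechet_derivative (frame i) (at ?x) (a i ?x) \<bullet> \<xi> ?x = - (d\<Phi> ?x (a i ?x) \<bullet> ?L (a i ?x))" for i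
        by (simp only: orth)
      then show ?thesis
        unfolding inner_sum_left normal_part_self_adjoint \<xi>_def[symmetric] by (simp add: sum_negf)
    qed
    finally show "(\<Sum>i\<in>UNIV. second_fundamental_form (e i q) (e i) q) \<bullet> \<xi>0 =
      (\<Sum>i\<in>UNIV. normal_part ?x (frechet_derivative (frame i) (at ?x) (a i ?x))) \<bullet> \<xi>0" .
  qed
  then show ?thesis by (rule vector_eq_rdot[THEN iffD1])
qed

text \<open>Resolves the definite description: \<open>frame_field\<close> supplies existence,
  \<open>normal_trace_frame\<close> uniqueness.\<close>

lemma mean_curvature_eq:
  assumes q: "q \<in> U"
  shows "real CARD('m) *\<^sub>R mean_curvature q =
    (\<Sum>i\<in>UNIV. normal_part (\<psi> q) (frechet_derivative (frame i) (at (\<psi> q)) (a i (\<psi> q))))" (is "_ = ?t")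
proof -
  have "mean_curvature q = (1 / real CARD('m)) *\<^sub>R ?t"
    unfolding mean_curvature_def
  proof (rule the_equality)
    show "\<exists>W e. orthonormal_frame_on W e \<and> q \<in> W \<and> (1 / real CARD('m)) *\<^sub>R ?t =
        (1 / real CARD('m)) *\<^sub>R (\<Sum>i\<in>UNIV. second_fundamental_form (e i q) (e i) q)"
      using orthonormal_frame_field q normal_trace_frame[OF orthonormal_frame_field q q] by metis
  qed (use normal_trace_frame q in auto)
  then show ?thesis by simp
qed

lemma local_rep_mean_curvature:
  "y \<in> \<psi> ` U \<Longrightarrow> real CARD('m) *\<^sub>R local_rep mean_curvature y =
    (\<Sum>i\<in>UNIV. normal_part y (frechet_derivative (frame i) (at y) (a i y)))"
  using mean_curvature_eq by (auto simp: chart_inv[OF chart])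

lemma smooth_mean_curvature: "smooth_on (\<psi> ` U) (local_rep mean_curvature)"
proof -
  have "smooth_on (\<psi> ` U) (\<lambda>y. (1 / real CARD('m)) *\<^sub>R (\<Sum>i\<in>UNIV. normal_part y (frechet_derivative (frame i) (at y) (a i y))))"
    by (intro smooth_on_scaleR smooth_on_const smooth_normal_trace open_S)
  then show ?thesis
    by (subst smooth_on_cong[OF open_S]) (auto simp: local_rep_mean_curvature[symmetric] simp del: comp_apply)
qed

lemma differentiable_mean_curvature: "q \<in> U \<Longrightarrow> local_rep mean_curvature differentiable (at (\<psi> q))"
  by (rule smooth_on_differentiable[OF smooth_mean_curvature]) simp

lemma shape_operator_mean_curvature:
  assumes pseudo_umbilical and q: "q \<in> U"
  shows "shape_operator mean_curvature (d\<Phi> (\<psi> q) v) q = (norm (mean_curvature q))\<^sup>2 *\<^sub>R d\<Phi> (\<psi> q) v"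
  using assms chart_subset[OF chart] unfolding pseudo_umbilical_def by (auto simp: tangent_space_eq[OF chart q])

lemma umbilical_eq:
  assumes pseudo_umbilical and x: "x \<in> \<psi> ` U"
  shows "frechet_derivative (local_rep mean_curvature) (at x) v \<bullet> d\<Phi> x u =
    - (local_rep mean_curvature x \<bullet> local_rep mean_curvature x) * (d\<Phi> x v \<bullet> d\<Phi> x u)"
proof -
  obtain q where q: "q \<in> U" "x = \<psi> q" using x by auto
  let ?D = "frechet_derivative (local_rep mean_curvature) (at x) v"
  have H: "local_rep mean_curvature x = mean_curvature q" using q by (simp add: chart_inv[OF chart])
  have "?D \<bullet> d\<Phi> x u = (\<Sum>i\<in>UNIV. (?D \<bullet> frame i x) *\<^sub>R frame i x) \<bullet> d\<Phi> x u"
    by (subst d\<Phi>_expansion[OF x, of u]) (simp add: inner_sum_left inner_sum_right inner_commute mult.commute)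
  also have "(\<Sum>i\<in>UNIV. (?D \<bullet> frame i x) *\<^sub>R frame i x) = - ((norm (mean_curvature q))\<^sup>2 *\<^sub>R d\<Phi> x v)"
    using shape_operator_eq[OF q(1) differentiable_mean_curvature[OF q(1)], of v]
      shape_operator_mean_curvature[OF assms(1) q(1), of v]
    by (simp add: q(2) minus_equation_iff)
  finally show ?thesis unfolding H by (simp add: power2_norm_eq_inner del: comp_apply)
qed

text \<open>The normal biharmonic equation in the frame \<open>frame_field\<close>. Since A_H e_i =
  |H|^2 e_i, the sum of B(A_H e_i, e_i) is |H|^2 times the trace of B, that is m |H|^2 H.\<close>

lemma bitension_eq:
  assumes pseudo_umbilical biharmonic and x: "x \<in> \<psi> ` U"
  shows "(\<Sum>i\<in>UNIV.
        normal_part x (frechet_derivative (\<lambda>y. normal_part y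
          (frechet_derivative (local_rep mean_curvature) (at y) (a i y))) (at x) (a i x))
      - normal_part x (frechet_derivative (local_rep mean_curvature) (at x)
          (\<Sum>j\<in>UNIV. (frechet_derivative (frame i) (at x) (a i x) \<bullet> frame j x) *\<^sub>R a j x)))
    = (real CARD('m) * (local_rep mean_curvature x \<bullet> local_rep mean_curvature x - 1)) *\<^sub>R local_rep mean_curvature x"
proof -
  obtain q where q: "q \<in> U" "x = \<psi> q" using x by auto
  let ?H = "local_rep mean_curvature"
  have H: "?H x = mean_curvature q" using q by (simp add: chart_inv[OF chart])
  have ff: "frame_field i q = d\<Phi> x (a i x)" for i by (simp add: frame_field_def frame_def q(2))
  let ?N = "\<lambda>i y. normal_part y (frechet_derivative ?H (at y) (a i y))"
  have smooth_N: "smooth_on (\<psi> ` U) (?N i)" for i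
    by (intro smooth_normal_part smooth_on_directional_derivative smooth_mean_curvature smooth_a open_S)
  have N: "local_rep (\<lambda>p. normal_conn (frame_field i p) mean_curvature p) y = ?N i y" if "y \<in> \<psi> ` U" for i y
    using that normal_conn_eq[OF _ differentiable_mean_curvature]
    by (auto simp: chart_inv[OF chart] frame_field_def frame_def)
  have 1: "normal_conn (frame_field i q) (\<lambda>p. normal_conn (frame_field i p) mean_curvature p) q =
      normal_part x (frechet_derivative (?N i) (at x) (a i x))" for i
    using normal_conn_eq[OF q(1) local_rep_cong(1)[OF N smooth_N q(1)]] local_rep_cong(2)[OF N smooth_N q(1)]
    by (simp add: ff q(2))
  let ?v = "\<lambda>i. \<Sum>j\<in>UNIV. (frechet_derivative (frame i) (at x) (a i x) \<bullet> frame j x) *\<^sub>R a j x"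
  have "tangent_conn (frame_field i q) (frame_field i) q = d\<Phi> x (?v i)" for i
    using tangent_conn_eq[OF q(1) frame_field_derivative(1)[OF _ q(1)]] frame_field_derivative(2)[OF _ q(1)]
    by (simp add: ff q(2) linear_sum[OF linear_d\<Phi>[OF x[unfolded q(2)]]] linear_cmul[OF linear_d\<Phi>[OF x[unfolded q(2)]]]
        frame_def)
  then have 2: "normal_conn (tangent_conn (frame_field i q) (frame_field i) q) mean_curvature q =
      normal_part x (frechet_derivative ?H (at x) (?v i))" for i
    using normal_conn_eq[OF q(1) differentiable_mean_curvature[OF q(1)], of "?v i"] by (simp add: q(2))
  have 3: "second_fundamental_form (shape_operator mean_curvature (frame_field i q) q) (frame_field i) q =
      (norm (mean_curvature q))\<^sup>2 *\<^sub>R normal_part x (frechet_derivative (frame i) (at x) (a i x))" for i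
  proof -
    have "shape_operator mean_curvature (frame_field i q) q = d\<Phi> x ((norm (mean_curvature q))\<^sup>2 *\<^sub>R a i x)"
      using shape_operator_mean_curvature[OF assms(1) q(1), of "a i x"]
      by (simp add: ff q(2)[symmetric] linear_cmul[OF linear_d\<Phi>[OF x]])
    then show ?thesis
      using second_fundamental_form_eq[OF q(1) frame_field_derivative(1)[OF _ q(1)]] frame_field_derivative(2)[OF _ q(1)]
      by (simp add: q(2)[symmetric] linear_cmul[OF smooth_on_linear[OF smooth_frame x]] linear_cmul[OF linear_normal_part])
  qed
  have "normal_laplacian frame_field mean_curvature q
      - (\<Sum>i\<in>UNIV. second_fundamental_form (shape_operator mean_curvature (frame_field i q) q) (frame_field i) q)
      + real CARD('m) *\<^sub>R mean_curvature q = 0"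
    using assms(2) orthonormal_frame_field q(1) unfolding biharmonic_def by blast
  then show ?thesis
    unfolding normal_laplacian_def 1 2 3 scaleR_sum_right[symmetric] local_rep_mean_curvature[OF x, symmetric] H
    by (simp add: power2_norm_eq_inner algebra_simps)
qed

end

context sphere_submanifold
begin

lemma obtain_sphere_chart:
  assumes "(U, \<psi>) \<in> charts"
  obtains a where "sphere_chart M charts \<phi> U \<psi> a"
proof -
  let ?\<Phi> = "\<phi> \<circ> inv_into U \<psi>"
  obtain a :: "'m \<Rightarrow> real ^ 'm \<Rightarrow> real ^ 'm" where a: "\<And>i. smooth_on (\<psi> ` U) (a i)"
    "\<And>x i j. x \<in> \<psi> ` U \<Longrightarrow> frechet_derivative ?\<Phi> (at x) (a i x) \<bullet> frechet_derivative ?\<Phi> (at x) (a j x) =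
      (if i = j then 1 else 0)"
    by (rule gram_schmidt_fields[OF chart_open_image[OF assms] smooth_parametrisation[OF assms]])
      (use inj_parametrisation[OF assms] in auto)
  have "?\<Phi> x \<bullet> ?\<Phi> x = 1" if "x \<in> \<psi> ` U" for x
    using that in_sphere chart_subset[OF assms] by (auto simp: chart_inv[OF assms] dot_square_norm)
  then have "sphere_chart M charts \<phi> U \<psi> a"
    using a assms chart_open_image[OF assms] smooth_parametrisation[OF assms] by unfold_locales auto
  then show ?thesis by (rule that)
qed

text \<open>In a chart \<open>f\<close> is constant on a ball, so every set cut out by a condition
  on the value of \<open>f\<close> is open; the sets where \<open>f\<close> equals and differs from
  \<open>f p\<close> would separate a connected set containing \<open>p\<close> and
  \<open>q\<close>.\<close>

lemma connected_component_constant: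
  assumes const: "\<And>U \<psi> x. (U, \<psi>) \<in> charts \<Longrightarrow> x \<in> \<psi> ` U \<Longrightarrow>
      ((f \<circ> inv_into U \<psi>) has_derivative (\<lambda>_. 0)) (at x)"
    and "connected_component_of M p q"
  shows "f p = f q"
proof -
  have nbhd: "\<exists>T. openin M T \<and> r \<in> T \<and> (\<forall>t\<in>T. f t = f r)" if r: "r \<in> topspace M" for r
  proof -
    obtain U \<psi> where c: "(U, \<psi>) \<in> charts" "r \<in> U" using chart_at[OF r] by metis
    obtain d where d: "d > 0" "ball (\<psi> r) d \<subseteq> \<psi> ` U"
      using open_contains_ball chart_open_image[OF c(1)] c(2) by blast
    have "\<exists>k. \<forall>x\<in>ball (\<psi> r) d. (f \<circ> inv_into U \<psi>) x = k"
    proof (rule has_derivative_zero_constant[OF convex_ball])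
      fix x assume "x \<in> ball (\<psi> r) d"
      then have "x \<in> \<psi> ` U" using d(2) by blast
      from const[OF c(1) this]
      show "((f \<circ> inv_into U \<psi>) has_derivative (\<lambda>h. 0)) (at x within ball (\<psi> r) d)"
        by (rule has_derivative_at_withinI)
    qed
    then obtain k where k: "\<And>x. x \<in> ball (\<psi> r) d \<Longrightarrow> (f \<circ> inv_into U \<psi>) x = k" by blast
    have "f t = k" if "t \<in> U" "\<psi> t \<in> ball (\<psi> r) d" for t
      using k[OF that(2)] that(1) by (simp add: chart_inv[OF c(1)])
    then show ?thesis
      using openin_chart_preimage[OF c(1) open_ball, of "\<psi> r" d] c(2) d(1)
      by (intro exI[of _ "{t \<in> U. \<psi> t \<in> ball (\<psi> r) d}"]) auto
  qed
  have op: "openin M {t \<in> topspace M. P (f t)}" for P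
  proof (subst openin_subopen, clarify)
    fix r assume r: "r \<in> topspace M" "P (f r)"
    obtain T where T: "openin M T" "r \<in> T" "\<And>t. t \<in> T \<Longrightarrow> f t = f r" using nbhd[OF r(1)] by blast
    have "T \<subseteq> {t \<in> topspace M. P (f t)}"
    proof
      fix t assume "t \<in> T"
      then show "t \<in> {t \<in> topspace M. P (f t)}" using T(3)[of t] openin_subset[OF T(1)] r(2) by auto
    qed
    then show "\<exists>T. openin M T \<and> r \<in> T \<and> T \<subseteq> {t \<in> topspace M. P (f t)}"
      using T(1,2) by blast
  qed
  obtain T where T: "connectedin M T" "p \<in> T" "q \<in> T"
    using assms(2) unfolding connected_component_of_def by blast
  show ?thesis
  proof (rule ccontr)
    assume "f p \<noteq> f q"
    let ?E1 = "{t \<in> topspace M. f t = f p}" and ?E2 = "{t \<in> topspace M. f t \<noteq> f p}"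
    have "p \<in> ?E1 \<inter> T" "q \<in> ?E2 \<inter> T"
      using T connectedin_subset_topspace[OF T(1)] \<open>f p \<noteq> f q\<close> by auto
    then have "?E1 \<inter> T \<noteq> {}" "?E2 \<inter> T \<noteq> {}" by blast+
    moreover have "T \<subseteq> ?E1 \<union> ?E2" "?E1 \<inter> ?E2 \<inter> T = {}"
      using connectedin_subset_topspace[OF T(1)] by auto
    ultimately have "\<exists>E1 E2. openin M E1 \<and> openin M E2 \<and> T \<subseteq> E1 \<union> E2 \<and> E1 \<inter> E2 \<inter> T = {} \<and> E1 \<inter> T \<noteq> {} \<and> E2 \<inter> T \<noteq> {}"
      using op[of "\<lambda>y. y = f p"] op[of "\<lambda>y. y \<noteq> f p"] by blast
    then show False using T(1)[unfolded connectedin] by (rule conjunct2[THEN notE, rotated])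
  qed
qed

end

lemma biharmonic_derivative_norm_mean_curvature:
  fixes M :: "'a topology" and charts :: "('a set \<times> ('a \<Rightarrow> real ^ 4)) set" and \<phi> :: "'a \<Rightarrow> real ^ 7"
  assumes "sphere_submanifold M charts \<phi>"
    and pu: "sphere_submanifold.pseudo_umbilical M charts \<phi>"
    and bi: "sphere_submanifold.biharmonic M charts \<phi>"
    and c: "(U, \<psi>) \<in> charts" and x: "x \<in> \<psi> ` U"
  shows "(((\<lambda>q. norm (sphere_submanifold.mean_curvature M charts \<phi> q) ^ 2) \<circ> inv_into U \<psi>)
    has_derivative (\<lambda>_. 0)) (at x)"
proof -
  obtain a where "sphere_chart M charts \<phi> U \<psi> a"
    using sphere_submanifold.obtain_sphere_chart[OF assms(1) c] by blast
  then interpret sphere_chart M charts \<phi> U \<psi> a .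
  interpret biharmonic_field "\<psi> ` U" "\<phi> \<circ> inv_into U \<psi>" a "local_rep mean_curvature"
    using local_rep_mean_curvature umbilical_eq[OF pu] bitension_eq[OF pu bi] by unfold_locales simp_all
  have "smooth_on (\<psi> ` U) (\<lambda>y. local_rep mean_curvature y \<bullet> local_rep mean_curvature y)"
    by (intro smooth_on_inner smooth_mean_curvature open_S)
  from smooth_on_has_derivative[OF this x]
  have "((\<lambda>y. local_rep mean_curvature y \<bullet> local_rep mean_curvature y) has_derivative (\<lambda>_. 0)) (at x)"
    unfolding derivative_norm_H_eq_0[OF x, abs_def] .
  then show ?thesis by (simp add: power2_norm_eq_inner o_def)
qed

theorem corollary1p6:
  fixes M :: "'a topology"
    and charts :: "('a set \<times> ('a \<Rightarrow> real ^ 4)) set"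
    and \<phi> :: "'a \<Rightarrow> real ^ 7"
  assumes "sphere_submanifold M charts \<phi>"
    and "sphere_submanifold.pseudo_umbilical M charts \<phi>"
    and "sphere_submanifold.biharmonic M charts \<phi>"
    and "connected_component_of M p q"
  shows "norm (sphere_submanifold.mean_curvature M charts \<phi> p) =
         norm (sphere_submanifold.mean_curvature M charts \<phi> q)"
proof -
  have "norm (sphere_submanifold.mean_curvature M charts \<phi> p) ^ 2 =
      norm (sphere_submanifold.mean_curvature M charts \<phi> q) ^ 2"
    by (rule sphere_submanifold.connected_component_constant[OF assms(1) _ assms(4)])
      (rule biharmonic_derivative_norm_mean_curvature[OF assms(1-3)])
  then show ?thesis by simp
qed

end
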